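(* Let $n\in\mathbb{N}$ and let $V:\mathbb{R}^n\to\mathbb{R}$ be continuous and bounded below. Suppose that, as a multiplication operator with domain $D(V)=\{f\in L^2(\mathbb{R}^n): Vf\in L^2(\mathbb{R}^n)\}$, $V$ is relatively $(-\Delta)$-bounded with relative bound strictly less than one, so that $H=-\Delta+V$ is self-adjoint on the domain $H^2(\mathbb{R}^n)\subseteq D(V)$. Let $\psi$ be an eigenfunction of $H$ with associated eigenvalue $E\in\mathbb{R}$, and suppose $\psi\in L^\infty(\mathbb{R}^n)$. Let $\phi\in C^1([0,+\infty))$ be an increasing function with $\phi\ge 1$, $$\lim_{t\to+\infty}\phi(t)=\infty,\qquad 0<M_\phi:=\sup_{t\in[0,\infty)}\left|\frac{\phi'(t)}{\phi(t)}\right|<\infty .$$ Suppose that $\epsilon,\delta>0$ satisfy $$\max\{0,1-M_\phi^{-2}\}<\epsilon<1$$ and $$\chi_{\{V\le E+\delta\}}\,\phi\big((1-\epsilon)\rho_E\big)\in L^2(\mathbb{R}^n),$$ where $\rho_E(x)$ is the Agmon distance of $x$ to the origin associated with $V$ and $E$. Then there exists a constant $0<c_{\epsilon,\delta}<\infty$ such that $$\int_{\mathbb{R}^n}\phi\big((1-\epsilon)\rho_E(x)\big)^2\,|\psi(x)|^2\,\mathrm{d}^n x\le c_{\epsilon,\delta}.$$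
   Context: $-\Delta$ is the self-adjoint Laplacian on $L^2(\mathbb{R}^n)$ with domain $H^2(\mathbb{R}^n)$. For continuous $V:\mathbb{R}^n\to\mathbb{R}$ and $E\in\mathbb{R}$, the Agmon metric is the pseudo-metric $$\rho_E(x,y):=\inf_{\gamma\in P_{x,y}}\int_0^1 (V(\gamma(t))-E)_+^{1/2}\,|\dot\gamma(t)|\,\mathrm{d}t,$$ where $P_{x,y}$ is the set of absolutely continuous paths $\gamma:[0,1]\to\mathbb{R}^n$ with $\gamma(0)=x$, $\gamma(1)=y$, and $(V-E)_+:=\max\{V-E,0\}$. The Agmon distance to the origin is $\rho_E(x):=\rho_E(x,0)$. $\chi_A$ denotes the characteristic function of a set $A$, and $\{V\le E+\delta\}=\{x\in\mathbb{R}^n: V(x)\le E+\delta\}$. "Increasing" means $s\le t$ implies $\phi(s)\le\phi(t)$ (not necessarily strictly). *)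

theory Defs
  imports "HOL-Analysis.Analysis"
begin

text \<open>
  \<open>L\<^sup>2\<close> consists of functions, not of classes; operators are identified up to equality almost
  everywhere.
\<close>

definition L2 :: "(real ^ 'n \<Rightarrow> 'b::real_normed_vector) set" where
  "L2 = {f \<in> borel_measurable lebesgue. integrable lebesgue (\<lambda>x. (norm (f x))\<^sup>2)}"

definition L2_norm :: "(real ^ 'n \<Rightarrow> 'b::real_normed_vector) \<Rightarrow> real" where
  "L2_norm f = sqrt (\<integral>x. (norm (f x))\<^sup>2 \<partial>lebesgue)"

definition essentially_bounded :: "(real ^ 'n \<Rightarrow> 'b::real_normed_vector) \<Rightarrow> bool" where
  "essentially_bounded f \<longleftrightarrow>
     f \<in> borel_measurable lebesgue \<and> (\<exists>C. AE x in lebesgue. norm (f x) \<le> C)"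

primrec C_k :: "nat \<Rightarrow> (real ^ 'n \<Rightarrow> complex) \<Rightarrow> bool" where
  "C_k 0 f \<longleftrightarrow> continuous_on UNIV f"
| "C_k (Suc k) f \<longleftrightarrow>
     f differentiable_on UNIV \<and> (\<forall>v. C_k k (\<lambda>x. frechet_derivative f (at x) v))"

definition test_function :: "(real ^ 'n \<Rightarrow> complex) \<Rightarrow> bool" where
  "test_function \<eta> \<longleftrightarrow> (\<forall>k. C_k k \<eta>) \<and> compact (closure {x. \<eta> x \<noteq> 0})"

definition has_weak_deriv ::
    "'n \<Rightarrow> (real ^ 'n \<Rightarrow> complex) \<Rightarrow> (real ^ 'n \<Rightarrow> complex) \<Rightarrow> bool" where
  "has_weak_deriv i f g \<longleftrightarrow>
     (\<forall>\<eta>. test_function \<eta> \<longrightarrow>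
        (\<integral>x. f x * frechet_derivative \<eta> (at x) (axis i 1) \<partial>lebesgue)
          = - (\<integral>x. g x * \<eta> x \<partial>lebesgue))"

text \<open>
  The choice in \<open>weak_deriv\<close> is only among functions that agree almost everywhere. The condition
  \<open>g \<in> L2\<close> keeps the integrals in \<open>has_weak_deriv\<close> meaningful.
\<close>

definition weak_deriv :: "'n \<Rightarrow> (real ^ 'n \<Rightarrow> complex) \<Rightarrow> real ^ 'n \<Rightarrow> complex" where
  "weak_deriv i f = (SOME g. g \<in> L2 \<and> has_weak_deriv i f g)"

definition H1 :: "(real ^ 'n \<Rightarrow> complex) set" where
  "H1 = {f \<in> L2. \<forall>i. \<exists>g \<in> L2. has_weak_deriv i f g}"

definition H2 :: "(real ^ 'n \<Rightarrow> complex) set" where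
  "H2 = {f \<in> H1. \<forall>i. weak_deriv i f \<in> H1}"

definition laplacian :: "(real ^ 'n \<Rightarrow> complex) \<Rightarrow> real ^ 'n \<Rightarrow> complex" where
  "laplacian f = (\<lambda>x. \<Sum>i\<in>UNIV. weak_deriv i (weak_deriv i f) x)"

text \<open>An unbounded operator is a pair of a domain and an action; only the action on the domain
  matters.\<close>

type_synonym 'n operator =
  "(real ^ 'n \<Rightarrow> complex) set \<times> ((real ^ 'n \<Rightarrow> complex) \<Rightarrow> real ^ 'n \<Rightarrow> complex)"

definition neg_laplacian :: "('n::finite) operator" where
  "neg_laplacian = (H2, \<lambda>f x. - laplacian f x)"

definition mult_operator :: "(real ^ 'n \<Rightarrow> real) \<Rightarrow> ('n::finite) operator" where
  "mult_operator V =
     ({f \<in> L2. (\<lambda>x. complex_of_real (V x) * f x) \<in> L2}, \<lambda>f x. complex_of_real (V x) * f x)"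

definition schroedinger :: "(real ^ 'n \<Rightarrow> real) \<Rightarrow> ('n::finite) operator" where
  "schroedinger V = (H2, \<lambda>f x. snd neg_laplacian f x + snd (mult_operator V) f x)"

definition admissible_bounds :: "('n::finite) operator \<Rightarrow> 'n operator \<Rightarrow> real set" where
  "admissible_bounds A T =
     {a. 0 \<le> a \<and> (\<exists>b\<ge>0. \<forall>f \<in> fst T. L2_norm (snd A f) \<le> a * L2_norm (snd T f) + b * L2_norm f)}"

definition relatively_bounded :: "('n::finite) operator \<Rightarrow> 'n operator \<Rightarrow> bool" where
  "relatively_bounded A T \<longleftrightarrow> fst T \<subseteq> fst A \<and> admissible_bounds A T \<noteq> {}"

definition relative_bound :: "('n::finite) operator \<Rightarrow> 'n operator \<Rightarrow> real" where
  "relative_bound A T = Inf (admissible_bounds A T)"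

definition eigenfunction :: "('n::finite) operator \<Rightarrow> real \<Rightarrow> (real ^ 'n \<Rightarrow> complex) \<Rightarrow> bool" where
  "eigenfunction T E \<psi> \<longleftrightarrow>
     \<psi> \<in> fst T \<and> \<not> (AE x in lebesgue. \<psi> x = 0) \<and>
     (AE x in lebesgue. snd T \<psi> x = complex_of_real E * \<psi> x)"

definition abs_continuous :: "real \<Rightarrow> real \<Rightarrow> (real \<Rightarrow> 'a::metric_space) \<Rightarrow> bool" where
  "abs_continuous a b \<gamma> \<longleftrightarrow>
     (\<forall>e>0. \<exists>d>0. \<forall>D. finite D \<and> (\<forall>(s, t) \<in> D. a \<le> s \<and> s \<le> t \<and> t \<le> b) \<and>
        disjoint_family_on (\<lambda>(s, t). {s<..<t}) D \<and> (\<Sum>(s, t)\<in>D. t - s) < d \<longrightarrow>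
        (\<Sum>(s, t)\<in>D. dist (\<gamma> s) (\<gamma> t)) < e)"

definition agmon_paths :: "real ^ 'n \<Rightarrow> real ^ 'n \<Rightarrow> (real \<Rightarrow> real ^ 'n) set" where
  "agmon_paths x y = {\<gamma>. abs_continuous 0 1 \<gamma> \<and> \<gamma> 0 = x \<and> \<gamma> 1 = y}"

text \<open>
  An absolutely continuous path is differentiable almost everywhere on \<open>[0,1]\<close> and the integrand
  is then Lebesgue integrable; the unspecified values of \<open>vector_derivative\<close> on a null set do not
  matter.
\<close>

definition agmon_length :: "(real ^ 'n \<Rightarrow> real) \<Rightarrow> real \<Rightarrow> (real \<Rightarrow> real ^ 'n) \<Rightarrow> real" where
  "agmon_length V E \<gamma> =
     (LINT t:{0..1}|lebesgue. sqrt (max (V (\<gamma> t) - E) 0) * norm (vector_derivative \<gamma> (at t)))"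

definition agmon_metric :: "(real ^ 'n \<Rightarrow> real) \<Rightarrow> real \<Rightarrow> real ^ 'n \<Rightarrow> real ^ 'n \<Rightarrow> real" where
  "agmon_metric V E x y = (INF \<gamma>\<in>agmon_paths x y. agmon_length V E \<gamma>)"

definition agmon_dist :: "(real ^ 'n \<Rightarrow> real) \<Rightarrow> real \<Rightarrow> real ^ 'n \<Rightarrow> real" where
  "agmon_dist V E x = agmon_metric V E x 0"

end

theory Submission
  imports Defs
begin

text \<open>
  Agmon's argument. Multiplying \<open>-\<Delta>\<psi> + (V - E)\<psi> = 0\<close> by \<open>g\<^sup>2\<close> times the conjugate of \<open>\<psi>\<close>, for a real
  compactly supported \<open>C\<^sup>1\<close> weight \<open>g\<close>, and integrating by parts gives
  \<open>\<integral> (V - E) g\<^sup>2 |\<psi>|\<^sup>2 \<le> \<integral> |\<nabla>g|\<^sup>2 |\<psi>|\<^sup>2\<close>; this is done for mollifications of \<open>\<psi>\<close>, and the limit only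
  needs \<open>L\<^sup>1\<close> convergence because \<open>\<psi>\<close> and \<open>(V - E)\<psi>\<close> are locally bounded.
  The Agmon distance satisfies \<open>|\<nabla>\<rho>|\<^sup>2 \<le> (V - E)\<^sub>+\<close> in the Lipschitz sense, so \<open>ln \<phi>((1 - \<epsilon>)\<rho>)\<close> has slope
  at most \<open>a\<close> times \<open>sqrt ((V - E)\<^sub>+)\<close> with \<open>a = M (1 - \<epsilon>) < 1\<close>. Taking for \<open>g\<close> a cutoff at radius \<open>R\<close> times the
  weight truncated at \<open>R\<close> (smoothed on the logarithmic scale), the gradient term is absorbed where
  \<open>V > E + \<delta>\<close>, while the set \<open>V \<le> E + \<delta>\<close> is controlled by the hypothesis and \<open>|\<psi>| \<le> C\<close>.
  Finally let \<open>R\<close> tend to infinity with Fatou's lemma.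
\<close>

section \<open>Smooth bump functions\<close>

text \<open>Completing the square eliminates the gradient of \<psi>, so only \<psi> and its
  Laplacian have to converge under mollification. Translates of the mollifier are test functions;
  therefore mollification commutes with weak derivatives, and the Laplacian of the mollified \<psi>
  is the mollification of \<open>(V - E) \<psi>\<close>. The gradient bound on the Agmon distance is
  kept as a difference bound: if \<open>max (V - E) 0 \<le> B\<^sup>2\<close> on a segment, the
  values at its ends differ by at most \<open>B\<close> times its length. This form passes to
  truncated logarithms and turns into a pointwise gradient bound once the function is mollified. The
  gap \<open>1 - a\<^sup>2\<close> is spent twice: \<open>\<eta>\<close> separates the gradient of
  the cutoff from that of the weight, and \<open>\<tau>\<close> covers the loss in mollifying the
  weight. \<open>agmon_length\<close> is a Bochner integral, with value 0 should it diverge. A path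
  and its extension by a segment are therefore compared in \<open>ennreal\<close>, in both
  directions, before real lengths are compared.\<close>

lemma C_k_continuous: "C_k k f \<Longrightarrow> continuous_on UNIV f"
  by (cases k) (auto simp: differentiable_imp_continuous_on)

lemma C_k_SucD: "C_k (Suc k) f \<Longrightarrow> C_k k f"
proof (induction k arbitrary: f)
  case 0
  then show ?case by (auto simp: differentiable_imp_continuous_on)
next
  case (Suc k)
  then show ?case by (metis C_k.simps(2))
qed

text \<open>Differentiation rules yield \<open>has_derivative\<close>, while \<open>C_k\<close> is
  phrased with \<open>frechet_derivative\<close>; uniqueness of derivatives bridges the two.\<close>

lemma C_k_SucI:
  assumes "\<And>x. (f has_derivative (\<lambda>v. D v x)) (at x)" "\<And>v. C_k k (D v)"
  shows "C_k (Suc k) f"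
proof -
  have "frechet_derivative f (at x) = (\<lambda>v. D v x)" for x
    using frechet_derivative_at[OF assms(1)[of x]] by simp
  moreover have "f differentiable_on UNIV"
    using assms(1) by (auto simp: differentiable_on_def differentiable_def)
  ultimately show ?thesis
    using assms(2) by simp
qed

lemma C_k_SucE:
  assumes "C_k (Suc k) f"
  obtains D where "\<And>x. (f has_derivative (\<lambda>v. D v x)) (at x)" "\<And>v. C_k k (D v)"
proof
  show "(f has_derivative (\<lambda>v. frechet_derivative f (at x) v)) (at x)" for x
    using assms by (simp add: differentiable_on_def frechet_derivative_works[symmetric])
  show "C_k k (\<lambda>x. frechet_derivative f (at x) v)" for v
    using assms by simp
qed

lemma C_k_const: "C_k k (\<lambda>x. c)"
proof (induction k arbitrary: c)
  case (Suc k)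
  show ?case
    by (rule C_k_SucI[where D="\<lambda>v x. 0"]) (auto intro: Suc)
qed auto

lemma C_k_of_real_inner_diff: "C_k k (\<lambda>x. complex_of_real ((x - a) \<bullet> v))"
proof (cases k)
  case 0
  then show ?thesis by (auto intro!: continuous_intros)
next
  case (Suc k')
  show ?thesis unfolding Suc
    by (rule C_k_SucI[where D="\<lambda>w x. complex_of_real (w \<bullet> v)"])
       (auto intro!: derivative_eq_intros C_k_const)
qed

lemma C_k_add: "C_k k f \<Longrightarrow> C_k k g \<Longrightarrow> C_k k (\<lambda>x. f x + g x)"
proof (induction k arbitrary: f g)
  case (Suc k)
  obtain D where D: "\<And>x. (f has_derivative (\<lambda>v. D v x)) (at x)" "\<And>v. C_k k (D v)"
    using C_k_SucE Suc by blast
  obtain F where F: "\<And>x. (g has_derivative (\<lambda>v. F v x)) (at x)" "\<And>v. C_k k (F v)"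
    using C_k_SucE Suc by blast
  show ?case
    by (rule C_k_SucI[where D="\<lambda>v x. D v x + F v x"])
       (auto intro!: derivative_eq_intros D F Suc)
qed (auto intro!: continuous_intros)

lemma C_k_mult: "C_k k f \<Longrightarrow> C_k k g \<Longrightarrow> C_k k (\<lambda>x. f x * g x)"
proof (induction k arbitrary: f g)
  case (Suc k)
  obtain D where D: "\<And>x. (f has_derivative (\<lambda>v. D v x)) (at x)" "\<And>v. C_k k (D v)"
    using C_k_SucE Suc by blast
  obtain F where F: "\<And>x. (g has_derivative (\<lambda>v. F v x)) (at x)" "\<And>v. C_k k (F v)"
    using C_k_SucE Suc by blast
  show ?case
    by (rule C_k_SucI[where D="\<lambda>v x. f x * F v x + D v x * g x"])
       (auto intro!: derivative_eq_intros D F Suc C_k_add C_k_SucD[OF Suc.prems(1)] C_k_SucD[OF Suc.prems(2)])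
qed (auto intro!: continuous_intros)

text \<open>The family \<open>exp (-1/s) / s ^ m\<close> contains the standard bump profile and is closed under
  differentiation up to linear combinations.\<close>

definition flat :: "nat \<Rightarrow> real \<Rightarrow> real" where
  "flat m s = (if s \<le> 0 then 0 else exp (- (1 / s)) / s ^ m)"

lemma flat_nonneg: "0 \<le> flat m s"
  by (simp add: flat_def)

text \<open>This is differentiability of \<open>flat m\<close> at the origin. On the right,
  \<open>y = 1/s\<close> turns the quotient into \<open>y ^ (m + 1) / exp y\<close>.\<close>

lemma flat_quotient_tendsto: "((\<lambda>s. flat m s / s) \<longlongrightarrow> 0) (at 0)"
proof (rule filterlim_split_at)
  show "((\<lambda>s. flat m s / s) \<longlongrightarrow> 0) (at_left 0)"
    by (rule Lim_transform_eventually[OF tendsto_const])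
       (auto simp: flat_def eventually_at_filter)
  have "((\<lambda>y::real. y ^ Suc m / exp y) \<longlongrightarrow> 0) at_top"
    by (rule tendsto_power_div_exp_0)
  then have "((\<lambda>s::real. inverse s ^ Suc m / exp (inverse s)) \<longlongrightarrow> 0) (at_right 0)"
    by (rule filterlim_compose[OF _ filterlim_inverse_at_top_right])
  then show "((\<lambda>s. flat m s / s) \<longlongrightarrow> 0) (at_right 0)"
    by (rule Lim_transform_eventually)
       (auto simp: flat_def exp_minus field_simps intro!: eventually_mono[OF eventually_at_right_less])
qed

lemma flat_has_real_derivative [derivative_intros]:
  "(flat m has_real_derivative (flat (m + 2) s - m * flat (m + 1) s)) (at s)"
proof -
  consider "s < 0" | "s = 0" | "s > 0" by linarith
  then show ?thesis
  proof cases
    case 1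
    have "((\<lambda>s. 0) has_real_derivative 0) (at s)" by simp
    then have "(flat m has_real_derivative 0) (at s)"
      by (rule has_field_derivative_transform_within_open[where S="{..<0}"])
         (use 1 in \<open>auto simp: flat_def\<close>)
    then show ?thesis using 1 by (simp add: flat_def)
  next
    case 2
    then show ?thesis
      using flat_quotient_tendsto[of m] by (simp add: has_field_derivative_iff flat_def)
  next
    case 3
    have exp': "((\<lambda>s. exp (- (1 / s))) has_real_derivative exp (- (1 / s)) / s\<^sup>2) (at s)"
      using 3 by (auto intro!: derivative_eq_intros simp: power2_eq_square)
    have "((\<lambda>s. exp (- (1 / s)) / s ^ m) has_real_derivative
        (exp (- (1 / s)) / s\<^sup>2 * s ^ m - exp (- (1 / s)) * (real m * s ^ (m - Suc 0))) / (s ^ m * s ^ m)) (at s)"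
      using DERIV_divide[OF exp' DERIV_pow[of m s UNIV]] 3 by simp
    also have "(exp (- (1 / s)) / s\<^sup>2 * s ^ m - exp (- (1 / s)) * (real m * s ^ (m - Suc 0))) / (s ^ m * s ^ m)
        = flat (m + 2) s - m * flat (m + 1) s"
      \<comment> \<open>Splitting on \<open>m\<close> settles the truncated exponent
        \<open>m - Suc 0\<close>: for \<open>m = 0\<close> its coefficient is zero.\<close>
      using 3 by (cases m) (simp_all add: flat_def field_simps power2_eq_square)
    finally have "((\<lambda>s. exp (- (1 / s)) / s ^ m) has_real_derivative
             (flat (m + 2) s - m * flat (m + 1) s)) (at s)" .
    then show ?thesis
      by (rule has_field_derivative_transform_within_open[where S="{0<..}"])
         (use 3 in \<open>auto simp: flat_def\<close>)
  qed
qed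

lemma continuous_on_flat [continuous_intros]:
  "continuous_on S f \<Longrightarrow> continuous_on S (\<lambda>x. flat m (f x))"
  by (rule continuous_on_compose2[of UNIV "flat m"])
     (auto intro!: DERIV_continuous_on[where D="\<lambda>s. flat (m + 2) s - m * flat (m + 1) s"]
       has_field_derivative_at_within flat_has_real_derivative)

text \<open>A derivative either hits \<open>P\<close> or multiplies it by
  \<open>(y - a) \<bullet> v\<close> and raises the index by one or two, so the induction runs over
  all \<open>P\<close> and \<open>m\<close>. Smoothness of \<open>P\<close> to every order keeps the
  class closed.\<close>

lemma C_k_flat:
  "(\<And>j. C_k j P) \<Longrightarrow>
    C_k k (\<lambda>y. P y * complex_of_real (flat m (r\<^sup>2 - (y - a) \<bullet> (y - a))))"
proof (induction k arbitrary: P m)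
  case 0
  have "continuous_on UNIV P" using C_k_continuous 0 by blast
  then show ?case by (auto intro!: continuous_intros)
next
  case (Suc k)
  let ?s = "\<lambda>y. r\<^sup>2 - (y - a) \<bullet> (y - a)"
  obtain D where D: "\<And>x. (P has_derivative (\<lambda>v. D v x)) (at x)" "\<And>v. C_k k (D v)"
    using C_k_SucE Suc.prems by blast
  \<comment> \<open>\<open>D\<close> came with order \<open>k\<close> only; uniqueness of the
    derivative gives every order.\<close>
  have D': "C_k j (D v)" for j v
  proof -
    have "frechet_derivative P (at x) = (\<lambda>v. D v x)" for x
      using frechet_derivative_at[OF D(1)[of x]] by simp
    then show ?thesis using Suc.prems[of "Suc j"] by simp
  qed
  have flat': "((\<lambda>y. flat m (?s y)) has_derivative
      (\<lambda>v. (flat (m + 2) (?s x) - m * flat (m + 1) (?s x)) * (- 2 * ((x - a) \<bullet> v)))) (at x)" for x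
  proof -
    have "(?s has_derivative (\<lambda>v. - 2 * ((x - a) \<bullet> v))) (at x)"
      by (auto intro!: derivative_eq_intros simp: inner_commute)
    from has_derivative_compose[OF this
        flat_has_real_derivative[unfolded has_field_derivative_def, of m "?s x"]]
    show ?thesis by simp
  qed
  show ?case
  proof (rule C_k_SucI[where D="\<lambda>v y. D v y * complex_of_real (flat m (?s y))
      + (P y * (complex_of_real ((y - a) \<bullet> v) * (-2))) * complex_of_real (flat (m + 2) (?s y))
      + (P y * (complex_of_real ((y - a) \<bullet> v) * (2 * of_nat m))) * complex_of_real (flat (m + 1) (?s y))"])
    show "((\<lambda>y. P y * complex_of_real (flat m (?s y))) has_derivative
       (\<lambda>v. D v x * complex_of_real (flat m (?s x))
      + (P x * (complex_of_real ((x - a) \<bullet> v) * (-2))) * complex_of_real (flat (m + 2) (?s x))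
      + (P x * (complex_of_real ((x - a) \<bullet> v) * (2 * of_nat m))) * complex_of_real (flat (m + 1) (?s x))))
      (at x)" for x
      by (rule derivative_eq_intros D flat' refl)+ (auto simp: algebra_simps)
  qed (intro C_k_add C_k_mult Suc.IH C_k_of_real_inner_diff C_k_const D' Suc.prems)+
qed

section \<open>Mollification\<close>

text \<open>Borel measurability is built in so that convolutions are jointly measurable and Fubini
  over \<open>lborel\<close> applies; elements of \<open>L2\<close> enter through Borel
  representatives.\<close>

definition locally_integrable :: "('a::euclidean_space \<Rightarrow> 'b::{banach,second_countable_topology}) \<Rightarrow> bool" where
  "locally_integrable f \<longleftrightarrow>
     f \<in> borel_measurable borel \<and> (\<forall>R. integrable lborel (\<lambda>x. indicator (cball 0 R) x *\<^sub>R f x))"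

lemma integrable_compact_support:
  fixes f :: "'a::euclidean_space \<Rightarrow> 'b::{banach,second_countable_topology}"
  assumes "continuous_on UNIV f" "\<And>x. norm x > R \<Longrightarrow> f x = 0"
  shows "integrable lborel f"
proof -
  have "integrable lborel (\<lambda>x. indicator (cball 0 R) x *\<^sub>R f x)"
    by (rule borel_integrable_compact) (auto intro: continuous_on_subset[OF assms(1)])
  also have "(\<lambda>x. indicator (cball 0 R) x *\<^sub>R f x) = f"
    using assms(2) by (auto simp: fun_eq_iff indicator_def not_le)
  finally show ?thesis .
qed

lemma compact_support_bounded:
  fixes f :: "'a::euclidean_space \<Rightarrow> 'b::real_normed_vector"
  assumes "continuous_on UNIV f" "\<And>x. norm x > R \<Longrightarrow> f x = 0"
  obtains B where "0 < B" "\<And>x. norm (f x) \<le> B"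
proof -
  have "compact (f ` cball 0 R)"
    by (intro compact_continuous_image continuous_on_subset[OF assms(1)]) auto
  then obtain B where B: "0 < B" "\<And>x. x \<in> cball 0 R \<Longrightarrow> norm (f x) \<le> B"
    using compact_imp_bounded bounded_pos by (metis imageI)
  have "norm (f x) \<le> B" for x
    using B(1) B(2)[of x] assms(2)[of x] by (cases "norm x > R") auto
  with B(1) show ?thesis using that by blast
qed

lemma locally_integrable_scaleR_compact_support:
  fixes f :: "'a::euclidean_space \<Rightarrow> 'b::{banach,second_countable_topology}"
  assumes f: "locally_integrable f" and K: "continuous_on UNIV K" "\<And>x. norm x > R \<Longrightarrow> K x = 0"
  shows "integrable lborel (\<lambda>x. K x *\<^sub>R f x)"
proof -
  obtain B where B: "0 < B" "\<And>x. norm (K x) \<le> B"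
    using compact_support_bounded K by blast
  have [measurable]: "f \<in> borel_measurable borel" "K \<in> borel_measurable borel"
    using f K by (auto simp: locally_integrable_def intro: borel_measurable_continuous_onI)
  show ?thesis
  proof (rule Bochner_Integration.integrable_bound)
    show "integrable lborel (\<lambda>x. B *\<^sub>R (indicator (cball 0 R) x *\<^sub>R f x))"
      using f by (intro integrable_scaleR_right) (simp add: locally_integrable_def)
    show "AE x in lborel. norm (K x *\<^sub>R f x) \<le> norm (B *\<^sub>R (indicator (cball 0 R) x *\<^sub>R f x))"
      using B K(2) by (intro AE_I2) (auto simp: indicator_def not_le intro!: mult_right_mono)
  qed measurable
qed

lemma continuous_locally_integrable:
  fixes f :: "'a::euclidean_space \<Rightarrow> 'b::{banach,second_countable_topology}"
  assumes "continuous_on UNIV f"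
  shows "locally_integrable f"
  unfolding locally_integrable_def
  by (auto intro!: borel_integrable_compact continuous_on_subset[OF assms]
      borel_measurable_continuous_onI[OF assms])

lemma locally_integrable_diff:
  fixes f g :: "'a::euclidean_space \<Rightarrow> 'b::{banach,second_countable_topology}"
  assumes "locally_integrable f" "locally_integrable g"
  shows "locally_integrable (\<lambda>y. f y - g y)"
  using assms by (auto simp: locally_integrable_def scaleR_diff_right)

lemma lborel_integral_translate:
  fixes f :: "'a::euclidean_space \<Rightarrow> 'b::{banach,second_countable_topology}"
  assumes [measurable]: "f \<in> borel_measurable borel"
  shows "(\<integral>x. f (c + x) \<partial>lborel) = (\<integral>x. f x \<partial>lborel)"
  by (subst (2) lborel_distr_plus[symmetric, of c]) (simp add: integral_distr)

lemma lborel_integral_reflect: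
  fixes f :: "'a::euclidean_space \<Rightarrow> 'b::{banach,second_countable_topology}"
  assumes [measurable]: "f \<in> borel_measurable borel"
  shows "(\<integral>x. f (c - x) \<partial>lborel) = (\<integral>x. f x \<partial>lborel)"
proof -
  have *: "lborel = distr lborel borel (\<lambda>x::'a. c - x)"
    using lborel_affine[of "-1" c] by (simp add: density_1)
  show ?thesis
    by (subst (2) *) (simp add: integral_distr)
qed

text \<open>Difference quotients are the form of a derivative to which dominated convergence along
  null sequences applies.\<close>

lemma has_vector_derivative_at_iff_tendsto:
  "(f has_vector_derivative D) (at t) \<longleftrightarrow> ((\<lambda>h. (f (t + h) - f t) /\<^sub>R h) \<longlongrightarrow> D) (at 0)"
proof -
  have "norm (f (t + h) - f t - h *\<^sub>R D) / norm h = norm ((f (t + h) - f t) /\<^sub>R h - D)" if "h \<noteq> 0" for h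
  proof -
    have "(f (t + h) - f t) /\<^sub>R h - D = inverse h *\<^sub>R (f (t + h) - f t - h *\<^sub>R D)"
      using that by (simp add: algebra_simps)
    then show ?thesis by (simp add: divide_inverse_commute)
  qed
  then have "((\<lambda>h. norm (f (t + h) - f t - h *\<^sub>R D) / norm h) \<longlongrightarrow> 0) (at 0) \<longleftrightarrow>
      ((\<lambda>h. norm ((f (t + h) - f t) /\<^sub>R h - D)) \<longlongrightarrow> 0) (at 0)"
    by (intro Lim_cong_within) auto
  then show ?thesis
    by (simp add: has_vector_derivative_def has_derivative_at bounded_linear_scaleR_left
        tendsto_norm_zero_iff LIM_zero_iff)
qed

lemma convolution_continuous:
  fixes f :: "'a::euclidean_space \<Rightarrow> 'b::{banach,second_countable_topology}"
  assumes f: "locally_integrable f"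
    and K: "continuous_on UNIV K" "\<And>z. norm z > r \<Longrightarrow> K z = 0"
  shows "continuous_on UNIV (\<lambda>x. \<integral>y. K (x - y) *\<^sub>R f y \<partial>lborel)"
proof (rule continuous_on_sequentiallyI)
  fix u :: "nat \<Rightarrow> 'a" and a assume u: "u \<longlonglongrightarrow> a"
  obtain B where B: "0 < B" "\<And>x. norm (K x) \<le> B"
    using compact_support_bounded K by blast
  have [measurable]: "f \<in> borel_measurable borel" "K \<in> borel_measurable borel"
    using f K by (auto simp: locally_integrable_def intro: borel_measurable_continuous_onI)
  \<comment> \<open>Boundedness of the centres keeps the supports of all kernels in one ball, which
    supplies the dominating function.\<close>
  from u have "Bseq u" by (simp add: convergent_imp_Bseq convergentI)
  then obtain C where C: "\<And>n. norm (u n) \<le> C" by (auto simp: Bseq_def)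
  show "(\<lambda>n. \<integral>y. K (u n - y) *\<^sub>R f y \<partial>lborel) \<longlonglongrightarrow> (\<integral>y. K (a - y) *\<^sub>R f y \<partial>lborel)"
  proof (rule integral_dominated_convergence)
    show "integrable lborel (\<lambda>y. B * norm (indicator (cball 0 (C + r)) y *\<^sub>R f y))"
      using f by (intro integrable_mult_right integrable_norm) (simp add: locally_integrable_def)
    show "AE y in lborel. (\<lambda>n. K (u n - y) *\<^sub>R f y) \<longlonglongrightarrow> K (a - y) *\<^sub>R f y"
    proof (intro AE_I2 tendsto_intros)
      fix y
      have "isCont K (a - y)" using K(1) by (simp add: continuous_on_eq_continuous_at)
      then show "(\<lambda>n. K (u n - y)) \<longlonglongrightarrow> K (a - y)"
        by (rule isCont_tendsto_compose) (intro tendsto_intros u)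
    qed
    fix n
    show "AE y in lborel. norm (K (u n - y) *\<^sub>R f y) \<le> B * norm (indicator (cball 0 (C + r)) y *\<^sub>R f y)"
    proof (rule AE_I2)
      fix y
      have "norm y > C + r \<Longrightarrow> norm (u n - y) > r"
        using C[of n] norm_triangle_ineq2[of y "u n"] by (simp add: norm_minus_commute)
      then show "norm (K (u n - y) *\<^sub>R f y) \<le> B * norm (indicator (cball 0 (C + r)) y *\<^sub>R f y)"
        using B K(2)[of "u n - y"] by (auto simp: indicator_def not_le intro!: mult_right_mono)
    qed
  qed measurable
qed

text \<open>The derivative falls on the kernel, so \<open>f\<close> only has to be locally
  integrable. The mean value inequality bounds the difference quotients of \<open>K\<close> by
  \<open>B\<close>, and for bounded steps their supports stay in one ball, so dominated convergence
  applies.\<close>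

lemma convolution_has_vector_derivative:
  fixes f :: "'a::euclidean_space \<Rightarrow> 'b::{banach,second_countable_topology}"
  assumes f: "locally_integrable f"
    and K: "\<And>z. (K has_derivative K' z) (at z)" "\<And>z. norm z > r \<Longrightarrow> K z = 0"
    and B: "\<And>z. norm (K' z v) \<le> B"
    and K'_meas: "(\<lambda>z. K' z v) \<in> borel_measurable borel"
  shows "((\<lambda>t. \<integral>y. K (x + t *\<^sub>R v - y) *\<^sub>R f y \<partial>lborel) has_vector_derivative
           (\<integral>y. K' (x - y) v *\<^sub>R f y \<partial>lborel)) (at 0)"
unfolding has_vector_derivative_at_iff_tendsto tendsto_at_iff_sequentially comp_def
proof (intro allI impI)
  fix t :: "nat \<Rightarrow> real" assume t: "\<forall>i. t i \<in> UNIV - {0}" "t \<longlonglongrightarrow> 0"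
  have K_cont: "continuous_on UNIV K"
    using K(1) by (meson continuous_at_imp_continuous_on has_derivative_continuous)
  have [measurable]: "f \<in> borel_measurable borel" "K \<in> borel_measurable borel"
    "(\<lambda>z. K' z v) \<in> borel_measurable borel"
    using f K_cont K'_meas by (auto simp: locally_integrable_def intro: borel_measurable_continuous_onI)
  have B0: "0 \<le> B" using B[of 0] norm_ge_zero order_trans by blast
  from t have "Bseq t" by (simp add: convergent_imp_Bseq convergentI)
  then obtain C where C: "\<And>n. norm (t n) \<le> C" by (auto simp: Bseq_def)
  define R where "R = norm x + C * norm v + r"
  have lip: "norm (K (x + s *\<^sub>R v - y) - K (x - y)) \<le> \<bar>s\<bar> * B" for s y
  proof -
    have "norm (K (x + s *\<^sub>R v - y) - K (x + 0 *\<^sub>R v - y)) \<le> B * norm (s - 0)"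
    proof (rule differentiable_bound[of UNIV "\<lambda>s. K (x + s *\<^sub>R v - y)" "\<lambda>s h. K' (x + s *\<^sub>R v - y) (h *\<^sub>R v)"])
      fix s :: real
      show "((\<lambda>s. K (x + s *\<^sub>R v - y)) has_derivative (\<lambda>h. K' (x + s *\<^sub>R v - y) (h *\<^sub>R v))) (at s)"
        by (rule has_derivative_compose[of "\<lambda>s. x + s *\<^sub>R v - y" "\<lambda>h. h *\<^sub>R v" s UNIV K, OF _ K(1)])
           (auto intro!: derivative_eq_intros)
      have lin: "linear (K' z)" for z using K(1)[of z] has_derivative_linear by blast
      show "onorm (\<lambda>h. K' (x + s *\<^sub>R v - y) (h *\<^sub>R v)) \<le> B"
        by (rule onorm_le) (use B B0 lin in \<open>auto simp: linear_scale abs_mult mult.commute[of B] intro: mult_left_mono\<close>)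
    qed auto
    then show ?thesis by (simp add: mult.commute)
  qed
  have intK: "integrable lborel (\<lambda>y. K (z - y) *\<^sub>R f y)" for z
  proof (rule locally_integrable_scaleR_compact_support[OF f, of _ "norm z + r"])
    show "continuous_on UNIV (\<lambda>y. K (z - y))"
      by (intro continuous_on_compose2[OF K_cont] continuous_intros) auto
    show "K (z - y) = 0" if "norm y > norm z + r" for y
      using that norm_triangle_ineq2[of y z] by (intro K) (simp add: norm_minus_commute)
  qed
  have "(\<lambda>n. \<integral>y. ((K (x + t n *\<^sub>R v - y) - K (x - y)) / t n) *\<^sub>R f y \<partial>lborel)
      \<longlonglongrightarrow> (\<integral>y. K' (x - y) v *\<^sub>R f y \<partial>lborel)"
  proof (rule integral_dominated_convergence)
    show "integrable lborel (\<lambda>y. B * norm (indicator (cball 0 R) y *\<^sub>R f y))"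
      using f by (intro integrable_mult_right integrable_norm) (simp add: locally_integrable_def)
    show "AE y in lborel. (\<lambda>n. ((K (x + t n *\<^sub>R v - y) - K (x - y)) / t n) *\<^sub>R f y) \<longlonglongrightarrow> K' (x - y) v *\<^sub>R f y"
    proof (intro AE_I2 tendsto_scaleR tendsto_const)
      fix y
      have lin: "linear (K' z)" for z using K(1)[of z] has_derivative_linear by blast
      have "((\<lambda>s. K (x + s *\<^sub>R v - y)) has_derivative (\<lambda>h. K' (x + 0 *\<^sub>R v - y) (h *\<^sub>R v))) (at 0)"
        by (rule has_derivative_compose[of "\<lambda>s. x + s *\<^sub>R v - y" "\<lambda>h. h *\<^sub>R v" 0 UNIV K, OF _ K(1)])
           (auto intro!: derivative_eq_intros)
      then have "((\<lambda>s. K (x + s *\<^sub>R v - y)) has_real_derivative K' (x - y) v) (at 0)"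
        unfolding has_field_derivative_def
        by (rule has_derivative_eq_rhs) (simp add: lin linear_scale fun_eq_iff)
      then have "((\<lambda>s. (K (x + s *\<^sub>R v - y) - K (x - y)) / s) \<longlongrightarrow> K' (x - y) v) (at 0)"
        by (simp add: has_field_derivative_iff)
      then show "(\<lambda>n. (K (x + t n *\<^sub>R v - y) - K (x - y)) / t n) \<longlonglongrightarrow> K' (x - y) v"
        using t by (simp add: tendsto_at_iff_sequentially comp_def)
    qed
    fix n
    show "AE y in lborel. norm (((K (x + t n *\<^sub>R v - y) - K (x - y)) / t n) *\<^sub>R f y)
        \<le> B * norm (indicator (cball 0 R) y *\<^sub>R f y)"
    proof (rule AE_I2)
      fix y
      have tv: "norm (t n *\<^sub>R v) \<le> C * norm v" "0 \<le> C * norm v"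
        using C[of n] by (auto intro: mult_right_mono order_trans[OF norm_ge_zero C])
      have tn: "t n \<noteq> 0" using t by auto
      show "norm (((K (x + t n *\<^sub>R v - y) - K (x - y)) / t n) *\<^sub>R f y)
        \<le> B * norm (indicator (cball 0 R) y *\<^sub>R f y)"
      proof (cases "norm y \<le> R")
        case True
        have "norm ((K (x + t n *\<^sub>R v - y) - K (x - y)) / t n) \<le> B"
          using lip[of "t n" y] tn by (simp add: pos_divide_le_eq mult.commute)
        then have "norm ((K (x + t n *\<^sub>R v - y) - K (x - y)) / t n) * norm (f y) \<le> B * norm (f y)"
          by (rule mult_right_mono) simp
        then show ?thesis using True by (simp add: abs_mult)
      next
        case False
        have "norm (x - y) > r"
          using False tv(2) norm_triangle_ineq2[of y x] by (simp add: R_def norm_minus_commute)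
        moreover have "norm (x + t n *\<^sub>R v - y) > r"
          using False tv(1) norm_triangle_ineq2[of y "x + t n *\<^sub>R v"] norm_triangle_ineq[of x "t n *\<^sub>R v"]
          unfolding R_def norm_minus_commute[of _ y] by linarith
        ultimately show ?thesis using K(2) B0 by simp
      qed
    qed
  qed measurable
  then show "(\<lambda>n. ((\<integral>y. K (x + (0 + t n) *\<^sub>R v - y) *\<^sub>R f y \<partial>lborel) - (\<integral>y. K (x + 0 *\<^sub>R v - y) *\<^sub>R f y \<partial>lborel)) /\<^sub>R t n)
      \<longlonglongrightarrow> (\<integral>y. K' (x - y) v *\<^sub>R f y \<partial>lborel)"
    by (simp add: intK divide_inverse_commute scaleR_left_diff_distrib scaleR_diff_right
        flip: Bochner_Integration.integral_diff scaleR_scaleR integral_scaleR_right)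
qed

text \<open>The standard bump \<open>exp (- 1 / (r\<^sup>2 - |x|\<^sup>2))\<close> on the ball of
  radius \<open>r\<close>; the squared norm keeps it smooth at the origin.\<close>

definition bump :: "real \<Rightarrow> 'a::euclidean_space \<Rightarrow> real" where
  "bump r x = flat 0 (r\<^sup>2 - x \<bullet> x)"

definition mollifier :: "real \<Rightarrow> 'a::euclidean_space \<Rightarrow> real" where
  "mollifier r x = bump r x / (\<integral>y. bump r (y::'a) \<partial>lborel)"

text \<open>The chain rule for \<open>bump\<close>: \<open>flat 2\<close> is the derivative of
  \<open>flat 0\<close>, because the term with coefficient \<open>m\<close> disappears. The last
  argument is the direction.\<close>

definition mollifier_deriv :: "real \<Rightarrow> 'a::euclidean_space \<Rightarrow> 'a \<Rightarrow> real" where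
  "mollifier_deriv r x v = flat 2 (r\<^sup>2 - x \<bullet> x) * (- 2 * (x \<bullet> v)) / (\<integral>y. bump r (y::'a) \<partial>lborel)"

definition mollify ::
    "real \<Rightarrow> ('a::euclidean_space \<Rightarrow> 'b::{banach,second_countable_topology}) \<Rightarrow> 'a \<Rightarrow> 'b" where
  "mollify r f x = (\<integral>y. mollifier r (x - y) *\<^sub>R f y \<partial>lborel)"

lemma flat_norm_eq_0:
  fixes x :: "'a::euclidean_space"
  assumes "r > 0" "norm x \<ge> r"
  shows "flat m (r\<^sup>2 - x \<bullet> x) = 0"
  using power_mono[OF assms(2), of 2] assms by (auto simp: flat_def power2_norm_eq_inner)

text \<open>A nonnegative integrand with integral zero vanishes almost everywhere, which would make
  the open ball of radius \<open>r\<close> a null set.\<close>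

lemma integral_bump_pos:
  assumes r: "r > 0"
  shows "0 < (\<integral>y. bump r (y::'a::euclidean_space) \<partial>lborel)"
proof -
  have int: "integrable lborel (bump r :: 'a \<Rightarrow> real)"
    by (rule integrable_compact_support[of _ r])
       (use r in \<open>auto simp: bump_def flat_norm_eq_0 intro!: continuous_intros\<close>)
  have nonneg: "0 \<le> bump r x" for x :: 'a by (simp add: bump_def flat_nonneg)
  have "(\<integral>y. bump r (y::'a) \<partial>lborel) \<noteq> 0"
  proof
    assume "(\<integral>y. bump r (y::'a) \<partial>lborel) = 0"
    then have "AE y::'a in lborel. bump r y = 0"
      using integral_nonneg_eq_0_iff_AE[OF int] nonneg by simp
    moreover have "bump r y \<noteq> 0" if "y \<in> ball 0 r" for y :: 'a
    proof -
      have "(norm y)\<^sup>2 < r\<^sup>2" using that r by (intro power_strict_mono) auto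
      then show ?thesis by (simp add: bump_def flat_def power2_norm_eq_inner)
    qed
    ultimately have "AE y::'a in lborel. y \<notin> ball 0 r" by (auto elim: eventually_mono)
    then have "ball (0::'a) r \<in> null_sets lborel" by (simp add: AE_iff_null_sets)
    then have "negligible (ball (0::'a) r)"
      by (simp add: negligible_iff_null_sets null_sets_completionI)
    then show False using r by (simp add: open_not_negligible)
  qed
  moreover have "0 \<le> (\<integral>y. bump r (y::'a) \<partial>lborel)" by (simp add: nonneg)
  ultimately show ?thesis by linarith
qed

context
  fixes r :: real
  assumes r: "r > 0"
begin

lemma mollifier_nonneg: "0 \<le> mollifier r (x :: 'a::euclidean_space)"
  using integral_bump_pos[OF r, where 'a='a]
  by (simp add: mollifier_def bump_def flat_nonneg)

lemma mollifier_eq_0: "norm x \<ge> r \<Longrightarrow> mollifier r (x :: 'a::euclidean_space) = 0"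
  using r by (simp add: mollifier_def bump_def flat_norm_eq_0)

lemma mollifier_continuous: "continuous_on UNIV (mollifier r :: 'a::euclidean_space \<Rightarrow> real)"
  unfolding mollifier_def bump_def using integral_bump_pos[OF r, where 'a='a]
  by (auto simp: bump_def intro!: continuous_intros)

lemma mollifier_measurable: "(mollifier r :: 'a::euclidean_space \<Rightarrow> real) \<in> borel_measurable borel"
  by (rule borel_measurable_continuous_onI[OF mollifier_continuous])

lemma integral_mollifier: "(\<integral>x. mollifier r (x::'a::euclidean_space) \<partial>lborel) = 1"
  unfolding mollifier_def using integral_bump_pos[OF r, where 'a='a] by simp

lemma mollifier_has_derivative:
  "(mollifier r has_derivative mollifier_deriv r x) (at (x :: 'a::euclidean_space))"
proof -
  have "((\<lambda>x. r\<^sup>2 - x \<bullet> x) has_derivative (\<lambda>v. - 2 * (x \<bullet> v))) (at x)"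
    by (auto intro!: derivative_eq_intros simp: inner_commute)
  from has_derivative_compose[OF this
      flat_has_real_derivative[unfolded has_field_derivative_def, of 0 "r\<^sup>2 - x \<bullet> x"]]
  have "((\<lambda>x. bump r x) has_derivative (\<lambda>v. flat 2 (r\<^sup>2 - x \<bullet> x) * (- 2 * (x \<bullet> v)))) (at x)"
    by (simp add: bump_def numeral_2_eq_2)
  from has_derivative_divide'[OF this has_derivative_const[of "\<integral>y. bump r (y::'a) \<partial>lborel"]]
  show ?thesis
    using integral_bump_pos[OF r, where 'a='a]
    by (simp add: mollifier_def[abs_def] mollifier_deriv_def[abs_def] fun_eq_iff)
qed

lemma mollifier_deriv_continuous:
  "continuous_on UNIV (\<lambda>x. mollifier_deriv r (x :: 'a::euclidean_space) v)"
  unfolding mollifier_deriv_def using integral_bump_pos[OF r, where 'a='a]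
  by (auto intro!: continuous_intros)

lemma mollifier_deriv_eq_0: "norm x \<ge> r \<Longrightarrow> mollifier_deriv r (x :: 'a::euclidean_space) v = 0"
  using r by (simp add: mollifier_deriv_def flat_norm_eq_0)

lemma mollify_integrable:
  fixes f :: "'a::euclidean_space \<Rightarrow> 'b::{banach,second_countable_topology}"
  assumes "locally_integrable f"
  shows "integrable lborel (\<lambda>y. mollifier r (x - y) *\<^sub>R f y)"
proof (rule locally_integrable_scaleR_compact_support[OF assms, of _ "norm x + r"])
  show "continuous_on UNIV (\<lambda>y. mollifier r (x - y))"
    by (intro continuous_on_compose2[OF mollifier_continuous] continuous_intros) auto
  show "mollifier r (x - y) = 0" if "norm y > norm x + r" for y
    using that norm_triangle_ineq2[of y x] by (intro mollifier_eq_0) (simp add: norm_minus_commute)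
qed

lemma mollify_continuous:
  fixes f :: "'a::euclidean_space \<Rightarrow> 'b::{banach,second_countable_topology}"
  assumes "locally_integrable f"
  shows "continuous_on UNIV (mollify r f)"
  unfolding mollify_def[abs_def]
  by (rule convolution_continuous[OF assms mollifier_continuous, of r]) (simp add: mollifier_eq_0)

lemma mollify_deriv_continuous:
  fixes f :: "'a::euclidean_space \<Rightarrow> 'b::{banach,second_countable_topology}"
  assumes "locally_integrable f"
  shows "continuous_on UNIV (\<lambda>x. \<integral>y. mollifier_deriv r (x - y) v *\<^sub>R f y \<partial>lborel)"
  by (rule convolution_continuous[OF assms mollifier_deriv_continuous, of r])
     (simp add: mollifier_deriv_eq_0)

lemma mollify_has_vector_derivative:
  fixes f :: "'a::euclidean_space \<Rightarrow> 'b::{banach,second_countable_topology}"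
  assumes "locally_integrable f"
  shows "((\<lambda>t. mollify r f (x + t *\<^sub>R v)) has_vector_derivative
            (\<integral>y. mollifier_deriv r (x - y) v *\<^sub>R f y \<partial>lborel)) (at 0)"
proof -
  have "mollifier_deriv r z v = 0" if "norm z > r" for z :: 'a
    using that by (intro mollifier_deriv_eq_0) simp
  then obtain B where B: "0 < B" "\<And>z::'a. norm (mollifier_deriv r z v) \<le> B"
    using compact_support_bounded[OF mollifier_deriv_continuous] by blast
  show ?thesis unfolding mollify_def
    by (rule convolution_has_vector_derivative[OF assms mollifier_has_derivative, of r _ B])
       (use B in \<open>auto simp: mollifier_eq_0 intro: borel_measurable_continuous_onI[OF mollifier_deriv_continuous]\<close>)
qed

lemma integral_mollifier_translate: "(\<integral>y. mollifier r (x - y :: 'a::euclidean_space) \<partial>lborel) = 1"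
  using lborel_integral_reflect[OF mollifier_measurable, of x] integral_mollifier by metis

text \<open>The mollification is an average with total mass one over points closer than
  \<open>r\<close>, so a bound near \<open>x\<close> suffices.\<close>

lemma norm_mollify_le:
  fixes f :: "'a::euclidean_space \<Rightarrow> 'b::{banach,second_countable_topology}"
  assumes f: "locally_integrable f" and C: "AE y in lborel. norm (x - y) < r \<longrightarrow> norm (f y) \<le> C"
  shows "norm (mollify r f x) \<le> C"
proof -
  have one: "integrable lborel (\<lambda>y. mollifier r (x - y))"
    using mollify_integrable[OF continuous_locally_integrable[of "\<lambda>_. 1::real"], of x] by simp
  have "norm (mollify r f x) \<le> (\<integral>y. norm (mollifier r (x - y) *\<^sub>R f y) \<partial>lborel)"
    unfolding mollify_def by (rule integral_norm_bound)
  also have "\<dots> \<le> (\<integral>y. mollifier r (x - y) * C \<partial>lborel)"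
  proof (rule integral_mono_AE)
    show "AE y in lborel. norm (mollifier r (x - y) *\<^sub>R f y) \<le> mollifier r (x - y) * C"
      using C
    proof eventually_elim
      case (elim y)
      then show ?case
        by (cases "norm (x - y) < r") (auto simp: mollifier_eq_0 mollifier_nonneg intro: mult_left_mono)
    qed
  qed (use integrable_norm[OF mollify_integrable[OF f, of x]] one in auto)
  also have "\<dots> = C" by (simp add: integral_mollifier_translate)
  finally show ?thesis .
qed

lemma mollify_const:
  "mollify r (\<lambda>_::'a::euclidean_space. c :: 'b::{banach,second_countable_topology}) x = c"
proof -
  have one: "integrable lborel (\<lambda>y. mollifier r (x - y))"
    using mollify_integrable[OF continuous_locally_integrable[of "\<lambda>_. 1::real"], of x] by simp
  then show ?thesis by (simp add: mollify_def integral_mollifier_translate)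
qed

lemma mollify_diff:
  fixes f g :: "'a::euclidean_space \<Rightarrow> 'b::{banach,second_countable_topology}"
  assumes "locally_integrable f" "locally_integrable g"
  shows "mollify r (\<lambda>y. f y - g y) x = mollify r f x - mollify r g x"
  unfolding mollify_def
  by (simp add: scaleR_diff_right Bochner_Integration.integral_diff mollify_integrable assms)

text \<open>Constants are fixed by mollification, so the difference is an average of
  \<open>f y - f x\<close>.\<close>

lemma norm_mollify_diff_le:
  fixes f :: "'a::euclidean_space \<Rightarrow> 'b::{banach,second_countable_topology}"
  assumes f: "locally_integrable f" and C: "\<And>y. norm (x - y) < r \<Longrightarrow> norm (f y - f x) \<le> C"
  shows "norm (mollify r f x - f x) \<le> C"
proof -
  have c: "locally_integrable (\<lambda>_::'a. f x)" by (rule continuous_locally_integrable) simp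
  have "mollify r f x - f x = mollify r (\<lambda>y. f y - f x) x"
    using mollify_diff[OF f c] by (simp add: mollify_const)
  also have "norm \<dots> \<le> C"
    by (rule norm_mollify_le) (use f c C in \<open>auto intro: locally_integrable_diff\<close>)
  finally show ?thesis .
qed

text \<open>This admits the kernel itself into \<open>has_weak_deriv\<close>, so weak derivatives of
  a function become classical derivatives of its mollification.\<close>

lemma test_function_mollifier:
  fixes x :: "real ^ 'n"
  shows "test_function (\<lambda>y. complex_of_real (mollifier r (x - y)))"
proof -
  have "closure {y. complex_of_real (mollifier r (x - y)) \<noteq> 0} \<subseteq> cball x r"
    by (rule closure_minimal) (auto simp: dist_norm intro: ccontr mollifier_eq_0)
  then have "compact (closure {y. complex_of_real (mollifier r (x - y)) \<noteq> 0})"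
    by (simp add: compact_eq_bounded_closed bounded_subset[of "cball x r"])
  moreover have "C_k k (\<lambda>y. complex_of_real (mollifier r (x - y)))" for k
  proof -
    have "(\<lambda>y. complex_of_real (mollifier r (x - y))) =
      (\<lambda>y. complex_of_real (1 / (\<integral>y. bump r (y :: real ^ 'n) \<partial>lborel)) *
         complex_of_real (flat 0 (r\<^sup>2 - (y - x) \<bullet> (y - x))))"
      by (auto simp: mollifier_def bump_def inner_diff inner_commute add.commute)
    then show ?thesis by (simp only: C_k_flat[OF C_k_const])
  qed
  ultimately show ?thesis by (simp add: test_function_def)
qed

text \<open>The differentiation is in the subtracted variable; the resulting sign cancels the one in
  \<open>has_weak_deriv\<close>.\<close>

lemma frechet_derivative_mollifier:
  fixes x y :: "real ^ 'n"
  shows "frechet_derivative (\<lambda>y. complex_of_real (mollifier r (x - y))) (at y) v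
           = - complex_of_real (mollifier_deriv r (x - y) v)"
proof -
  have "((\<lambda>y. mollifier r (x - y)) has_derivative (\<lambda>v. mollifier_deriv r (x - y) (- v))) (at y)"
    by (rule has_derivative_compose[of "\<lambda>y. x - y" "\<lambda>v. - v" y UNIV, OF _ mollifier_has_derivative])
       (auto intro!: derivative_eq_intros)
  then have "((\<lambda>y. complex_of_real (mollifier r (x - y))) has_derivative
      (\<lambda>v. complex_of_real (mollifier_deriv r (x - y) (- v)))) (at y)"
    by (rule has_derivative_of_real)
  from frechet_derivative_at[OF this, symmetric] show ?thesis
    by (simp add: mollifier_deriv_def)
qed

end

section \<open>L1 convergence of mollifications\<close>

lemma locally_integrable_bounded:
  fixes f :: "'a::euclidean_space \<Rightarrow> 'b::{banach,second_countable_topology}"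
  assumes [measurable]: "f \<in> borel_measurable borel" and C: "\<And>R. \<exists>C. \<forall>x\<in>cball 0 R. norm (f x) \<le> C"
  shows "locally_integrable f"
  unfolding locally_integrable_def
proof (intro conjI allI)
  fix R
  obtain C where C: "\<And>x. x \<in> cball 0 R \<Longrightarrow> norm (f x) \<le> C" using C by blast
  show "integrable lborel (\<lambda>x. indicator (cball 0 R) x *\<^sub>R f x)"
  proof (rule Bochner_Integration.integrable_bound)
    show "integrable lborel (\<lambda>x::'a. C * indicator (cball 0 R) x :: real)"
      by (intro integrable_mult_right integrable_real_indicator)
         (auto simp: emeasure_lborel_cball_finite[unfolded infinity_ennreal_def])
    show "AE x in lborel. norm (indicator (cball 0 R) x *\<^sub>R f x) \<le> norm (C * indicator (cball 0 R) x)"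
      using C by (intro AE_I2) (force simp: indicator_def)
  qed (auto intro!: borel_measurable_scaleR borel_measurable_indicator)
qed fact

text \<open>Measurability yields continuous functions \<open>h n\<close> converging almost
  everywhere, but without a common bound or support. The clamp \<open>cl\<close> and the cutoff
  \<open>cut\<close> provide both and leave \<open>f\<close> unchanged, so the limit is still
  \<open>f\<close> and dominated convergence applies.\<close>

lemma continuous_approximation_L1:
  fixes f :: "'a::euclidean_space \<Rightarrow> 'b::euclidean_space"
  assumes [measurable]: "f \<in> borel_measurable borel"
    and f: "\<And>x. norm (f x) \<le> C" "\<And>x. norm x > R \<Longrightarrow> f x = 0" and e: "e > 0"
  obtains g where "continuous_on UNIV g" "\<And>x. norm x > R + 1 \<Longrightarrow> g x = 0"
    "(\<integral>x. norm (f x - g x) \<partial>lborel) < e" "integrable lborel (\<lambda>x. norm (f x - g x))"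
proof -
  have "f \<in> borel_measurable lebesgue" by (rule measurable_completion) simp
  then have "f measurable_on UNIV" by (intro lebesgue_measurable_imp_measurable_on) auto
  then obtain N h where N: "negligible N" and h: "\<And>n. continuous_on UNIV (h n)"
      "\<And>x. x \<notin> N \<Longrightarrow> (\<lambda>n. h n x) \<longlonglongrightarrow> f x"
    by (auto simp: measurable_on_def)
  \<comment> \<open>The maximum with 1 makes \<open>D\<close> positive, so that the denominator in
    \<open>cl\<close> never vanishes.\<close>
  define D where "D = max C 1"
  have D: "D > 0" "norm (f x) \<le> D" for x using f(1)[of x] by (auto simp: D_def)
  define cl where "cl z = (D / max D (norm z)) *\<^sub>R z" for z :: 'b
  have maxD: "max D (norm z) > 0" "max D (norm z) \<noteq> 0" for z :: 'b using D(1) by auto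
  have cl_bound: "norm (cl z) \<le> D" for z
  proof -
    have "norm (cl z) = D * norm z / max D (norm z)" using D(1) by (simp add: cl_def)
    also have "\<dots> \<le> D" using maxD(1)[of z] D(1) by (simp add: pos_divide_le_eq)
    finally show ?thesis .
  qed
  have cl_id: "cl z = z" if "norm z \<le> D" for z using that D(1) by (simp add: cl_def max_def)
  have cl_cont: "continuous_on UNIV cl"
    unfolding cl_def by (intro continuous_intros) (use maxD in auto)
  define cut :: "'a \<Rightarrow> real" where "cut x = max 0 (min 1 (R + 1 - norm x))" for x
  define g where "g n x = cut x *\<^sub>R cl (h n x)" for n x
  have g_cont: "continuous_on UNIV (g n)" for n
    unfolding g_def cut_def by (intro continuous_intros continuous_on_compose2[OF cl_cont] h) auto
  have g_supp: "g n x = 0" if "norm x > R + 1" for n x using that by (simp add: g_def cut_def)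
  have [measurable]: "g n \<in> borel_measurable borel" for n
    by (rule borel_measurable_continuous_onI[OF g_cont])
  have g_bound: "norm (g n x) \<le> D" for n x
  proof -
    have "norm (g n x) \<le> 1 * norm (cl (h n x))" unfolding g_def norm_scaleR
      by (rule mult_right_mono) (auto simp: cut_def)
    then show ?thesis using cl_bound[of "h n x"] by linarith
  qed
  have int: "integrable lborel (\<lambda>x::'a. 2 * D * indicator (cball 0 (R + 1)) x :: real)"
    by (intro integrable_mult_right integrable_real_indicator)
       (auto simp: emeasure_lborel_cball_finite[unfolded infinity_ennreal_def])
  have bound: "AE x in lborel. norm (norm (f x - g n x)) \<le> 2 * D * indicator (cball 0 (R + 1)) x" for n
  proof (rule AE_I2)
    fix x
    show "norm (norm (f x - g n x)) \<le> 2 * D * indicator (cball 0 (R + 1)) x"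
    proof (cases "norm x \<le> R + 1")
      case True
      then show ?thesis using norm_triangle_ineq4[of "f x" "g n x"] D(2)[of x] g_bound[of n x] by simp
    next
      case False
      then show ?thesis using f(2)[of x] g_supp[of x n] by simp
    qed
  qed
  have "AE x in lebesgue. x \<notin> N"
    using N by (simp add: negligible_iff_null_sets AE_not_in)
  then have "AE x in lborel. x \<notin> N" by (simp add: AE_completion_iff)
  then have lim: "AE x in lborel. (\<lambda>n. norm (f x - g n x)) \<longlonglongrightarrow> 0"
  proof eventually_elim
    case (elim x)
    have "(\<lambda>n. cl (h n x)) \<longlonglongrightarrow> cl (f x)"
      using cl_cont h(2)[OF elim] by (auto simp: continuous_on_eq_continuous_at intro: isCont_tendsto_compose)
    then have "(\<lambda>n. norm (f x - g n x)) \<longlonglongrightarrow> norm (f x - cut x *\<^sub>R f x)"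
      unfolding g_def by (intro tendsto_intros) (simp add: cl_id D(2))
    moreover have "f x = cut x *\<^sub>R f x" using f(2)[of x] by (cases "norm x > R") (auto simp: cut_def)
    ultimately show ?case by simp
  qed
  have "(\<lambda>n. \<integral>x. norm (f x - g n x) \<partial>lborel) \<longlonglongrightarrow> (\<integral>x. 0 \<partial>(lborel :: 'a measure))"
    by (rule integral_dominated_convergence[OF _ _ int lim bound]) auto
  then have "\<forall>\<^sub>F n in sequentially. (\<integral>x. norm (f x - g n x) \<partial>lborel) < e"
    using e by (auto intro: order_tendstoD)
  then obtain n where "(\<integral>x. norm (f x - g n x) \<partial>lborel) < e"
    by (auto simp: eventually_sequentially)
  moreover have "integrable lborel (\<lambda>x. norm (f x - g n x))"
    by (rule integrable_dominated_convergence2[OF _ _ int lim bound]) auto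
  ultimately show ?thesis using g_cont g_supp that by blast
qed

text \<open>Exchanging the integrals leaves the kernel mass 1 in front of \<open>norm (f y)\<close>.
  Nonnegative integrals allow both sides to be infinite.\<close>

lemma nn_integral_mollify_le:
  fixes f :: "'a::euclidean_space \<Rightarrow> 'b::{banach,second_countable_topology}"
  assumes r: "r > 0" and f: "locally_integrable f"
  shows "(\<integral>\<^sup>+x. norm (mollify r f x) \<partial>lborel) \<le> (\<integral>\<^sup>+x. norm (f x) \<partial>lborel)"
proof -
  have [measurable]: "f \<in> borel_measurable borel" using f by (simp add: locally_integrable_def)
  note [measurable] = mollifier_measurable[OF r, where 'a='a]
  have "(\<integral>\<^sup>+x. norm (mollify r f x) \<partial>lborel)
      \<le> (\<integral>\<^sup>+x. \<integral>\<^sup>+y. ennreal (mollifier r (x - y)) * ennreal (norm (f y)) \<partial>lborel \<partial>lborel)"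
  proof (rule nn_integral_mono)
    fix x :: 'a
    have "ennreal (norm (mollify r f x)) \<le> (\<integral>\<^sup>+y. ennreal (norm (mollifier r (x - y) *\<^sub>R f y)) \<partial>lborel)"
      unfolding mollify_def by (rule integral_norm_bound_ennreal[OF mollify_integrable[OF r f]])
    then show "ennreal (norm (mollify r f x)) \<le> (\<integral>\<^sup>+y. ennreal (mollifier r (x - y)) * ennreal (norm (f y)) \<partial>lborel)"
      by (simp add: mollifier_nonneg[OF r] ennreal_mult')
  qed
  also have "\<dots> = (\<integral>\<^sup>+y. \<integral>\<^sup>+x. ennreal (mollifier r (x - y)) * ennreal (norm (f y)) \<partial>lborel \<partial>lborel)"
    by (rule lborel_pair.Fubini'[symmetric]) measurable
  also have "\<dots> = (\<integral>\<^sup>+y. ennreal (norm (f y)) \<partial>lborel)"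
  proof (rule nn_integral_cong)
    fix y :: 'a
    have "integrable lborel (\<lambda>x. mollifier r (x - y))"
      by (rule integrable_compact_support[of _ "norm y + r"])
         (auto intro!: continuous_on_compose2[OF mollifier_continuous[OF r]] continuous_intros mollifier_eq_0[OF r]
           intro: order_trans[OF _ norm_triangle_ineq2])
    then have "(\<integral>\<^sup>+x. ennreal (mollifier r (x - y)) \<partial>lborel) = ennreal (\<integral>x. mollifier r (x - y) \<partial>lborel)"
      by (intro nn_integral_eq_integral) (auto simp: mollifier_nonneg[OF r])
    also have "\<dots> = 1"
      using lborel_integral_translate[OF mollifier_measurable[OF r], of "- y"] integral_mollifier[OF r, where 'a='a] by simp
    finally have "(\<integral>\<^sup>+x. ennreal (mollifier r (x - y)) \<partial>lborel) = 1" .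
    then show "(\<integral>\<^sup>+x. ennreal (mollifier r (x - y)) * ennreal (norm (f y)) \<partial>lborel) = ennreal (norm (f y))"
      by (subst nn_integral_multc) auto
  qed
  finally show ?thesis .
qed

text \<open>A three-term estimate through a continuous \<open>g\<close>: mollification contracts the
  error \<open>f - g\<close> in L1, and it moves \<open>g\<close> little by uniform continuity on a
  bounded region.\<close>

lemma mollify_L1_approx:
  fixes f :: "'a::euclidean_space \<Rightarrow> 'b::euclidean_space"
  assumes [measurable]: "f \<in> borel_measurable borel"
    and f: "\<And>x. norm (f x) \<le> C" "\<And>x. norm x > R \<Longrightarrow> f x = 0" and e: "e > 0"
  obtains r0 where "r0 > 0"
    "\<And>r. 0 < r \<Longrightarrow> r < r0 \<Longrightarrow> (\<integral>\<^sup>+x. norm (mollify r f x - f x) \<partial>lborel) \<le> ennreal e"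
proof -
  obtain g where g: "continuous_on UNIV g" "\<And>x. norm x > R + 1 \<Longrightarrow> g x = 0"
    "(\<integral>x. norm (f x - g x) \<partial>lborel) < e / 3" "integrable lborel (\<lambda>x. norm (f x - g x))"
    using continuous_approximation_L1[of f C R "e / 3"] assms by auto
  have [measurable]: "g \<in> borel_measurable borel" by (rule borel_measurable_continuous_onI[OF g(1)])
  have fg: "(\<integral>\<^sup>+x. norm (f x - g x) \<partial>lborel) \<le> ennreal (e / 3)"
    using g(3) by (subst nn_integral_eq_integral[OF g(4)]) (auto intro: ennreal_leI)
  \<comment> \<open>\<open>g\<close> lives in radius \<open>R + 1\<close> and radii \<open>r\<close>
    stay below 1, so the error for \<open>g\<close> vanishes outside this ball. The larger radius
    \<open>R + 3\<close> below also covers the neighbours of its points.\<close>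
  let ?B = "cball (0::'a) (R + 2)"
  define m where "m = measure lborel ?B"
  \<comment> \<open>Adding 1 to the measure \<open>m\<close> keeps the denominator positive.\<close>
  define e' where "e' = e / (3 * (m + 1))"
  have m: "m \<ge> 0" by (simp add: m_def)
  have e': "e' > 0" "e' * m \<le> e / 3" using m e by (auto simp: e'_def field_simps)
  have "uniformly_continuous_on (cball 0 (R + 3)) g"
    by (intro compact_uniformly_continuous continuous_on_subset[OF g(1)]) auto
  then obtain d where d: "d > 0" "\<And>x y. norm x \<le> R + 3 \<Longrightarrow> norm y \<le> R + 3 \<Longrightarrow> norm (y - x) < d \<Longrightarrow> norm (g y - g x) < e'"
    using e'(1) unfolding uniformly_continuous_on_def dist_norm by (metis mem_cball_0)
  have f_li: "locally_integrable f" by (rule locally_integrable_bounded) (use f in auto)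
  have g_li: "locally_integrable g" by (rule continuous_locally_integrable[OF g(1)])
  show ?thesis
  proof (rule that)
    show "min d 1 > 0" using d by simp
    fix r :: real assume r: "0 < r" "r < min d 1"
    note [measurable] = borel_measurable_continuous_onI[OF mollify_continuous[OF r(1) f_li]]
      borel_measurable_continuous_onI[OF mollify_continuous[OF r(1) g_li]]
    have 1: "(\<integral>\<^sup>+x. norm (mollify r f x - mollify r g x) \<partial>lborel) \<le> ennreal (e / 3)"
      using nn_integral_mollify_le[OF r(1) locally_integrable_diff[OF f_li g_li]] fg
      by (auto simp: mollify_diff[OF r(1) f_li g_li])
    have "(\<integral>\<^sup>+x. norm (mollify r g x - g x) \<partial>lborel) \<le> (\<integral>\<^sup>+x. ennreal e' * indicator ?B x \<partial>lborel)"
    proof (rule nn_integral_mono)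
      fix x
      have "norm (mollify r g x - g x) \<le> (if norm x \<le> R + 2 then e' else 0)"
      proof (rule norm_mollify_diff_le[OF r(1) g_li])
        fix y assume y: "norm (x - y) < r"
        show "norm (g y - g x) \<le> (if norm x \<le> R + 2 then e' else 0)"
        proof (cases "norm x \<le> R + 2")
          case True
          then have "norm (g y - g x) < e'"
            using y r norm_triangle_ineq2[of y x] by (intro d) (auto simp: norm_minus_commute)
          then show ?thesis using True by simp
        next
          case False
          then show ?thesis
            using y r norm_triangle_ineq2[of x y] by (simp add: g(2))
        qed
      qed
      then show "ennreal (norm (mollify r g x - g x)) \<le> ennreal e' * indicator ?B x"
        by (auto simp: indicator_def intro: ennreal_leI split: if_splits)
    qed
    also have "\<dots> = ennreal (e' * m)"
      using e'(1) emeasure_lborel_cball_finite[of "0::'a" "R + 2"]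
      by (simp add: nn_integral_cmult_indicator m_def ennreal_mult emeasure_eq_ennreal_measure)
    also have "\<dots> \<le> ennreal (e / 3)" using e'(2) by (rule ennreal_leI)
    finally have 2: "(\<integral>\<^sup>+x. norm (mollify r g x - g x) \<partial>lborel) \<le> ennreal (e / 3)" .
    have "(\<integral>\<^sup>+x. norm (mollify r f x - f x) \<partial>lborel) \<le>
      (\<integral>\<^sup>+x. ennreal (norm (mollify r f x - mollify r g x)) + ennreal (norm (mollify r g x - g x)) + ennreal (norm (f x - g x)) \<partial>lborel)"
    proof (rule nn_integral_mono)
      fix x
      have "norm (mollify r f x - f x) \<le> norm (mollify r f x - mollify r g x) + norm (mollify r g x - g x) + norm (f x - g x)"
        using norm_triangle_ineq4[of "(mollify r f x - mollify r g x) + (mollify r g x - g x)" "f x - g x"]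
          norm_triangle_ineq[of "mollify r f x - mollify r g x" "mollify r g x - g x"] by simp
      then show "ennreal (norm (mollify r f x - f x)) \<le> ennreal (norm (mollify r f x - mollify r g x)) + ennreal (norm (mollify r g x - g x)) + ennreal (norm (f x - g x))"
        by (simp flip: ennreal_plus)
    qed
    also have "\<dots> \<le> ennreal (e / 3) + ennreal (e / 3) + ennreal (e / 3)"
      using 1 2 fg by (simp add: nn_integral_add add_mono)
    also have "\<dots> = ennreal e" using e by (simp flip: ennreal_plus)
    finally show "(\<integral>\<^sup>+x. norm (mollify r f x - f x) \<partial>lborel) \<le> ennreal e" .
  qed
qed

section \<open>Energy inequality\<close>

lemma has_vector_derivative_line:
  fixes f :: "'a::real_normed_vector \<Rightarrow> 'b::real_normed_vector"
  assumes "\<And>x. ((\<lambda>t. f (x + t *\<^sub>R v)) has_vector_derivative D x) (at 0)"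
  shows "((\<lambda>t. f (x + t *\<^sub>R v)) has_vector_derivative D (x + s *\<^sub>R v)) (at s)"
proof -
  have "(((\<lambda>t. f (x + s *\<^sub>R v + t *\<^sub>R v)) \<circ> (\<lambda>t. t - s)) has_vector_derivative 1 *\<^sub>R D (x + s *\<^sub>R v)) (at s)"
    by (rule vector_diff_chain_at) (auto intro!: derivative_eq_intros assms)
  then show ?thesis by (simp add: comp_def algebra_simps)
qed

text \<open>Difference quotients integrate to zero by translation invariance.\<close>

lemma integral_directional_derivative_eq_0:
  fixes \<Phi> :: "'a::euclidean_space \<Rightarrow> real"
  assumes \<Phi>: "continuous_on UNIV \<Phi>" "\<And>x. norm x > R \<Longrightarrow> \<Phi> x = 0"
    and D: "continuous_on UNIV D"
    and der: "\<And>x. ((\<lambda>t. \<Phi> (x + t *\<^sub>R v)) has_vector_derivative D x) (at 0)"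
  shows "(\<integral>x. D x \<partial>lborel) = 0"
proof -
  \<comment> \<open>Outside the closed ball \<open>\<Phi>\<close> vanishes at all nearby points of
    the line, and hence so does its derivative.\<close>
  have D0: "D x = 0" if "norm x > R" for x
  proof -
    have "isCont (\<lambda>t. norm (x + t *\<^sub>R v)) 0" by (intro continuous_intros)
    then have "((\<lambda>t. norm (x + t *\<^sub>R v)) \<longlongrightarrow> norm (x + 0 *\<^sub>R v)) (nhds 0)"
      using tendsto_at_iff_tendsto_nhds[of "\<lambda>t. norm (x + t *\<^sub>R v)" 0] by (simp add: isCont_def)
    then have "\<forall>\<^sub>F t in nhds 0. norm (x + t *\<^sub>R v) > R"
      by (rule order_tendstoD(1)) (simp add: that)
    then have "\<forall>\<^sub>F t in nhds 0. \<Phi> (x + t *\<^sub>R v) = 0"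
      by eventually_elim (rule \<Phi>(2))
    then have "((\<lambda>t. \<Phi> (x + t *\<^sub>R v)) has_vector_derivative D x) (at 0) \<longleftrightarrow>
        ((\<lambda>t. 0) has_vector_derivative D x) (at 0)"
      by (intro has_vector_derivative_cong_ev) (auto elim: eventually_mono simp: \<Phi>(2)[OF that])
    then have "((\<lambda>t. 0::real) has_vector_derivative D x) (at 0)" using der by simp
    then show ?thesis using vector_derivative_unique_at has_vector_derivative_const by blast
  qed
  obtain B where B: "0 < B" "\<And>x. norm (D x) \<le> B"
    using compact_support_bounded[OF D D0] by blast
  define t where "t n = inverse (real (Suc n))" for n
  have t: "t n > 0" "t n \<le> 1" for n by (auto simp: t_def field_simps)
  have t0: "t \<longlonglongrightarrow> 0" unfolding t_def by (rule LIMSEQ_inverse_real_of_nat)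
  have [measurable]: "\<Phi> \<in> borel_measurable borel" "D \<in> borel_measurable borel"
    using \<Phi>(1) D by (auto intro: borel_measurable_continuous_onI)
  have int: "integrable lborel (\<lambda>x. \<Phi> (w + x))" for w
  proof (rule integrable_compact_support[of _ "R + norm w"])
    show "continuous_on UNIV (\<lambda>x. \<Phi> (w + x))"
      by (intro continuous_on_compose2[OF \<Phi>(1)] continuous_intros) auto
    show "\<Phi> (w + x) = 0" if "norm x > R + norm w" for x
      using that norm_triangle_ineq2[of x "-w"] by (intro \<Phi>) (simp add: add.commute)
  qed
  have "(\<lambda>n. \<integral>x. (\<Phi> (t n *\<^sub>R v + x) - \<Phi> x) / t n \<partial>lborel) \<longlonglongrightarrow> (\<integral>x. D x \<partial>lborel)"
  proof (rule integral_dominated_convergence)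
    \<comment> \<open>All shifts \<open>t n *\<^sub>R v\<close> are at most as long as
      \<open>v\<close>, since \<open>t n \<le> 1\<close>; this fixes the radius of the dominating
      indicator.\<close>
    show "integrable lborel (\<lambda>x. B * indicator (cball 0 (R + norm v)) x :: real)"
      by (intro integrable_mult_right integrable_real_indicator) (auto simp: emeasure_lborel_cball_finite[unfolded infinity_ennreal_def])
    show "AE x in lborel. (\<lambda>n. (\<Phi> (t n *\<^sub>R v + x) - \<Phi> x) / t n) \<longlonglongrightarrow> D x"
    proof (rule AE_I2)
      fix x
      have "((\<lambda>s. (\<Phi> (x + s *\<^sub>R v) - \<Phi> x) / s) \<longlongrightarrow> D x) (at 0)"
        using der[of x] by (simp add: has_real_derivative_iff_has_vector_derivative[symmetric] has_field_derivative_iff)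
      then show "(\<lambda>n. (\<Phi> (t n *\<^sub>R v + x) - \<Phi> x) / t n) \<longlonglongrightarrow> D x"
        using t0 t(1) by (simp add: tendsto_at_iff_sequentially comp_def add.commute less_imp_neq[symmetric])
    qed
    fix n
    show "AE x in lborel. norm ((\<Phi> (t n *\<^sub>R v + x) - \<Phi> x) / t n) \<le> B * indicator (cball 0 (R + norm v)) x"
    proof (rule AE_I2)
      fix x
      show "norm ((\<Phi> (t n *\<^sub>R v + x) - \<Phi> x) / t n) \<le> B * indicator (cball 0 (R + norm v)) x"
      proof (cases "norm x \<le> R + norm v")
        case True
        have "norm (\<Phi> (x + t n *\<^sub>R v) - \<Phi> (x + 0 *\<^sub>R v)) \<le> B * norm (t n - 0)"
        proof (rule differentiable_bound[of UNIV "\<lambda>s. \<Phi> (x + s *\<^sub>R v)" "\<lambda>s h. h *\<^sub>R D (x + s *\<^sub>R v)"])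
          show "((\<lambda>s. \<Phi> (x + s *\<^sub>R v)) has_derivative (\<lambda>h. h *\<^sub>R D (x + s *\<^sub>R v))) (at s)" for s
            using has_vector_derivative_line[of \<Phi> v D x s, OF der] by (simp add: has_vector_derivative_def)
          show "onorm (\<lambda>h. h *\<^sub>R D (x + s *\<^sub>R v)) \<le> B" for s :: real
            by (rule onorm_le) (use B in \<open>auto simp: abs_mult mult.commute[of B] intro: mult_left_mono\<close>)
        qed auto
        then show ?thesis using True t(1)[of n] by (simp add: pos_divide_le_eq add.commute mult.commute)
      next
        case False
        have "norm (t n *\<^sub>R v) \<le> norm v"
          using t[of n] by (simp add: mult_left_le_one_le)
        then have "norm (t n *\<^sub>R v + x) > R"
          using False norm_triangle_ineq2[of x "- (t n *\<^sub>R v)"] by (simp add: add.commute)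
        moreover have "norm x > R" using False norm_ge_zero[of v] by linarith
        ultimately show ?thesis using \<Phi>(2) B(1) by simp
      qed
    qed
  qed measurable
  moreover have "(\<integral>x. (\<Phi> (t n *\<^sub>R v + x) - \<Phi> x) / t n \<partial>lborel) = 0" for n
    using int[of 0] int[of "t n *\<^sub>R v"] by (simp add: lborel_integral_translate)
  ultimately have "(\<lambda>n. 0) \<longlonglongrightarrow> (\<integral>x. D x \<partial>lborel)" by (simp only:)
  then show ?thesis by (simp add: LIMSEQ_const_iff)
qed

text \<open>Integrate the divergence of \<open>g\<^sup>2 (\<nabla>v \<bullet> v)\<close> and complete the square:
  \<open>|p|\<^sup>2 g\<^sup>2 + 2 g \<partial>g (p \<bullet> v) \<ge> - (\<partial>g)\<^sup>2 |v|\<^sup>2\<close>.\<close>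

lemma energy_inequality_direction:
  fixes g g' :: "'a::euclidean_space \<Rightarrow> real" and v p q :: "'a \<Rightarrow> complex"
  assumes cont: "continuous_on UNIV v" "continuous_on UNIV p" "continuous_on UNIV q"
      "continuous_on UNIV g" "continuous_on UNIV g'"
    and v: "\<And>x. ((\<lambda>t. v (x + t *\<^sub>R e)) has_vector_derivative p x) (at 0)"
    and p: "\<And>x. ((\<lambda>t. p (x + t *\<^sub>R e)) has_vector_derivative q x) (at 0)"
    and g: "\<And>x. ((\<lambda>t. g (x + t *\<^sub>R e)) has_vector_derivative g' x) (at 0)"
    and supp: "\<And>x. norm x > R \<Longrightarrow> g x = 0" "\<And>x. norm x > R \<Longrightarrow> g' x = 0"
  shows "(\<integral>x. - ((g x)\<^sup>2 * (q x \<bullet> v x)) \<partial>lborel) \<ge> (\<integral>x. - ((g' x)\<^sup>2 * (norm (v x))\<^sup>2) \<partial>lborel)"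
proof -
  let ?D = "\<lambda>x. 2 * g x * g' x * (p x \<bullet> v x) + (g x)\<^sup>2 * (q x \<bullet> v x + p x \<bullet> p x)"
  have "(\<integral>x. ?D x \<partial>lborel) = 0"
  proof (rule integral_directional_derivative_eq_0[of "\<lambda>x. (g x)\<^sup>2 * (p x \<bullet> v x)" R _ e])
    fix x
    have g2: "((\<lambda>t. (g (x + t *\<^sub>R e))\<^sup>2) has_vector_derivative 2 * g x * g' x) (at 0)"
      using g[of x] unfolding has_real_derivative_iff_has_vector_derivative[symmetric]
      by (auto intro!: derivative_eq_intros)
    have pv: "((\<lambda>t. p (x + t *\<^sub>R e) \<bullet> v (x + t *\<^sub>R e)) has_vector_derivative p x \<bullet> p x + q x \<bullet> v x) (at 0)"
      using bounded_bilinear.has_vector_derivative[OF bounded_bilinear_inner p[of x] v[of x]] by simp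
    have "((\<lambda>t. (g (x + t *\<^sub>R e))\<^sup>2 * (p (x + t *\<^sub>R e) \<bullet> v (x + t *\<^sub>R e))) has_vector_derivative
       (g (x + 0 *\<^sub>R e))\<^sup>2 * (p x \<bullet> p x + q x \<bullet> v x) + (2 * g x * g' x) * (p (x + 0 *\<^sub>R e) \<bullet> v (x + 0 *\<^sub>R e))) (at 0)"
      by (rule has_vector_derivative_mult[OF g2 pv])
    then show "((\<lambda>t. (g (x + t *\<^sub>R e))\<^sup>2 * (p (x + t *\<^sub>R e) \<bullet> v (x + t *\<^sub>R e))) has_vector_derivative ?D x) (at 0)"
      by (simp add: algebra_simps)
  qed (use supp in \<open>auto intro!: continuous_intros cont\<close>)
  moreover have intD: "integrable lborel ?D"
    by (rule integrable_compact_support[of _ R]) (use supp in \<open>auto intro!: continuous_intros cont\<close>)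
  \<comment> \<open>Adding \<open>?D\<close>, whose integral is zero, trades the second derivative
    \<open>q\<close> for the terms of the square.\<close>
  ultimately have "(\<integral>x. - ((g x)\<^sup>2 * (q x \<bullet> v x)) \<partial>lborel) = (\<integral>x. ?D x - (g x)\<^sup>2 * (q x \<bullet> v x) \<partial>lborel)"
    by (subst Bochner_Integration.integral_diff)
       (use supp in \<open>auto intro!: continuous_intros cont integrable_compact_support[of _ R]\<close>)
  also have "\<dots> \<ge> (\<integral>x. - ((g' x)\<^sup>2 * (norm (v x))\<^sup>2) \<partial>lborel)"
  proof (rule integral_mono)
    fix x
    have "norm (g x *\<^sub>R p x + g' x *\<^sub>R v x)^2 \<ge> 0" by simp
    then show "- ((g' x)\<^sup>2 * (norm (v x))\<^sup>2) \<le> ?D x - (g x)\<^sup>2 * (q x \<bullet> v x)"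
      unfolding power2_norm_eq_inner by (simp add: inner_simps inner_commute power2_eq_square algebra_simps)
  next
    show "integrable lborel (\<lambda>x. - ((g' x)\<^sup>2 * (norm (v x))\<^sup>2))"
      "integrable lborel (\<lambda>x. ?D x - (g x)\<^sup>2 * (q x \<bullet> v x))"
      by (rule integrable_compact_support[of _ R]; use supp in \<open>auto intro!: continuous_intros cont\<close>)+
  qed
  finally show ?thesis .
qed

text \<open>Only pure second derivatives enter, so the coordinate directions are estimated one at a
  time; summation restores the Laplacian and the squared gradient.\<close>

lemma energy_inequality:
  fixes g :: "real ^ 'n \<Rightarrow> real" and v :: "real ^ 'n \<Rightarrow> complex"
  assumes cont: "continuous_on UNIV v" "\<And>i. continuous_on UNIV (p i)" "\<And>i. continuous_on UNIV (q i)"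
      "continuous_on UNIV g" "\<And>i. continuous_on UNIV (g' i)"
    and v: "\<And>i x. ((\<lambda>t. v (x + t *\<^sub>R axis i 1)) has_vector_derivative p i x) (at 0)"
    and p: "\<And>i x. ((\<lambda>t. p i (x + t *\<^sub>R axis i 1)) has_vector_derivative q i x) (at 0)"
    and g: "\<And>i x. ((\<lambda>t. g (x + t *\<^sub>R axis i 1)) has_vector_derivative g' i x) (at 0)"
    and supp: "\<And>x. norm x > R \<Longrightarrow> g x = 0" "\<And>i x. norm x > R \<Longrightarrow> g' i x = 0"
  shows "(\<integral>x. (g x)\<^sup>2 * ((\<Sum>i\<in>UNIV. q i x) \<bullet> v x) \<partial>lborel)
          \<le> (\<integral>x. (\<Sum>i\<in>UNIV. (g' i x)\<^sup>2) * (norm (v x))\<^sup>2 \<partial>lborel)"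
proof -
  have int: "integrable lborel (\<lambda>x. (g x)\<^sup>2 * (q i x \<bullet> v x))"
    "integrable lborel (\<lambda>x. (g' i x)\<^sup>2 * (norm (v x))\<^sup>2)" for i
    by (rule integrable_compact_support[of _ R]; use supp in \<open>auto intro!: continuous_intros cont\<close>)+
  have "(\<integral>x. (g x)\<^sup>2 * (q i x \<bullet> v x) \<partial>lborel) \<le> (\<integral>x. (g' i x)\<^sup>2 * (norm (v x))\<^sup>2 \<partial>lborel)" for i
    using energy_inequality_direction[OF cont(1) cont(2) cont(3) cont(4) cont(5) v p g, of R i] supp by simp
  then show ?thesis
    by (simp add: sum_distrib_right sum_distrib_left inner_sum_left int sum_mono)
qed

section \<open>From weak derivatives to the energy inequality for the eigenfunction\<close>

lemma mollify_cong_AE: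
  fixes f g :: "'a::euclidean_space \<Rightarrow> 'b::{banach,second_countable_topology}"
  assumes r: "r > 0" and [measurable]: "f \<in> borel_measurable borel" "g \<in> borel_measurable borel"
    and eq: "AE y in lborel. norm (x - y) < r \<longrightarrow> f y = g y"
  shows "mollify r f x = mollify r g x"
  unfolding mollify_def
proof (rule integral_cong_AE)
  note [measurable] = mollifier_measurable[OF r, where 'a='a]
  show "(\<lambda>y. mollifier r (x - y) *\<^sub>R f y) \<in> borel_measurable lborel"
    "(\<lambda>y. mollifier r (x - y) *\<^sub>R g y) \<in> borel_measurable lborel" by measurable
  show "AE y in lborel. mollifier r (x - y) *\<^sub>R f y = mollifier r (x - y) *\<^sub>R g y"
    using eq mollifier_eq_0[OF r, of "x - _"] by (auto elim!: eventually_mono simp: not_less)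
qed

lemma mollify_sum:
  fixes f :: "'i \<Rightarrow> 'a::euclidean_space \<Rightarrow> 'b::{banach,second_countable_topology}"
  assumes r: "r > 0" and f: "\<And>i. i \<in> A \<Longrightarrow> locally_integrable (f i)"
  shows "mollify r (\<lambda>y. \<Sum>i\<in>A. f i y) x = (\<Sum>i\<in>A. mollify r (f i) x)"
  unfolding mollify_def scaleR_sum_right
  by (rule Bochner_Integration.integral_sum) (rule mollify_integrable[OF r f])

text \<open>Testing the weak derivative against \<open>mollifier r (x - y)\<close> moves the
  derivative from the kernel onto the function. The primed functions are Borel versions, which
  allows passing from \<open>lebesgue\<close> to \<open>lborel\<close>.\<close>

lemma weak_deriv_mollify:
  fixes f g f' g' :: "real ^ 'n \<Rightarrow> complex"
  assumes wd: "has_weak_deriv i f g"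
    and [measurable]: "f \<in> borel_measurable lebesgue" "g \<in> borel_measurable lebesgue"
      "f' \<in> borel_measurable borel" "g' \<in> borel_measurable borel"
    and ae: "AE x in lebesgue. f x = f' x" "AE x in lebesgue. g x = g' x" and r: "r > 0"
  shows "(\<integral>y. mollifier_deriv r (x - y) (axis i 1) *\<^sub>R f' y \<partial>lborel) = mollify r g' x"
proof -
  have [measurable]: "f' \<in> borel_measurable lebesgue" "g' \<in> borel_measurable lebesgue"
    by (auto intro: measurable_completion)
  have m1: "(\<lambda>y. mollifier r (x - y)) \<in> borel_measurable borel"
    by (intro borel_measurable_continuous_onI continuous_on_compose2[OF mollifier_continuous[OF r]] continuous_intros) auto
  have m2: "(\<lambda>y. mollifier_deriv r (x - y) (axis i 1)) \<in> borel_measurable borel"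
    by (intro borel_measurable_continuous_onI continuous_on_compose2[OF mollifier_deriv_continuous[OF r]] continuous_intros) auto
  note [measurable] = m1 m2
  have [measurable]: "(\<lambda>y. mollifier r (x - y)) \<in> borel_measurable lebesgue"
     "(\<lambda>y. mollifier_deriv r (x - y) (axis i 1)) \<in> borel_measurable lebesgue"
    using m1 m2 by (auto intro: measurable_completion)
  have "(\<integral>y. f y * - complex_of_real (mollifier_deriv r (x - y) (axis i 1)) \<partial>lebesgue)
      = - (\<integral>y. g y * complex_of_real (mollifier r (x - y)) \<partial>lebesgue)"
    using wd test_function_mollifier[OF r, of x]
    unfolding has_weak_deriv_def frechet_derivative_mollifier[OF r, symmetric] by blast
  moreover have "(\<integral>y. f y * - complex_of_real (mollifier_deriv r (x - y) (axis i 1)) \<partial>lebesgue)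
      = - (\<integral>y. mollifier_deriv r (x - y) (axis i 1) *\<^sub>R f y \<partial>lebesgue)"
    by (simp add: scaleR_conv_of_real mult.commute)
  moreover have "(\<integral>y. mollifier_deriv r (x - y) (axis i 1) *\<^sub>R f y \<partial>lebesgue)
      = (\<integral>y. mollifier_deriv r (x - y) (axis i 1) *\<^sub>R f' y \<partial>lebesgue)"
    by (rule integral_cong_AE) (use ae(1) in \<open>auto elim: eventually_mono\<close>)
  moreover have "\<dots> = (\<integral>y. mollifier_deriv r (x - y) (axis i 1) *\<^sub>R f' y \<partial>lborel)"
    by (rule integral_completion) measurable
  moreover have "(\<integral>y. g y * complex_of_real (mollifier r (x - y)) \<partial>lebesgue)
      = (\<integral>y. mollifier r (x - y) *\<^sub>R g' y \<partial>lebesgue)"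
    by (rule integral_cong_AE)
       (use ae(2) in \<open>auto elim: eventually_mono simp: scaleR_conv_of_real mult.commute\<close>)
  moreover have "\<dots> = (\<integral>y. mollifier r (x - y) *\<^sub>R g' y \<partial>lborel)"
    by (rule integral_completion) measurable
  ultimately show ?thesis by (simp add: mollify_def)
qed

lemma completion_ex_borel_measurable_complex:
  fixes f :: "'a \<Rightarrow> complex"
  assumes f: "f \<in> borel_measurable (completion M)"
  obtains f' where "f' \<in> borel_measurable M" "AE x in M. f x = f' x"
proof -
  have "(\<lambda>x. Re (f x)) \<in> borel_measurable (completion M)" "(\<lambda>x. Im (f x)) \<in> borel_measurable (completion M)"
    using f by simp_all
  then obtain a b where ab: "a \<in> borel_measurable M" "AE x in M. Re (f x) = a x"
      "b \<in> borel_measurable M" "AE x in M. Im (f x) = b x"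
    using completion_ex_borel_measurable_real by metis
  show ?thesis
  proof
    show "(\<lambda>x. complex_of_real (a x) + \<i> * complex_of_real (b x)) \<in> borel_measurable M"
      using ab by measurable
    show "AE x in M. f x = complex_of_real (a x) + \<i> * complex_of_real (b x)"
      using ab(2,4) by eventually_elim (simp add: complex_eq_iff)
  qed
qed

lemma L2_locally_integrable:
  fixes f f' :: "real ^ 'n \<Rightarrow> complex"
  assumes f: "f \<in> L2" and [measurable]: "f' \<in> borel_measurable borel" and ae: "AE x in lborel. f x = f' x"
  shows "integrable lborel (\<lambda>x. (norm (f' x))\<^sup>2)" "locally_integrable f'"
proof -
  have [measurable]: "f \<in> borel_measurable lebesgue" "f' \<in> borel_measurable lebesgue"
    using f by (auto simp: L2_def intro: measurable_completion)
  have "integrable lebesgue (\<lambda>x. (norm (f' x))\<^sup>2) \<longleftrightarrow> integrable lebesgue (\<lambda>x. (norm (f x))\<^sup>2)"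
    by (rule integrable_cong_AE) (use AE_completion[OF ae] in \<open>auto elim: eventually_mono\<close>)
  then have "integrable lebesgue (\<lambda>x. (norm (f' x))\<^sup>2)" using f by (simp add: L2_def)
  then show sq: "integrable lborel (\<lambda>x. (norm (f' x))\<^sup>2)" by (simp add: integrable_completion)
  have "integrable lborel (\<lambda>x. indicator (cball 0 R) x *\<^sub>R f' x)" for R
  proof (rule Bochner_Integration.integrable_bound)
    show "integrable lborel (\<lambda>x. indicator (cball 0 R) x + (norm (f' x))\<^sup>2)"
      by (intro Bochner_Integration.integrable_add integrable_real_indicator sq)
         (auto simp: emeasure_lborel_cball_finite[unfolded infinity_ennreal_def])
    \<comment> \<open>This elementary inequality bounds the function on a ball by integrable terms,
      in place of Cauchy-Schwarz.\<close>
    have "t \<le> 1 + t\<^sup>2" for t :: real using zero_le_power2[of "t - 1/2"] by (simp add: power2_eq_square algebra_simps)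
    then show "AE x in lborel. norm (indicator (cball 0 R) x *\<^sub>R f' x) \<le> norm (indicator (cball 0 R) x + (norm (f' x))\<^sup>2)"
      by (intro AE_I2) (auto simp: indicator_def)
  qed (auto intro!: borel_measurable_scaleR borel_measurable_indicator)
  then show "locally_integrable f'" by (simp add: locally_integrable_def)
qed

text \<open>Membership in \<open>H1\<close> provides a witness, so the choice made by
  \<open>weak_deriv\<close> meets its specification, for \<open>f\<close> and again for its first
  derivatives.\<close>

lemma H2_weak_deriv:
  assumes "f \<in> H2"
  shows "f \<in> L2" "weak_deriv i f \<in> L2" "weak_deriv i (weak_deriv i f) \<in> L2"
    "has_weak_deriv i f (weak_deriv i f)" "has_weak_deriv i (weak_deriv i f) (weak_deriv i (weak_deriv i f))"
proof -
  have *: "weak_deriv i h \<in> L2 \<and> has_weak_deriv i h (weak_deriv i h)" if "h \<in> H1" for h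
  proof -
    have "\<exists>g. g \<in> L2 \<and> has_weak_deriv i h g" using that by (auto simp: H1_def)
    from someI_ex[OF this] show ?thesis by (simp add: weak_deriv_def)
  qed
  have "f \<in> H1" "weak_deriv i f \<in> H1" using assms by (auto simp: H2_def)
  then show "f \<in> L2" "weak_deriv i f \<in> L2" "weak_deriv i (weak_deriv i f) \<in> L2"
    "has_weak_deriv i f (weak_deriv i f)" "has_weak_deriv i (weak_deriv i f) (weak_deriv i (weak_deriv i f))"
    using * by (auto simp: H1_def)
qed

text \<open>The classical inequality is applied to the mollified \<psi>. On the support of
  \<open>g\<close> all factors are bounded uniformly in \<open>r\<close>, so the error in each term
  is a constant times the L1 distance of \<psi> or of \<open>W \<psi>\<close> from its
  mollification.\<close>

lemma weak_solution_energy_inequality: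
  fixes g W :: "real ^ 'n \<Rightarrow> real" and \<psi> :: "real ^ 'n \<Rightarrow> complex"
  assumes \<psi>_meas [measurable]: "\<psi> \<in> borel_measurable borel" and C: "\<And>x. norm (\<psi> x) \<le> C"
    and p: "\<And>i. locally_integrable (p i)" and q: "\<And>i. locally_integrable (q i)"
    and \<psi>_p: "\<And>r x i. 0 < r \<Longrightarrow> (\<integral>y. mollifier_deriv r (x - y) (axis i 1) *\<^sub>R \<psi> y \<partial>lborel) = mollify r (p i) x"
    and p_q: "\<And>r x i. 0 < r \<Longrightarrow> (\<integral>y. mollifier_deriv r (x - y) (axis i 1) *\<^sub>R p i y \<partial>lborel) = mollify r (q i) x"
    and W: "continuous_on UNIV W" and eqn: "AE x in lborel. (\<Sum>i\<in>UNIV. q i x) = W x *\<^sub>R \<psi> x"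
    and g_cont: "continuous_on UNIV g" "\<And>i. continuous_on UNIV (g' i)"
    and g: "\<And>i x. ((\<lambda>t. g (x + t *\<^sub>R axis i 1)) has_vector_derivative g' i x) (at 0)"
    and supp: "\<And>x. norm x > R \<Longrightarrow> g x = 0" "\<And>i x. norm x > R \<Longrightarrow> g' i x = 0"
  shows "(\<integral>x. (g x)\<^sup>2 * W x * (norm (\<psi> x))\<^sup>2 \<partial>lborel)
          \<le> (\<integral>x. (\<Sum>i\<in>UNIV. (g' i x)\<^sup>2) * (norm (\<psi> x))\<^sup>2 \<partial>lborel)"
    and "integrable lborel (\<lambda>x. (g x)\<^sup>2 * W x * (norm (\<psi> x))\<^sup>2)"
    and "integrable lborel (\<lambda>x. (\<Sum>i\<in>UNIV. (g' i x)\<^sup>2) * (norm (\<psi> x))\<^sup>2)"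
proof -
  \<comment> \<open>Multiplication by \<open>W\<close> does not commute with mollification, so the
    product is mollified as a whole.\<close>
  define F where "F x = W x *\<^sub>R \<psi> x" for x
  define G where "G x = (\<Sum>i\<in>UNIV. (g' i x)\<^sup>2)" for x
  have G_cont: "continuous_on UNIV G" unfolding G_def by (intro continuous_intros g_cont)
  have G_supp: "G x = 0" if "norm x > R" for x using supp(2)[OF that] by (simp add: G_def)
  have [measurable]: "W \<in> borel_measurable borel" "g \<in> borel_measurable borel" "G \<in> borel_measurable borel"
    using W g_cont(1) G_cont by (auto intro: borel_measurable_continuous_onI)
  have [measurable]: "F \<in> borel_measurable borel" unfolding F_def by measurable
  have C0: "0 \<le> C" using C[of 0] norm_ge_zero order_trans by blast
  have F_bdd: "\<exists>C. \<forall>x\<in>cball 0 R. norm (F x) \<le> C" for R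
  proof -
    have "compact (W ` cball 0 R)" by (intro compact_continuous_image continuous_on_subset[OF W]) auto
    then obtain D where D: "\<And>x. x \<in> cball 0 R \<Longrightarrow> norm (W x) \<le> D"
      using compact_imp_bounded bounded_iff by (metis imageI)
    have "norm (F x) \<le> D * C" if "x \<in> cball 0 R" for x
      unfolding F_def norm_scaleR real_norm_def[symmetric]
      by (rule mult_mono) (use D[OF that] C order_trans[OF norm_ge_zero D[OF that]] in auto)
    then show ?thesis by blast
  qed
  have \<psi>_li: "locally_integrable \<psi>" by (rule locally_integrable_bounded) (use C in auto)
  have F_li: "locally_integrable F" by (rule locally_integrable_bounded) (use F_bdd in auto)
  obtain CF where CF: "\<And>x. x \<in> cball 0 (R + 1) \<Longrightarrow> norm (F x) \<le> CF" using F_bdd by blast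
  define CF' where "CF' = max CF 0"
  have CF': "norm (F x) \<le> CF'" if "norm x \<le> R + 1" for x using CF[of x] that by (simp add: CF'_def)
  obtain Bg where Bg: "0 < Bg" "\<And>x. norm ((g x)\<^sup>2) \<le> Bg"
    using compact_support_bounded[of "\<lambda>x. (g x)\<^sup>2" R] supp(1) g_cont(1) by (auto intro: continuous_intros)
  obtain BG where BG: "0 < BG" "\<And>x. norm (G x) \<le> BG"
    using compact_support_bounded[OF G_cont G_supp] by blast
  have G0: "0 \<le> G x" for x by (simp add: G_def sum_nonneg)
  \<comment> \<open>The truncations are bounded with bounded support, as L1 approximation requires.
    One extra unit of radius makes them indistinguishable from \<psi> and \<open>F\<close> under
    mollification at points of \<open>cball 0 R\<close>, because \<open>r < 1\<close>.\<close>
  define \<psi>1 where "\<psi>1 x = indicator (cball 0 (R + 1)) x *\<^sub>R \<psi> x" for x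
  define F1 where "F1 x = indicator (cball 0 (R + 1)) x *\<^sub>R F x" for x
  have [measurable]: "\<psi>1 \<in> borel_measurable borel" "F1 \<in> borel_measurable borel"
    unfolding \<psi>1_def F1_def by (auto intro!: borel_measurable_scaleR borel_measurable_indicator)
  have \<psi>1: "norm (\<psi>1 x) \<le> C" "norm x > R + 1 \<Longrightarrow> \<psi>1 x = 0" for x
    using C[of x] C0 by (auto simp: \<psi>1_def indicator_def)
  have F1: "norm (F1 x) \<le> CF'" "norm x > R + 1 \<Longrightarrow> F1 x = 0" for x
    using CF'[of x] by (auto simp: F1_def indicator_def CF'_def)
  have int_psi: "integrable lborel (\<lambda>x. h x * (norm (\<psi> x))\<^sup>2)" if h: "continuous_on UNIV h" "\<And>x. norm x > R \<Longrightarrow> h x = 0" for h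
  proof -
    have [measurable]: "h \<in> borel_measurable borel" using h by (auto intro: borel_measurable_continuous_onI)
    show ?thesis
    proof (rule Bochner_Integration.integrable_bound)
      show "integrable lborel (\<lambda>x. h x * C\<^sup>2)"
        using integrable_compact_support[OF h] by simp
      show "AE x in lborel. norm (h x * (norm (\<psi> x))\<^sup>2) \<le> norm (h x * C\<^sup>2)"
        using C by (intro AE_I2) (auto simp: abs_mult intro!: mult_left_mono power_mono)
    qed measurable
  qed
  have gW: "integrable lborel (\<lambda>x. (g x)\<^sup>2 * W x * (norm (\<psi> x))\<^sup>2)"
    by (rule int_psi) (use supp in \<open>auto intro!: continuous_intros g_cont W\<close>)
  have GI: "integrable lborel (\<lambda>x. G x * (norm (\<psi> x))\<^sup>2)"
    by (rule int_psi[OF G_cont G_supp])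
  \<comment> \<open>The first summand comes from the error in \<open>F x \<bullet> \<psi> x\<close>,
    the second from the error in the squared norm of \<psi>; the final 1 makes \<open>K\<close>
    positive.\<close>
  define K where "K = Bg * (C + CF') + 2 * BG * C + 1"
  have K: "K > 0" using Bg BG C0 by (simp add: K_def CF'_def add_nonneg_pos)
  have main: "(\<integral>x. (g x)\<^sup>2 * W x * (norm (\<psi> x))\<^sup>2 \<partial>lborel) \<le> (\<integral>x. G x * (norm (\<psi> x))\<^sup>2 \<partial>lborel) + e"
    if e: "e > 0" for e
  proof -
    define e' where "e' = e / (2 * K)"
    have e': "e' > 0" "K * (e' + e') = e" using e K by (auto simp: e'_def field_simps)
    obtain r1 where r1: "r1 > 0" "\<And>r. 0 < r \<Longrightarrow> r < r1 \<Longrightarrow> (\<integral>\<^sup>+x. norm (mollify r \<psi>1 x - \<psi>1 x) \<partial>lborel) \<le> ennreal e'"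
      using mollify_L1_approx[of \<psi>1 C "R + 1" e'] \<psi>1 e' by auto
    obtain r2 where r2: "r2 > 0" "\<And>r. 0 < r \<Longrightarrow> r < r2 \<Longrightarrow> (\<integral>\<^sup>+x. norm (mollify r F1 x - F1 x) \<partial>lborel) \<le> ennreal e'"
      using mollify_L1_approx[of F1 CF' "R + 1" e'] F1 e' by auto
    define r where "r = min (1/2) (min (r1 / 2) (r2 / 2))"
    have r: "0 < r" "r < 1" "r < r1" "r < r2" using r1 r2 by (auto simp: r_def)
    have \<psi>1_li: "locally_integrable \<psi>1" by (rule locally_integrable_bounded) (use \<psi>1 in auto)
    have F1_li: "locally_integrable F1" by (rule locally_integrable_bounded) (use F1 in auto)
    note [measurable] = borel_measurable_continuous_onI[OF mollify_continuous[OF r(1) \<psi>1_li]]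
      borel_measurable_continuous_onI[OF mollify_continuous[OF r(1) F1_li]]
    have L1: "integrable lborel h \<and> (\<integral>x. h x \<partial>lborel) \<le> e'"
      if "h \<in> borel_measurable borel" "\<And>x. 0 \<le> h x" "(\<integral>\<^sup>+x. h x \<partial>lborel) \<le> ennreal e'" for h
    proof -
      have "integrable lborel h" using that by (intro integrableI_nonneg) (auto intro: order_le_less_trans)
      moreover from this have "ennreal (\<integral>x. h x \<partial>lborel) \<le> ennreal e'"
        using that by (subst nn_integral_eq_integral[symmetric]) auto
      ultimately show ?thesis using e' by simp
    qed
    define a where "a x = norm (mollify r F1 x - F1 x)" for x
    define b where "b x = norm (mollify r \<psi>1 x - \<psi>1 x)" for x
    have a: "integrable lborel a" "(\<integral>x. a x \<partial>lborel) \<le> e'"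
      using L1[of a] r2(2)[OF r(1,4)] by (auto simp: a_def[abs_def])
    have b: "integrable lborel b" "(\<integral>x. b x \<partial>lborel) \<le> e'"
      using L1[of b] r1(2)[OF r(1,3)] by (auto simp: b_def[abs_def])
    have loc: "mollify r \<psi> x = mollify r \<psi>1 x" "mollify r F x = mollify r F1 x" if "norm x \<le> R" for x
    proof -
      have "norm y \<le> R + 1" if "norm (x - y) < r" for y
        using that \<open>norm x \<le> R\<close> r norm_triangle_ineq2[of y x] by (simp add: norm_minus_commute)
      then show "mollify r \<psi> x = mollify r \<psi>1 x" "mollify r F x = mollify r F1 x"
        by (auto intro!: mollify_cong_AE[OF r(1)] AE_I2 simp: \<psi>1_def F1_def)
    qed
    have bd: "norm (mollify r \<psi> x) \<le> C" for x
      by (rule norm_mollify_le[OF r(1) \<psi>_li]) (simp add: C)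
    \<comment> \<open>The equation survives mollification: the Laplacian of the mollified \<psi> is
      the mollified right-hand side.\<close>
    have sum_q: "(\<Sum>i\<in>UNIV. mollify r (q i) x) = mollify r F x" for x
    proof -
      have [measurable]: "q i \<in> borel_measurable borel" for i using q by (simp add: locally_integrable_def)
      have "mollify r F x = mollify r (\<lambda>y. \<Sum>i\<in>UNIV. q i y) x"
        by (rule mollify_cong_AE[OF r(1)]) (use eqn in \<open>auto elim: eventually_mono simp: F_def\<close>)
      then show ?thesis by (simp add: mollify_sum[OF r(1) q])
    qed
    have energy: "(\<integral>x. (g x)\<^sup>2 * (mollify r F x \<bullet> mollify r \<psi> x) \<partial>lborel)
        \<le> (\<integral>x. G x * (norm (mollify r \<psi> x))\<^sup>2 \<partial>lborel)"
      unfolding G_def sum_q[symmetric]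
    proof (rule energy_inequality[where p="\<lambda>i. mollify r (p i)" and R=R])
      show "((\<lambda>t. mollify r \<psi> (x + t *\<^sub>R axis i 1)) has_vector_derivative mollify r (p i) x) (at 0)" for i x
        using mollify_has_vector_derivative[OF r(1) \<psi>_li, of x "axis i 1"] by (simp add: \<psi>_p[OF r(1)])
      show "((\<lambda>t. mollify r (p i) (x + t *\<^sub>R axis i 1)) has_vector_derivative mollify r (q i) x) (at 0)" for i x
        using mollify_has_vector_derivative[OF r(1) p, of i x "axis i 1"] by (simp add: p_q[OF r(1)])
    qed (use supp g in \<open>auto intro!: mollify_continuous[OF r(1)] \<psi>_li p q g_cont\<close>)
    have c1: "continuous_on UNIV (mollify r \<psi>)" "continuous_on UNIV (mollify r F)"
      by (auto intro!: mollify_continuous[OF r(1)] \<psi>_li F_li)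
    have i1: "integrable lborel (\<lambda>x. (g x)\<^sup>2 * (mollify r F x \<bullet> mollify r \<psi> x))"
      by (rule integrable_compact_support[of _ R]) (use supp in \<open>auto intro!: continuous_intros g_cont c1\<close>)
    have i2: "integrable lborel (\<lambda>x. G x * (norm (mollify r \<psi> x))\<^sup>2)"
      by (rule integrable_compact_support[of _ R]) (use G_supp in \<open>auto intro!: continuous_intros G_cont c1\<close>)
    have "(\<integral>x. (g x)\<^sup>2 * W x * (norm (\<psi> x))\<^sup>2 - G x * (norm (\<psi> x))\<^sup>2 \<partial>lborel)
      \<le> (\<integral>x. ((g x)\<^sup>2 * (mollify r F x \<bullet> mollify r \<psi> x) - G x * (norm (mollify r \<psi> x))\<^sup>2) + K * (a x + b x) \<partial>lborel)"
    proof (rule integral_mono)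
      fix x
      show "(g x)\<^sup>2 * W x * (norm (\<psi> x))\<^sup>2 - G x * (norm (\<psi> x))\<^sup>2
        \<le> ((g x)\<^sup>2 * (mollify r F x \<bullet> mollify r \<psi> x) - G x * (norm (mollify r \<psi> x))\<^sup>2) + K * (a x + b x)"
      proof (cases "norm x \<le> R")
        case False
        then show ?thesis using supp(1)[of x] G_supp[of x] K by (simp add: a_def b_def)
      next
        case True
        let ?v = "mollify r \<psi> x" and ?f = "mollify r F x"
        have av: "a x = norm (?f - F x)" "b x = norm (?v - \<psi> x)"
          using True by (auto simp: a_def b_def loc F1_def \<psi>1_def)
        \<comment> \<open>One factor is changed at a time, so that every error meets a bounded
          factor.\<close>
        have "F x \<bullet> \<psi> x - ?f \<bullet> ?v = (F x - ?f) \<bullet> ?v + F x \<bullet> (\<psi> x - ?v)" by (simp add: inner_simps)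
        also have "\<dots> \<le> norm (F x - ?f) * norm ?v + norm (F x) * norm (\<psi> x - ?v)"
          by (intro add_mono norm_cauchy_schwarz)
        also have "\<dots> \<le> a x * C + CF' * b x"
          unfolding av norm_minus_commute[of "F x"] norm_minus_commute[of "\<psi> x"]
          using True by (intro add_mono mult_mono bd CF') (auto simp: CF'_def)
        also have "\<dots> \<le> (C + CF') * (a x + b x)"
          using C0 by (simp add: a_def b_def CF'_def algebra_simps)
        finally have 1: "F x \<bullet> \<psi> x - ?f \<bullet> ?v \<le> (C + CF') * (a x + b x)" .
        have ab0: "0 \<le> a x" "0 \<le> b x" by (auto simp: a_def b_def)
        have "(g x)\<^sup>2 * (F x \<bullet> \<psi> x - ?f \<bullet> ?v) \<le> (g x)\<^sup>2 * ((C + CF') * (a x + b x))"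
          using 1 by (rule mult_left_mono) simp
        also have "\<dots> \<le> Bg * ((C + CF') * (a x + b x))"
          using Bg(2)[of x] C0 ab0 by (intro mult_right_mono) (auto simp: CF'_def)
        finally have 2: "(g x)\<^sup>2 * (F x \<bullet> \<psi> x) - (g x)\<^sup>2 * (?f \<bullet> ?v) \<le> Bg * (C + CF') * (a x + b x)"
          by (simp add: algebra_simps)
        have "(norm ?v)\<^sup>2 - (norm (\<psi> x))\<^sup>2 = (norm ?v - norm (\<psi> x)) * (norm ?v + norm (\<psi> x))"
          by (simp add: power2_eq_square algebra_simps)
        also have "\<dots> \<le> b x * (2 * C)"
          unfolding av using bd[of x] C[of x] norm_triangle_ineq2[of ?v "\<psi> x"] by (intro mult_mono) auto
        finally have "G x * ((norm ?v)\<^sup>2 - (norm (\<psi> x))\<^sup>2) \<le> G x * (b x * (2 * C))"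
          using G0[of x] by (rule mult_left_mono)
        also have "\<dots> \<le> BG * ((a x + b x) * (2 * C))"
          using BG(2)[of x] BG(1) G0[of x] ab0 C0 by (intro mult_mono) auto
        finally have 3: "G x * (norm ?v)\<^sup>2 - G x * (norm (\<psi> x))\<^sup>2 \<le> 2 * BG * C * (a x + b x)"
          by (simp add: algebra_simps)
        have 4: "(g x)\<^sup>2 * W x * (norm (\<psi> x))\<^sup>2 = (g x)\<^sup>2 * (F x \<bullet> \<psi> x)"
          by (simp add: F_def power2_norm_eq_inner)
        have 5: "K * (a x + b x) = Bg * (C + CF') * (a x + b x) + 2 * BG * C * (a x + b x) + (a x + b x)"
          by (simp add: K_def algebra_simps)
        show ?thesis unfolding 4 5 using 2 3 ab0 by linarith
      qed
    qed (intro Bochner_Integration.integrable_add Bochner_Integration.integrable_diff integrable_mult_right gW GI i1 i2 a b)+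
    also have "\<dots> = (\<integral>x. (g x)\<^sup>2 * (mollify r F x \<bullet> mollify r \<psi> x) \<partial>lborel) - (\<integral>x. G x * (norm (mollify r \<psi> x))\<^sup>2 \<partial>lborel)
        + K * ((\<integral>x. a x \<partial>lborel) + (\<integral>x. b x \<partial>lborel))"
      using i1 i2 a(1) b(1) by simp
    also have "\<dots> \<le> 0 + K * (e' + e')"
      using energy a(2) b(2) K by (intro add_mono mult_left_mono) auto
    finally show ?thesis using gW GI e'(2) by simp
  qed
  show "(\<integral>x. (g x)\<^sup>2 * W x * (norm (\<psi> x))\<^sup>2 \<partial>lborel)
          \<le> (\<integral>x. (\<Sum>i\<in>UNIV. (g' i x)\<^sup>2) * (norm (\<psi> x))\<^sup>2 \<partial>lborel)"
    using field_le_epsilon[OF main] by (simp add: G_def)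
  show "integrable lborel (\<lambda>x. (g x)\<^sup>2 * W x * (norm (\<psi> x))\<^sup>2)" by fact
  show "integrable lborel (\<lambda>x. (\<Sum>i\<in>UNIV. (g' i x)\<^sup>2) * (norm (\<psi> x))\<^sup>2)" using GI by (simp add: G_def)
qed

text \<open>The interface between the operator and the decay estimate: a Borel version of \<psi>
  that is bounded everywhere, together with the energy inequality for every admissible weight. Weak
  derivatives do not occur after this point.\<close>

lemma eigenfunction_energy_inequality:
  fixes V :: "real ^ 'n \<Rightarrow> real" and \<psi> :: "real ^ 'n \<Rightarrow> complex"
  assumes V: "continuous_on UNIV V" and eig: "eigenfunction (schroedinger V) E \<psi>"
    and bdd: "essentially_bounded \<psi>"
  obtains \<psi>' C where "\<psi>' \<in> borel_measurable borel" "AE x in lebesgue. \<psi> x = \<psi>' x"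
    "\<And>x. norm (\<psi>' x) \<le> C" "integrable lborel (\<lambda>x. (norm (\<psi>' x))\<^sup>2)"
    "\<And>g g' R. continuous_on UNIV g \<Longrightarrow> (\<And>i. continuous_on UNIV (g' i)) \<Longrightarrow>
       (\<And>i x. ((\<lambda>t. g (x + t *\<^sub>R axis i 1)) has_vector_derivative g' i x) (at 0)) \<Longrightarrow>
       (\<And>x. norm x > R \<Longrightarrow> g x = 0) \<Longrightarrow> (\<And>i x. norm x > R \<Longrightarrow> g' i x = 0) \<Longrightarrow>
       (\<integral>x. (g x)\<^sup>2 * (V x - E) * (norm (\<psi>' x))\<^sup>2 \<partial>lborel)
          \<le> (\<integral>x. (\<Sum>i\<in>UNIV. (g' i x)\<^sup>2) * (norm (\<psi>' x))\<^sup>2 \<partial>lborel) \<and>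
       integrable lborel (\<lambda>x. (g x)\<^sup>2 * (V x - E) * (norm (\<psi>' x))\<^sup>2) \<and>
       integrable lborel (\<lambda>x. (\<Sum>i\<in>UNIV. (g' i x)\<^sup>2) * (norm (\<psi>' x))\<^sup>2)"
proof -
  have H2: "\<psi> \<in> H2" using eig by (simp add: eigenfunction_def schroedinger_def)
  let ?p = "\<lambda>i. weak_deriv i \<psi>" let ?q = "\<lambda>i. weak_deriv i (weak_deriv i \<psi>)"
  have meas: "f \<in> borel_measurable lebesgue" if "f \<in> L2" for f :: "real ^ 'n \<Rightarrow> complex"
    using that by (simp add: L2_def)
  have ex: "\<exists>f'. f' \<in> borel_measurable borel \<and> (AE x in lborel. f x = f' x)" if "f \<in> L2" for f :: "real ^ 'n \<Rightarrow> complex"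
    using completion_ex_borel_measurable_complex[OF meas[OF that]] by auto
  obtain \<psi>0 where \<psi>0: "\<psi>0 \<in> borel_measurable borel" "AE x in lborel. \<psi> x = \<psi>0 x"
    using ex[OF H2_weak_deriv(1)[OF H2]] by blast
  have "\<forall>i. \<exists>f'. f' \<in> borel_measurable borel \<and> (AE x in lborel. ?p i x = f' x)"
    using ex H2_weak_deriv(2)[OF H2] by blast
  then obtain p where p: "\<And>i. p i \<in> borel_measurable borel" "\<And>i. AE x in lborel. ?p i x = p i x" by metis
  have "\<forall>i. \<exists>f'. f' \<in> borel_measurable borel \<and> (AE x in lborel. ?q i x = f' x)"
    using ex H2_weak_deriv(3)[OF H2] by blast
  then obtain q where q: "\<And>i. q i \<in> borel_measurable borel" "\<And>i. AE x in lborel. ?q i x = q i x" by metis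
  obtain C0 where "AE x in lebesgue. norm (\<psi> x) \<le> C0" using bdd by (auto simp: essentially_bounded_def)
  then have C0: "AE x in lborel. norm (\<psi> x) \<le> C0" by (simp add: AE_completion_iff)
  define C where "C = max C0 0"
  \<comment> \<open>Setting the representative to 0 where it exceeds \<open>C\<close> changes it on
    a null set only and makes the bound hold at every point; \<open>C \<ge> 0\<close> lets the value
    0 obey it.\<close>
  define \<psi>' where "\<psi>' x = (if norm (\<psi>0 x) \<le> C then \<psi>0 x else 0)" for x
  have \<psi>': "\<psi>' \<in> borel_measurable borel" using \<psi>0(1) unfolding \<psi>'_def by measurable
  have \<psi>'_ae: "AE x in lborel. \<psi> x = \<psi>' x"
    using \<psi>0(2) C0 by eventually_elim (auto simp: \<psi>'_def C_def)
  have \<psi>'_C: "norm (\<psi>' x) \<le> C" for x by (auto simp: \<psi>'_def C_def)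
  \<comment> \<open>The eigenvalue equation solved for the Laplacian, which carries the sign of
    \<open>V - E\<close>.\<close>
  have "AE x in lebesgue. (\<Sum>i\<in>UNIV. ?q i x) = (V x - E) *\<^sub>R \<psi> x"
    using eig by (auto simp: eigenfunction_def schroedinger_def neg_laplacian_def mult_operator_def laplacian_def
        scaleR_conv_of_real algebra_simps elim!: eventually_mono)
  then have "AE x in lborel. (\<Sum>i\<in>UNIV. ?q i x) = (V x - E) *\<^sub>R \<psi> x" by (simp add: AE_completion_iff)
  moreover have "AE x in lborel. \<forall>i. ?q i x = q i x" using q(2) by (simp add: AE_all_countable)
  ultimately have eqn: "AE x in lborel. (\<Sum>i\<in>UNIV. q i x) = (V x - E) *\<^sub>R \<psi>' x"
    using \<psi>'_ae by eventually_elim simp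
  show ?thesis
  proof (rule that[OF \<psi>' AE_completion[OF \<psi>'_ae] \<psi>'_C])
    show "integrable lborel (\<lambda>x. (norm (\<psi>' x))\<^sup>2)"
      by (rule L2_locally_integrable(1)[OF H2_weak_deriv(1)[OF H2] \<psi>' \<psi>'_ae])
    fix g :: "real ^ 'n \<Rightarrow> real" and g' :: "'n \<Rightarrow> real ^ 'n \<Rightarrow> real" and R :: real
    assume g: "continuous_on UNIV g" "\<And>i. continuous_on UNIV (g' i)"
       "\<And>i x. ((\<lambda>t. g (x + t *\<^sub>R axis i 1)) has_vector_derivative g' i x) (at 0)"
       "\<And>x. norm x > R \<Longrightarrow> g x = 0" "\<And>i x. norm x > R \<Longrightarrow> g' i x = 0"
    have "continuous_on UNIV (\<lambda>x. V x - E)" by (intro continuous_intros V)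
    note * = weak_solution_energy_inequality[where p=p and q=q and W="\<lambda>x. V x - E" and \<psi>=\<psi>' and C=C and g=g and g'=g' and R=R, OF \<psi>' \<psi>'_C
      L2_locally_integrable(2)[OF H2_weak_deriv(2)[OF H2] p]
      L2_locally_integrable(2)[OF H2_weak_deriv(3)[OF H2] q]
      weak_deriv_mollify[OF H2_weak_deriv(4)[OF H2] meas[OF H2_weak_deriv(1)[OF H2]] meas[OF H2_weak_deriv(2)[OF H2]]
        \<psi>' p(1) AE_completion[OF \<psi>'_ae] AE_completion[OF p(2)]]
      weak_deriv_mollify[OF H2_weak_deriv(5)[OF H2] meas[OF H2_weak_deriv(2)[OF H2]] meas[OF H2_weak_deriv(3)[OF H2]]
        p(1) q(1) AE_completion[OF p(2)] AE_completion[OF q(2)]]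
      this eqn g]
    then show "(\<integral>x. (g x)\<^sup>2 * (V x - E) * (norm (\<psi>' x))\<^sup>2 \<partial>lborel)
          \<le> (\<integral>x. (\<Sum>i\<in>UNIV. (g' i x)\<^sup>2) * (norm (\<psi>' x))\<^sup>2 \<partial>lborel) \<and>
       integrable lborel (\<lambda>x. (g x)\<^sup>2 * (V x - E) * (norm (\<psi>' x))\<^sup>2) \<and>
       integrable lborel (\<lambda>x. (\<Sum>i\<in>UNIV. (g' i x)\<^sup>2) * (norm (\<psi>' x))\<^sup>2)"
      by blast
  qed
qed

section \<open>Agmon distance\<close>

text \<open>The derivative exists exactly when difference quotients satisfy the Cauchy criterion as
  the step tends to 0. With tolerances \<open>1 / Suc k\<close> and step bounds
  \<open>1 / Suc m\<close> this is a countable combination of sets \<open>A k m\<close>, each closed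
  by continuity of \<open>f\<close>.\<close>

lemma borel_differentiability_set:
  fixes f :: "real \<Rightarrow> 'a::{banach,second_countable_topology}"
  assumes f: "continuous_on UNIV f"
  shows "{t. \<exists>D. (f has_vector_derivative D) (at t)} \<in> sets borel"
proof -
  define Q where "Q t h = (f (t + h) - f t) /\<^sub>R h" for t h
  define A where "A k m = {t. \<forall>h1 h2. 0 < \<bar>h1\<bar> \<and> \<bar>h1\<bar> < 1 / Suc m \<and> 0 < \<bar>h2\<bar> \<and> \<bar>h2\<bar> < 1 / Suc m \<longrightarrow>
      dist (Q t h1) (Q t h2) \<le> 1 / Suc k}" for k m :: nat
  have "closed (A k m)" for k m
  proof -
    have Q: "continuous_on UNIV (\<lambda>t. Q t h)" for h
      unfolding Q_def by (intro continuous_intros continuous_on_compose2[OF f]) auto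
    have "A k m = (\<Inter>h1\<in>{h1. 0 < \<bar>h1\<bar> \<and> \<bar>h1\<bar> < 1 / Suc m}. \<Inter>h2\<in>{h2. 0 < \<bar>h2\<bar> \<and> \<bar>h2\<bar> < 1 / Suc m}.
        {t. dist (Q t h1) (Q t h2) \<le> 1 / Suc k})"
      unfolding A_def by blast
    also have "closed \<dots>"
      by (intro closed_INT ballI closed_Collect_le continuous_intros Q)
    finally show ?thesis .
  qed
  then have "(\<Inter>k. \<Union>m. A k m) \<in> sets borel" by (intro sets.countable_INT' sets.countable_UN') auto
  also have "(\<Inter>k. \<Union>m. A k m) = {t. \<exists>D. (f has_vector_derivative D) (at t)}"
  proof (intro set_eqI iffI)
    fix t assume t: "t \<in> {t. \<exists>D. (f has_vector_derivative D) (at t)}"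
    then obtain D where "(f has_vector_derivative D) (at t)" by blast
    then have D: "((\<lambda>h. Q t h) \<longlongrightarrow> D) (at 0)"
      by (simp add: has_vector_derivative_at_iff_tendsto Q_def)
    have "\<exists>m. t \<in> A k m" for k
    proof -
      have "\<forall>\<^sub>F h in at 0. dist (Q t h) D < 1 / Suc k / 2" by (rule tendstoD[OF D]) auto
      then obtain d where d: "d > 0" "\<And>h. h \<noteq> 0 \<Longrightarrow> \<bar>h\<bar> < d \<Longrightarrow> dist (Q t h) D < 1 / Suc k / 2"
        unfolding eventually_at by (auto simp: dist_norm)
      obtain m where m: "1 / Suc m < d" using d(1) reals_Archimedean[of d] by (auto simp: inverse_eq_divide)
      have "dist (Q t h1) (Q t h2) \<le> 1 / Suc k"
        if "0 < \<bar>h1\<bar>" "\<bar>h1\<bar> < 1 / Suc m" "0 < \<bar>h2\<bar>" "\<bar>h2\<bar> < 1 / Suc m" for h1 h2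
      proof -
        have "dist (Q t h1) D < 1 / Suc k / 2" "dist (Q t h2) D < 1 / Suc k / 2"
          by (rule d(2); use that m in auto)+
        then show ?thesis using dist_triangle2[of "Q t h1" "Q t h2" D] by linarith
      qed
      then show ?thesis by (auto simp: A_def)
    qed
    then show "t \<in> (\<Inter>k. \<Union>m. A k m)" by blast
  next
    fix t assume t: "t \<in> (\<Inter>k. \<Union>m. A k m)"
    \<comment> \<open>A particular null sequence of steps produces the candidate limit
      \<open>D\<close>; the Cauchy criterion then extends the convergence to all steps.\<close>
    define h where "h n = inverse (real (Suc n))" for n
    have h: "h n > 0" for n by (simp add: h_def)
    have h0: "h \<longlonglongrightarrow> 0" unfolding h_def by (rule LIMSEQ_inverse_real_of_nat)
    have small: "\<forall>\<^sub>F n in sequentially. h n < e" if "e > 0" for e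
      using h0 that by (rule order_tendstoD)
    have key: "\<exists>d>0. \<forall>h1 h2. 0 < \<bar>h1\<bar> \<and> \<bar>h1\<bar> < d \<and> 0 < \<bar>h2\<bar> \<and> \<bar>h2\<bar> < d \<longrightarrow> dist (Q t h1) (Q t h2) < e"
      if "e > 0" for e
    proof -
      obtain k where k: "1 / Suc k < e" using reals_Archimedean[OF \<open>e > 0\<close>] by (auto simp: inverse_eq_divide)
      obtain m where "t \<in> A k m" using t by blast
      then have "dist (Q t h1) (Q t h2) < e"
        if "0 < \<bar>h1\<bar>" "\<bar>h1\<bar> < 1 / Suc m" "0 < \<bar>h2\<bar>" "\<bar>h2\<bar> < 1 / Suc m" for h1 h2
        using that k unfolding A_def mem_Collect_eq by (meson le_less_trans)
      moreover have "1 / real (Suc m) > 0" by simp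
      ultimately show ?thesis by blast
    qed
    have "Cauchy (\<lambda>n. Q t (h n))"
    proof (rule metric_CauchyI)
      fix e :: real assume "e > 0"
      then obtain d where d: "d > 0" "\<And>h1 h2. 0 < \<bar>h1\<bar> \<Longrightarrow> \<bar>h1\<bar> < d \<Longrightarrow> 0 < \<bar>h2\<bar> \<Longrightarrow> \<bar>h2\<bar> < d \<Longrightarrow> dist (Q t h1) (Q t h2) < e"
        using key[OF \<open>e > 0\<close>] by blast
      obtain N where "\<And>n. n \<ge> N \<Longrightarrow> h n < d" using small[OF d(1)] by (auto simp: eventually_sequentially)
      then show "\<exists>M. \<forall>m\<ge>M. \<forall>n\<ge>M. dist (Q t (h m)) (Q t (h n)) < e"
        using d(2) h by (intro exI[of _ N]) (simp add: less_imp_neq[symmetric] abs_of_pos)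
    qed
    then obtain D where D: "(\<lambda>n. Q t (h n)) \<longlonglongrightarrow> D" using Cauchy_convergent_iff convergent_def by blast
    have "((\<lambda>h. Q t h) \<longlongrightarrow> D) (at 0)"
    proof (rule tendstoI)
      fix e :: real assume "e > 0"
      then obtain d where d: "d > 0" "\<And>h1 h2. 0 < \<bar>h1\<bar> \<Longrightarrow> \<bar>h1\<bar> < d \<Longrightarrow> 0 < \<bar>h2\<bar> \<Longrightarrow> \<bar>h2\<bar> < d \<Longrightarrow> dist (Q t h1) (Q t h2) < e / 2"
        using key[of "e / 2"] by auto
      have "dist (Q t h') D < e" if "h' \<noteq> 0" "\<bar>h'\<bar> < d" for h'
      proof -
        have "\<forall>\<^sub>F n in sequentially. dist (Q t h') (Q t (h n)) \<le> e / 2"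
          using small[OF d(1)]
        proof eventually_elim
          case (elim n)
          then show ?case using d(2)[of h' "h n"] h[of n] that by simp
        qed
        moreover have "(\<lambda>n. dist (Q t h') (Q t (h n))) \<longlonglongrightarrow> dist (Q t h') D" by (intro tendsto_intros D)
        ultimately have "dist (Q t h') D \<le> e / 2" by (intro tendsto_upperbound) auto
        then show ?thesis using \<open>e > 0\<close> by linarith
      qed
      then show "\<forall>\<^sub>F h in at 0. dist (Q t h) D < e" using d(1) by (auto simp: eventually_at dist_norm)
    qed
    then have "(f has_vector_derivative D) (at t)"
      by (simp add: has_vector_derivative_at_iff_tendsto Q_def)
    then show "t \<in> {t. \<exists>D. (f has_vector_derivative D) (at t)}" by blast
  qed
  finally show ?thesis .
qed

lemma borel_measurable_vector_derivative:
  fixes f :: "real \<Rightarrow> 'a::{banach,second_countable_topology}"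
  assumes f: "continuous_on UNIV f"
  shows "(\<lambda>t. vector_derivative f (at t)) \<in> borel_measurable borel"
proof -
  define S where "S = {t. \<exists>D. (f has_vector_derivative D) (at t)}"
  have [measurable]: "S \<in> sets borel" unfolding S_def by (rule borel_differentiability_set[OF f])
  \<comment> \<open>Where no derivative exists, the choice in \<open>vector_derivative\<close> is
    over the empty predicate, so its value is this one constant.\<close>
  define c :: 'a where "c = (SOME D. False)"
  define h where "h n = inverse (real (Suc n))" for n
  define q where "q n t = (if t \<in> S then (f (t + h n) - f t) /\<^sub>R h n else c)" for n t
  have "continuous_on UNIV (\<lambda>t. (f (t + h n) - f t) /\<^sub>R h n)" for n
    by (intro continuous_intros continuous_on_compose2[OF f]) auto
  then have [measurable]: "(\<lambda>t. (f (t + h n) - f t) /\<^sub>R h n) \<in> borel_measurable borel" for n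
    by (rule borel_measurable_continuous_onI)
  show ?thesis
  proof (rule borel_measurable_LIMSEQ_metric)
    show "q n \<in> borel_measurable borel" for n unfolding q_def by measurable
    fix t
    show "(\<lambda>n. q n t) \<longlonglongrightarrow> vector_derivative f (at t)"
    proof (cases "t \<in> S")
      case True
      then obtain D where D: "(f has_vector_derivative D) (at t)" by (auto simp: S_def)
      have "(\<lambda>n. (f (t + h n) - f t) /\<^sub>R h n) \<longlonglongrightarrow> D"
        using D LIMSEQ_inverse_real_of_nat
        unfolding has_vector_derivative_at_iff_tendsto tendsto_at_iff_sequentially comp_def h_def
        by (simp del: of_nat_Suc inverse_inverse_eq)
      then show ?thesis using True vector_derivative_at[OF D] by (simp add: q_def)
    next
      case False
      then show ?thesis by (simp add: q_def S_def c_def vector_derivative_def)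
    qed
  qed
qed

text \<open>Functions that agree near \<open>t\<close> have the same candidates for a derivative and
  hence the same choice; this also covers points without a derivative.\<close>

lemma vector_derivative_cong_open:
  assumes "open S" "t \<in> S" "\<And>s. s \<in> S \<Longrightarrow> f s = g s"
  shows "vector_derivative f (at t) = vector_derivative g (at t)"
proof -
  have "(f has_vector_derivative D) (at t) \<longleftrightarrow> (g has_vector_derivative D) (at t)" for D
    using assms by (metis has_vector_derivative_transform_within_open)
  then show ?thesis by (simp add: vector_derivative_def)
qed

text \<open>Where \<open>\<gamma>\<close> is not differentiable, both derivatives are the same unspecified vector, so that the
  factor \<open>2\<close> of the chain rule is missing.\<close>

lemma norm_vector_derivative_affine_bounds:
  fixes \<gamma> :: "real \<Rightarrow> 'a::real_normed_vector"
  shows "norm (vector_derivative (\<lambda>s. \<gamma> (2 * s - 1)) (at t)) \<le> 2 * norm (vector_derivative \<gamma> (at (2 * t - 1)))"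
    and "norm (vector_derivative \<gamma> (at (2 * t - 1))) \<le> norm (vector_derivative (\<lambda>s. \<gamma> (2 * s - 1)) (at t))"
proof -
  let ?g = "\<lambda>s. \<gamma> (2 * s - 1)"
  have 1: "(?g has_vector_derivative 2 *\<^sub>R D) (at t)" if D: "(\<gamma> has_vector_derivative D) (at (2 * t - 1))" for D
  proof -
    have "((\<lambda>s. 2 * s - 1) has_vector_derivative 2) (at t)"
      unfolding has_real_derivative_iff_has_vector_derivative[symmetric]
      by (auto intro!: derivative_eq_intros)
    from vector_diff_chain_at[OF this D] show ?thesis by (simp add: comp_def)
  qed
  have 2: "(\<gamma> has_vector_derivative (1/2) *\<^sub>R D) (at (2 * t - 1))" if D: "(?g has_vector_derivative D) (at t)" for D
  proof -
    have a: "((\<lambda>s. (s + 1) / 2) has_vector_derivative (1/2)) (at (2 * t - 1))"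
      unfolding has_real_derivative_iff_has_vector_derivative[symmetric]
      by (auto intro!: derivative_eq_intros)
    have "(?g has_vector_derivative D) (at ((\<lambda>s. (s + 1) / 2) (2 * t - 1)))" using D by simp
    from vector_diff_chain_at[OF a this] show ?thesis by (simp add: comp_def add_divide_distrib)
  qed
  have "norm (vector_derivative ?g (at t)) \<le> 2 * norm (vector_derivative \<gamma> (at (2 * t - 1))) \<and>
      norm (vector_derivative \<gamma> (at (2 * t - 1))) \<le> norm (vector_derivative ?g (at t))"
  proof (cases "\<exists>D. (\<gamma> has_vector_derivative D) (at (2 * t - 1))")
    case True
    then obtain D where D: "(\<gamma> has_vector_derivative D) (at (2 * t - 1))" by blast
    show ?thesis by (simp add: vector_derivative_at[OF D] vector_derivative_at[OF 1[OF D]])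
  next
    case False
    then have "\<And>D. \<not> (?g has_vector_derivative D) (at t)" using 2 by blast
    then show ?thesis using False by (simp add: vector_derivative_def)
  qed
  then show "norm (vector_derivative ?g (at t)) \<le> 2 * norm (vector_derivative \<gamma> (at (2 * t - 1)))"
    "norm (vector_derivative \<gamma> (at (2 * t - 1))) \<le> norm (vector_derivative ?g (at t))" by auto
qed

section \<open>Absolutely continuous paths and their extension by a segment\<close>

lemma abs_continuousD:
  assumes "abs_continuous a b \<gamma>" "e > 0"
  shows "\<exists>d>0. \<forall>D. finite D \<longrightarrow> (\<forall>s t. (s, t) \<in> D \<longrightarrow> a \<le> s \<and> s \<le> t \<and> t \<le> b) \<longrightarrow>
        disjoint_family_on (\<lambda>(s, t). {s<..<t}) D \<longrightarrow> (\<Sum>(s, t)\<in>D. t - s) < d \<longrightarrow>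
        (\<Sum>(s, t)\<in>D. dist (\<gamma> s) (\<gamma> t)) < e"
proof -
  obtain d where "d > 0" and d: "\<forall>D. finite D \<and> (\<forall>(s, t) \<in> D. a \<le> s \<and> s \<le> t \<and> t \<le> b) \<and>
        disjoint_family_on (\<lambda>(s, t). {s<..<t}) D \<and> (\<Sum>(s, t)\<in>D. t - s) < d \<longrightarrow>
        (\<Sum>(s, t)\<in>D. dist (\<gamma> s) (\<gamma> t)) < e"
    using assms unfolding abs_continuous_def by blast
  show ?thesis
  proof (intro exI[of _ d] conjI allI impI)
    fix D assume D: "finite D" "\<forall>s t. (s, t) \<in> D \<longrightarrow> a \<le> s \<and> s \<le> t \<and> t \<le> b"
      "disjoint_family_on (\<lambda>(s, t). {s<..<t}) D" "(\<Sum>(s, t)\<in>D. t - s) < d"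
    then have "\<forall>(s, t) \<in> D. a \<le> s \<and> s \<le> t \<and> t \<le> b" by auto
    then show "(\<Sum>(s, t)\<in>D. dist (\<gamma> s) (\<gamma> t)) < e" using d D by blast
  qed fact
qed

lemma abs_continuous_pairD:
  assumes "abs_continuous a b \<gamma>" "e > 0"
  shows "\<exists>d>0. \<forall>s t. a \<le> s \<longrightarrow> s \<le> t \<longrightarrow> t \<le> b \<longrightarrow> t - s < d \<longrightarrow> dist (\<gamma> s) (\<gamma> t) < e"
proof -
  from abs_continuousD[OF assms] obtain d where "d > 0" and
    d: "\<forall>D. finite D \<longrightarrow> (\<forall>s t. (s, t) \<in> D \<longrightarrow> a \<le> s \<and> s \<le> t \<and> t \<le> b) \<longrightarrow>
        disjoint_family_on (\<lambda>(s, t). {s<..<t}) D \<longrightarrow> (\<Sum>(s, t)\<in>D. t - s) < d \<longrightarrow>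
        (\<Sum>(s, t)\<in>D. dist (\<gamma> s) (\<gamma> t)) < e" by (elim exE conjE)
  show ?thesis
  proof (intro exI[of _ d] conjI allI impI)
    fix s t assume "a \<le> s" "s \<le> t" "t \<le> b" "t - s < d"
    then show "dist (\<gamma> s) (\<gamma> t) < e"
      using d[rule_format, of "{(s, t)}"] by (auto simp: disjoint_family_on_def)
  qed fact
qed

lemma abs_continuous_imp_continuous_on:
  assumes "abs_continuous a b \<gamma>"
  shows "continuous_on {a..b} \<gamma>"
  unfolding continuous_on_iff
proof (intro ballI allI impI)
  fix x e :: real assume x: "x \<in> {a..b}" and e: "e > 0"
  from abs_continuous_pairD[OF assms e] obtain d where d: "d > 0"
    "\<forall>s t. a \<le> s \<longrightarrow> s \<le> t \<longrightarrow> t \<le> b \<longrightarrow> t - s < d \<longrightarrow> dist (\<gamma> s) (\<gamma> t) < e"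
    by (elim exE conjE)
  have "dist (\<gamma> y) (\<gamma> x) < e" if "y \<in> {a..b}" "dist y x < d" for y
    using d(2)[rule_format, of x y] d(2)[rule_format, of y x] that x by (cases "x \<le> y") (auto simp: dist_real_def dist_commute)
  then show "\<exists>d>0. \<forall>x'\<in>{a..b}. dist x' x < d \<longrightarrow> dist (\<gamma> x') (\<gamma> x) < e" using d(1) by blast
qed

lemma abs_continuous_affine:
  fixes x v :: "'a::real_normed_vector"
  shows "abs_continuous a b (\<lambda>t. x + t *\<^sub>R v)"
  unfolding abs_continuous_def
proof (intro allI impI)
  fix e :: real assume e: "e > 0"
  show "\<exists>d>0. \<forall>D. finite D \<and> (\<forall>(s, t) \<in> D. a \<le> s \<and> s \<le> t \<and> t \<le> b) \<and>
        disjoint_family_on (\<lambda>(s, t). {s<..<t}) D \<and> (\<Sum>(s, t)\<in>D. t - s) < d \<longrightarrow>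
        (\<Sum>(s, t)\<in>D. dist (x + s *\<^sub>R v) (x + t *\<^sub>R v)) < e"
  \<comment> \<open>Adding 1 avoids division by zero for a constant path.\<close>
  proof (intro exI[of _ "e / (norm v + 1)"] conjI allI impI)
    show "e / (norm v + 1) > 0" using e by (simp add: add_nonneg_pos)
    fix D :: "(real \<times> real) set"
    assume D: "finite D \<and> (\<forall>(s, t) \<in> D. a \<le> s \<and> s \<le> t \<and> t \<le> b) \<and>
        disjoint_family_on (\<lambda>(s, t). {s<..<t}) D \<and> (\<Sum>(s, t)\<in>D. t - s) < e / (norm v + 1)"
    have "(\<Sum>(s, t)\<in>D. dist (x + s *\<^sub>R v) (x + t *\<^sub>R v)) = (\<Sum>(s, t)\<in>D. (t - s) * norm v)"
      using D by (intro sum.cong) (auto simp: dist_norm norm_minus_commute simp flip: scaleR_diff_left)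
    also have "\<dots> = (\<Sum>(s, t)\<in>D. t - s) * norm v" by (simp add: sum_distrib_right case_prod_unfold)
    also have "\<dots> \<le> (\<Sum>(s, t)\<in>D. t - s) * (norm v + 1)"
      using D by (intro mult_left_mono sum_nonneg) auto
    also have "\<dots> < e" using D by (simp add: pos_less_divide_eq add_nonneg_pos)
    finally show "(\<Sum>(s, t)\<in>D. dist (x + s *\<^sub>R v) (x + t *\<^sub>R v)) < e" .
  qed
qed

text \<open>The pointwise form transfers to affinely rescaled intervals by substituting for
  \<open>z\<close>.\<close>

lemma disjoint_family_on_intervals:
  "disjoint_family_on (\<lambda>(s, t). {s<..<t}) D \<longleftrightarrow>
    (\<forall>p\<in>D. \<forall>q\<in>D. p \<noteq> q \<longrightarrow> (\<forall>z::real. \<not> (fst p < z \<and> z < snd p \<and> fst q < z \<and> z < snd q)))"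
  unfolding disjoint_family_on_def case_prod_unfold disjoint_iff greaterThanLessThan_iff by blast

text \<open>It turns a competitor for the distance of \<open>y\<close> to the origin into one for
  that of \<open>x\<close>, at the cost of the segment between them.\<close>

definition prepend_segment :: "'a::real_normed_vector \<Rightarrow> (real \<Rightarrow> 'a) \<Rightarrow> real \<Rightarrow> 'a" where
  "prepend_segment x \<gamma> t = (if t \<le> 1/2 then x + t *\<^sub>R (2 *\<^sub>R (\<gamma> 0 - x)) else \<gamma> (2 * t - 1))"

text \<open>Intervals left of \<open>1/2\<close> see only the segment and those right of it only
  \<open>\<gamma>\<close>. An interval across \<open>1/2\<close> is cut there, and disjointness
  permits at most one such interval.\<close>

lemma abs_continuous_prepend_segment:
  fixes \<gamma> :: "real \<Rightarrow> 'a::real_normed_vector"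
  assumes \<gamma>: "abs_continuous 0 1 \<gamma>"
  shows "abs_continuous 0 1 (prepend_segment x \<gamma>)"
  unfolding abs_continuous_def
proof (intro allI impI)
  fix e :: real assume e: "e > 0"
  let ?p = "prepend_segment x \<gamma>"
  let ?l = "\<lambda>t. x + t *\<^sub>R (2 *\<^sub>R (\<gamma> 0 - x))"
  have l: "abs_continuous 0 1 ?l" by (rule abs_continuous_affine)
  have p1: "?p t = ?l t" if "t \<le> 1/2" for t using that by (simp add: prepend_segment_def)
  have p2: "?p t = \<gamma> (2 * t - 1)" if "t \<ge> 1/2" for t
  proof (cases "t = 1/2")
    case True
    show ?thesis unfolding True by (simp add: prepend_segment_def)
  qed (use that in \<open>auto simp: prepend_segment_def\<close>)
  have e4: "e / 4 > 0" using e by simp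
  from abs_continuousD[OF l e4] obtain d1 where d1: "d1 > 0"
    "\<forall>D. finite D \<longrightarrow> (\<forall>s t. (s, t) \<in> D \<longrightarrow> 0 \<le> s \<and> s \<le> t \<and> t \<le> 1) \<longrightarrow>
        disjoint_family_on (\<lambda>(s, t). {s<..<t}) D \<longrightarrow> (\<Sum>(s, t)\<in>D. t - s) < d1 \<longrightarrow>
        (\<Sum>(s, t)\<in>D. dist (?l s) (?l t)) < e / 4" by (elim exE conjE)
  from abs_continuousD[OF \<gamma> e4] obtain d2 where d2: "d2 > 0"
    "\<forall>D. finite D \<longrightarrow> (\<forall>s t. (s, t) \<in> D \<longrightarrow> 0 \<le> s \<and> s \<le> t \<and> t \<le> 1) \<longrightarrow>
        disjoint_family_on (\<lambda>(s, t). {s<..<t}) D \<longrightarrow> (\<Sum>(s, t)\<in>D. t - s) < d2 \<longrightarrow>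
        (\<Sum>(s, t)\<in>D. dist (\<gamma> s) (\<gamma> t)) < e / 4" by (elim exE conjE)
  from abs_continuous_pairD[OF l e4] obtain d3 where d3: "d3 > 0"
    "\<forall>s t. 0 \<le> s \<longrightarrow> s \<le> t \<longrightarrow> t \<le> 1 \<longrightarrow> t - s < d3 \<longrightarrow> dist (?l s) (?l t) < e / 4"
    by (elim exE conjE)
  from abs_continuous_pairD[OF \<gamma> e4] obtain d4 where d4: "d4 > 0"
    "\<forall>s t. 0 \<le> s \<longrightarrow> s \<le> t \<longrightarrow> t \<le> 1 \<longrightarrow> t - s < d4 \<longrightarrow> dist (\<gamma> s) (\<gamma> t) < e / 4"
    by (elim exE conjE)
  \<comment> \<open>On the second half the parameter runs at double speed, hence the halved
    \<open>d2\<close> and \<open>d4\<close>. The bounds \<open>d3\<close> and \<open>d4\<close>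
    serve the two pieces of the interval across \<open>1/2\<close>.\<close>
  define d where "d = min (min d1 (d2 / 2)) (min d3 (d4 / 2))"
  show "\<exists>d>0. \<forall>D. finite D \<and> (\<forall>(s, t) \<in> D. 0 \<le> s \<and> s \<le> t \<and> t \<le> 1) \<and>
        disjoint_family_on (\<lambda>(s, t). {s<..<t}) D \<and> (\<Sum>(s, t)\<in>D. t - s) < d \<longrightarrow>
        (\<Sum>(s, t)\<in>D. dist (?p s) (?p t)) < e"
  proof (intro exI[of _ d] conjI allI impI)
    show "d > 0" using d1(1) d2(1) d3(1) d4(1) by (simp add: d_def)
    fix D :: "(real \<times> real) set"
    assume "finite D \<and> (\<forall>(s, t) \<in> D. 0 \<le> s \<and> s \<le> t \<and> t \<le> 1) \<and>
        disjoint_family_on (\<lambda>(s, t). {s<..<t}) D \<and> (\<Sum>(s, t)\<in>D. t - s) < d"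
    then have D: "finite D" "\<And>s t. (s, t) \<in> D \<Longrightarrow> 0 \<le> s \<and> s \<le> t \<and> t \<le> 1"
      "disjoint_family_on (\<lambda>(s, t). {s<..<t}) D" "(\<Sum>(s, t)\<in>D. t - s) < d" by auto
    have sub: "(\<Sum>(s, t)\<in>D'. t - s) < d" if "D' \<subseteq> D" for D'
    proof -
      have "(\<Sum>(s, t)\<in>D'. t - s) \<le> (\<Sum>(s, t)\<in>D. t - s)"
        by (rule sum_mono2[OF D(1) that]) (use D(2) in auto)
      then show ?thesis using D(4) by linarith
    qed
    have disj: "disjoint_family_on (\<lambda>(s, t). {s<..<t}) D'" if "D' \<subseteq> D" for D'
      by (rule disjoint_family_on_mono[OF that D(3)])
    define D1 where "D1 = {p \<in> D. snd p \<le> 1/2}"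
    define D2 where "D2 = {p \<in> D. \<not> snd p \<le> 1/2 \<and> fst p \<ge> 1/2}"
    define D3 where "D3 = {p \<in> D. \<not> snd p \<le> 1/2 \<and> \<not> fst p \<ge> 1/2}"
    have fin: "finite D1" "finite D2" "finite D3" using D(1) by (auto simp: D1_def D2_def D3_def)
    have dec: "D = D1 \<union> (D2 \<union> D3)" "D1 \<inter> (D2 \<union> D3) = {}" "D2 \<inter> D3 = {}"
      by (auto simp: D1_def D2_def D3_def)
    have "(\<Sum>(s, t)\<in>D. dist (?p s) (?p t)) = (\<Sum>(s, t)\<in>D1. dist (?p s) (?p t)) +
        ((\<Sum>(s, t)\<in>D2. dist (?p s) (?p t)) + (\<Sum>(s, t)\<in>D3. dist (?p s) (?p t)))"
      using fin dec(2,3) by (subst dec(1)) (simp add: sum.union_disjoint)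
    also have "\<dots> < e / 4 + (e / 4 + e / 2)"
    proof (intro add_strict_mono)
      have "(\<Sum>(s, t)\<in>D1. dist (?p s) (?p t)) = (\<Sum>(s, t)\<in>D1. dist (?l s) (?l t))"
        using D(2) by (intro sum.cong refl) (auto simp: D1_def p1 dest!: D(2))
      also have "\<dots> < e / 4"
        by (rule d1(2)[rule_format]) (use D(2) fin sub[of D1] in \<open>auto simp: D1_def d_def intro!: disj\<close>)
      finally show "(\<Sum>(s, t)\<in>D1. dist (?p s) (?p t)) < e / 4" .
    next
      let ?f = "\<lambda>(s, t). (2 * s - 1, 2 * t - 1 :: real)"
      have inj: "inj_on ?f D2" by (auto simp: inj_on_def)
      have "(\<Sum>(s, t)\<in>D2. dist (?p s) (?p t)) = (\<Sum>(s, t)\<in>?f ` D2. dist (\<gamma> s) (\<gamma> t))"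
        unfolding sum.reindex[OF inj] by (intro sum.cong refl) (auto simp: D2_def p2 dest!: D(2))
      also have "\<dots> < e / 4"
      proof (rule d2(2)[rule_format])
        show "0 \<le> s \<and> s \<le> t \<and> t \<le> 1" if "(s, t) \<in> ?f ` D2" for s t
          using that by (auto simp: D2_def dest!: D(2))
        have "(\<Sum>(s, t)\<in>?f ` D2. t - s) = 2 * (\<Sum>(s, t)\<in>D2. t - s)"
          unfolding sum.reindex[OF inj] sum_distrib_left by (intro sum.cong) auto
        also have "\<dots> < d2" using sub[of D2] by (auto simp: D2_def d_def)
        finally show "(\<Sum>(s, t)\<in>?f ` D2. t - s) < d2" .
        show "disjoint_family_on (\<lambda>(s, t). {s<..<t}) (?f ` D2)"
          unfolding disjoint_family_on_intervals
        proof (intro ballI impI allI)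
          fix p q :: "real \<times> real" and z :: real
          assume "p \<in> ?f ` D2" "q \<in> ?f ` D2" "p \<noteq> q"
          then obtain p' q' where pq: "p' \<in> D2" "q' \<in> D2" "p = ?f p'" "q = ?f q'" "p' \<noteq> q'" by blast
          have "disjoint_family_on (\<lambda>(s, t). {s<..<t}) D2" by (rule disj) (auto simp: D2_def)
          then have "\<not> (fst p' < (z + 1) / 2 \<and> (z + 1) / 2 < snd p' \<and> fst q' < (z + 1) / 2 \<and> (z + 1) / 2 < snd q')"
            unfolding disjoint_family_on_intervals using pq by blast
          then show "\<not> (fst p < z \<and> z < snd p \<and> fst q < z \<and> z < snd q)"
            using pq by (auto simp: case_prod_unfold)
        qed
      qed (use fin in auto)
      finally show "(\<Sum>(s, t)\<in>D2. dist (?p s) (?p t)) < e / 4" .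
    next
      \<comment> \<open>Two different members would both contain the point
        \<open>1/2\<close>.\<close>
      have "D3 = {} \<or> (\<exists>s t. D3 = {(s, t)})"
      proof (cases "D3 = {}")
        case False
        then obtain p where p: "p \<in> D3" by blast
        have "q = p" if "q \<in> D3" for q
        proof -
          have "fst p < 1/2" "1/2 < snd p" "fst q < 1/2" "1/2 < snd q" "p \<in> D" "q \<in> D"
            using p that by (auto simp: D3_def)
          then show ?thesis using D(3) unfolding disjoint_family_on_intervals by metis
        qed
        then show ?thesis using p by (cases p) blast
      qed simp
      then show "(\<Sum>(s, t)\<in>D3. dist (?p s) (?p t)) < e / 2"
      proof (elim disjE exE)
        assume "D3 = {}" then show ?thesis using e by simp
      next
        fix s t assume st: "D3 = {(s, t)}"
        then have "(s, t) \<in> D3" by simp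
        then have st': "(s, t) \<in> D" "s < 1/2" "1/2 < t" by (auto simp: D3_def)
        have "t - s < d" using sub[of D3] st by (auto simp: D3_def)
        moreover have "dist (?p s) (?p (1/2)) < e / 4" if "t - s < d"
          unfolding p1[OF less_imp_le[OF st'(2)]] p1[OF order_refl]
          by (rule d3(2)[rule_format]) (use that st' D(2)[OF st'(1)] in \<open>auto simp: d_def\<close>)
        moreover have "dist (?p (1/2)) (?p t) < e / 4" if "t - s < d"
          unfolding p2[OF less_imp_le[OF st'(3)]] p2[OF order_refl]
          by (rule d4(2)[rule_format]) (use that st' D(2)[OF st'(1)] in \<open>auto simp: d_def\<close>)
        ultimately have "dist (?p s) (?p t) < e / 2"
          using dist_triangle[of "?p s" "?p t" "?p (1/2)"] by linarith
        then show ?thesis using st by simp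
      qed
    qed
    finally show "(\<Sum>(s, t)\<in>D. dist (?p s) (?p t)) < e" by simp
  qed
qed

text \<open>On the open interval the two-sided derivative depends only on values of the path inside
  \<open>[0,1]\<close>, the ones that absolute continuity constrains. The omitted end points form a
  null set.\<close>

definition agmon_integrand :: "(real ^ 'n \<Rightarrow> real) \<Rightarrow> real \<Rightarrow> (real \<Rightarrow> real ^ 'n) \<Rightarrow> real \<Rightarrow> real" where
  "agmon_integrand V E \<gamma> t =
     indicator {0<..<1} t * (sqrt (max (V (\<gamma> t) - E) 0) * norm (vector_derivative \<gamma> (at t)))"

lemma agmon_integrand_nonneg: "0 \<le> agmon_integrand V E \<gamma> t"
  by (simp add: agmon_integrand_def)

lemma agmon_integrand_measurable:
  fixes \<gamma> :: "real \<Rightarrow> real ^ 'n"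
  assumes V: "continuous_on UNIV V" and \<gamma>: "continuous_on {0..1} \<gamma>"
  shows "agmon_integrand V E \<gamma> \<in> borel_measurable borel"
proof -
  \<comment> \<open>Clamping the parameter gives a curve continuous on the whole line, to which the
    measurability result applies; its derivative agrees with that of \<open>\<gamma>\<close> on the
    open interval.\<close>
  define \<beta> where "\<beta> t = \<gamma> (max 0 (min 1 t))" for t
  have \<beta>: "continuous_on UNIV \<beta>"
    unfolding \<beta>_def by (intro continuous_on_compose2[OF \<gamma>] continuous_intros) auto
  have eq: "\<beta> t = \<gamma> t" if "t \<in> {0<..<1}" for t using that by (auto simp: \<beta>_def)
  have "agmon_integrand V E \<gamma> = (\<lambda>t. indicator {0<..<1} t * (sqrt (max (V (\<beta> t) - E) 0) * norm (vector_derivative \<beta> (at t))))"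
  proof
    fix t show "agmon_integrand V E \<gamma> t = indicator {0<..<1} t * (sqrt (max (V (\<beta> t) - E) 0) * norm (vector_derivative \<beta> (at t)))"
      using eq vector_derivative_cong_open[of "{0<..<1}" t \<beta> \<gamma>]
      by (cases "t \<in> {0<..<1}") (simp_all add: agmon_integrand_def)
  qed
  moreover have "continuous_on UNIV (\<lambda>t. sqrt (max (V (\<beta> t) - E) 0))"
    by (intro continuous_intros continuous_on_compose2[OF V \<beta>]) auto
  then have "(\<lambda>t. sqrt (max (V (\<beta> t) - E) 0)) \<in> borel_measurable borel"
    by (rule borel_measurable_continuous_onI)
  ultimately show ?thesis using borel_measurable_vector_derivative[OF \<beta>] by simp
qed

text \<open>In \<open>ennreal\<close> a divergent length stays visible as infinity, and sums and
  substitutions need no integrability.\<close>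

definition agmon_nn_length :: "(real ^ 'n \<Rightarrow> real) \<Rightarrow> real \<Rightarrow> (real \<Rightarrow> real ^ 'n) \<Rightarrow> ennreal" where
  "agmon_nn_length V E \<gamma> = (\<integral>\<^sup>+t. ennreal (agmon_integrand V E \<gamma> t) \<partial>lborel)"

text \<open>If the integral diverges then both sides are \<open>0\<close>.\<close>

lemma agmon_length_eq:
  fixes \<gamma> :: "real \<Rightarrow> real ^ 'n"
  assumes V: "continuous_on UNIV V" and \<gamma>: "continuous_on {0..1} \<gamma>"
  shows "agmon_length V E \<gamma> = enn2real (agmon_nn_length V E \<gamma>)"
proof -
  note [measurable] = agmon_integrand_measurable[OF V \<gamma>, of E]
  have "agmon_length V E \<gamma> = (\<integral>t. agmon_integrand V E \<gamma> t \<partial>lebesgue)"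
    unfolding agmon_length_def set_lebesgue_integral_def
  proof (rule integral_cong_AE)
    have ae: "AE t in lebesgue. t \<notin> {0, 1::real}"
      by (rule AE_not_in) (auto intro: negligible_finite simp flip: negligible_iff_null_sets)
    then have ae': "AE t in lebesgue. agmon_integrand V E \<gamma> t =
        indicat_real {0..1} t *\<^sub>R (sqrt (max (V (\<gamma> t) - E) 0) * norm (vector_derivative \<gamma> (at t)))"
      by eventually_elim (auto simp: agmon_integrand_def indicator_def)
    then show "AE t in lebesgue. indicat_real {0..1} t *\<^sub>R (sqrt (max (V (\<gamma> t) - E) 0) * norm (vector_derivative \<gamma> (at t)))
        = agmon_integrand V E \<gamma> t"
      by eventually_elim simp
    show m: "agmon_integrand V E \<gamma> \<in> borel_measurable lebesgue"
      by (rule measurable_completion) simp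
    show "(\<lambda>t. indicat_real {0..1} t *\<^sub>R (sqrt (max (V (\<gamma> t) - E) 0) * norm (vector_derivative \<gamma> (at t)))) \<in> borel_measurable lebesgue"
      by (rule borel_measurable_AE[OF m ae'])
  qed
  also have "\<dots> = (\<integral>t. agmon_integrand V E \<gamma> t \<partial>lborel)" by (rule integral_completion) simp
  also have "\<dots> = enn2real (agmon_nn_length V E \<gamma>)"
    unfolding agmon_nn_length_def by (rule integral_eq_nn_integral) (auto simp: agmon_integrand_nonneg)
  finally show ?thesis .
qed

lemma prepend_segment_path:
  assumes "\<gamma> \<in> agmon_paths y z"
  shows "prepend_segment x \<gamma> \<in> agmon_paths x z"
  using assms abs_continuous_prepend_segment[of \<gamma> x]
  by (auto simp: agmon_paths_def prepend_segment_def)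

text \<open>The segment is run for time \<open>1/2\<close> at speed twice the distance, which costs
  at most \<open>B\<close> times the distance. On the second half the integrand is at most twice
  that of \<open>\<gamma>\<close> at \<open>2 * t - 1\<close>, and the change of variables absorbs
  the factor.\<close>

lemma agmon_length_prepend_segment_le:
  fixes \<gamma> :: "real \<Rightarrow> real ^ 'n"
  assumes V: "continuous_on UNIV V" and \<gamma>: "abs_continuous 0 1 \<gamma>"
    and B: "0 \<le> B" "\<And>z. z \<in> closed_segment x (\<gamma> 0) \<Longrightarrow> sqrt (max (V z - E) 0) \<le> B"
  shows "agmon_length V E (prepend_segment x \<gamma>) \<le> B * dist x (\<gamma> 0) + agmon_length V E \<gamma>"
proof -
  let ?p = "prepend_segment x \<gamma>"
  let ?a = "agmon_integrand V E"
  have c: "continuous_on {0..1} \<gamma>" by (rule abs_continuous_imp_continuous_on[OF \<gamma>])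
  have cp: "continuous_on {0..1} ?p"
    by (rule abs_continuous_imp_continuous_on[OF abs_continuous_prepend_segment[OF \<gamma>]])
  note [measurable] = agmon_integrand_measurable[OF V c, of E] agmon_integrand_measurable[OF V cp, of E]
  have subst: "agmon_nn_length V E \<gamma> = 2 * (\<integral>\<^sup>+t. ennreal (?a \<gamma> (2 * t - 1)) \<partial>lborel)"
    unfolding agmon_nn_length_def using nn_integral_real_affine[of "\<lambda>t. ennreal (?a \<gamma> t)" 2 "-1"]
    by (simp add: algebra_simps)
  have vd2: "vector_derivative ?p (at t) = vector_derivative (\<lambda>s. \<gamma> (2 * s - 1)) (at t)" if "t > 1/2" for t
    by (rule vector_derivative_cong_open[of "{1/2<..}"]) (use that in \<open>auto simp: prepend_segment_def\<close>)
  have vd1: "vector_derivative ?p (at t) = 2 *\<^sub>R (\<gamma> 0 - x)" if "t < 1/2" for t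
  proof -
    have "vector_derivative ?p (at t) = vector_derivative (\<lambda>t. x + t *\<^sub>R (2 *\<^sub>R (\<gamma> 0 - x))) (at t)"
      by (rule vector_derivative_cong_open[of "{..<1/2}"]) (use that in \<open>auto simp: prepend_segment_def\<close>)
    also have "\<dots> = 2 *\<^sub>R (\<gamma> 0 - x)"
      by (rule vector_derivative_at) (auto intro!: derivative_eq_intros)
    finally show ?thesis .
  qed
  have half: "?a ?p t \<le> 2 * ?a \<gamma> (2 * t - 1)" "?a \<gamma> (2 * t - 1) \<le> ?a ?p t" if "t > 1/2" for t
    using that
      mult_left_mono[OF norm_vector_derivative_affine_bounds(1)[of \<gamma> t], of "sqrt (max (V (\<gamma> (2 * t - 1)) - E) 0)"]
      mult_left_mono[OF norm_vector_derivative_affine_bounds(2)[of \<gamma> t], of "sqrt (max (V (\<gamma> (2 * t - 1)) - E) 0)"]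
    by (auto simp: agmon_integrand_def indicator_def vd2 prepend_segment_def)
  \<comment> \<open>At the junction the derivative is not controlled; the single point is excluded
    as a null set.\<close>
  have upper: "ennreal (?a ?p t) \<le> ennreal (2 * B * dist x (\<gamma> 0)) * indicator {0..1/2} t + 2 * ennreal (?a \<gamma> (2 * t - 1))"
    if t: "t \<noteq> 1/2" for t
  proof -
    consider "t < 0" | "0 \<le> t" "t < 1/2" | "t > 1/2" using t by linarith
    then show ?thesis
    proof cases
      case 2
      have "?p t = (1 - 2 * t) *\<^sub>R x + (2 * t) *\<^sub>R \<gamma> 0"
        using 2 by (simp add: prepend_segment_def algebra_simps)
      then have "?p t \<in> closed_segment x (\<gamma> 0)" using 2 by (auto simp: in_segment intro!: exI[of _ "2 * t"])
      then have "sqrt (max (V (?p t) - E) 0) * norm (vector_derivative ?p (at t)) \<le> B * (2 * dist x (\<gamma> 0))"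
        using B 2 by (intro mult_mono) (auto simp: vd1 dist_norm norm_minus_commute)
      then have "?a ?p t \<le> 2 * B * dist x (\<gamma> 0)"
        using B by (auto simp: agmon_integrand_def indicator_def)
      then have "ennreal (?a ?p t) \<le> ennreal (2 * B * dist x (\<gamma> 0)) * indicator {0..1/2} t"
        using 2 by (simp add: ennreal_leI)
      then show ?thesis by (meson add_increasing2 order_trans zero_le)
    next
      case 3
      then show ?thesis using ennreal_leI[OF half(1)[of t]] by (simp add: ennreal_mult')
    qed (simp add: agmon_integrand_def)
  qed
  have 1: "agmon_nn_length V E ?p \<le> ennreal (B * dist x (\<gamma> 0)) + agmon_nn_length V E \<gamma>"
  proof -
    have "AE t in lborel. t \<noteq> 1/2" by (rule AE_lborel_singleton)
    then have "agmon_nn_length V E ?p \<le>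
        (\<integral>\<^sup>+t. ennreal (2 * B * dist x (\<gamma> 0)) * indicator {0..1/2} t + 2 * ennreal (?a \<gamma> (2 * t - 1)) \<partial>lborel)"
      unfolding agmon_nn_length_def by (intro nn_integral_mono_AE) (auto elim!: eventually_mono upper)
    also have "\<dots> = (\<integral>\<^sup>+t. ennreal (2 * B * dist x (\<gamma> 0)) * indicator {0..1/2::real} t \<partial>lborel) + agmon_nn_length V E \<gamma>"
      by (simp add: nn_integral_add nn_integral_cmult subst)
    also have "(\<integral>\<^sup>+t. ennreal (2 * B * dist x (\<gamma> 0)) * indicator {0..1/2::real} t \<partial>lborel)
        = ennreal (2 * B * dist x (\<gamma> 0)) * emeasure lborel {0..1/2::real}"
      by (rule nn_integral_cmult_indicator) simp
    also have "emeasure lborel {0..1/2::real} = ennreal (1/2)"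
      by (subst emeasure_lborel_Icc) auto
    also have "ennreal (2 * B * dist x (\<gamma> 0)) * ennreal (1/2) = ennreal (B * dist x (\<gamma> 0))"
      using B(1) by (subst ennreal_mult[symmetric]) auto
    finally show ?thesis .
  qed
  \<comment> \<open>The reverse comparison serves the divergent case: if \<open>\<gamma>\<close> has
    infinite length then so has its extension, and both real lengths are 0.\<close>
  have 2: "agmon_nn_length V E \<gamma> \<le> 2 * agmon_nn_length V E ?p"
    unfolding subst
  proof (rule mult_left_mono)
    have "?a \<gamma> (2 * t - 1) \<le> ?a ?p t" for t
      using half(2)[of t] agmon_integrand_nonneg[of V E ?p t]
      by (cases "t > 1/2") (auto simp: agmon_integrand_def[of V E \<gamma>])
    then show "(\<integral>\<^sup>+t. ennreal (?a \<gamma> (2 * t - 1)) \<partial>lborel) \<le> agmon_nn_length V E ?p"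
      unfolding agmon_nn_length_def by (intro nn_integral_mono ennreal_leI)
  qed simp
  show ?thesis
  proof (cases "agmon_nn_length V E \<gamma> = \<infinity>")
    case True
    then have "agmon_nn_length V E ?p = \<infinity>"
      using 2 by (auto simp: ennreal_mult_eq_top_iff top_unique)
    then show ?thesis using B(1) by (simp add: agmon_length_eq[OF V cp] agmon_length_eq[OF V c])
  next
    case False
    then have "enn2real (agmon_nn_length V E ?p) \<le> enn2real (ennreal (B * dist x (\<gamma> 0)) + agmon_nn_length V E \<gamma>)"
      using 1 by (intro enn2real_mono) (auto simp: less_top)
    also have "\<dots> = B * dist x (\<gamma> 0) + enn2real (agmon_nn_length V E \<gamma>)"
      using False B(1) by (subst enn2real_plus) (auto simp: less_top)
    finally show ?thesis by (simp add: agmon_length_eq[OF V cp] agmon_length_eq[OF V c])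
  qed
qed

section \<open>Segment bounds for the Agmon distance\<close>

lemma agmon_length_nonneg: "0 \<le> agmon_length V E \<gamma>"
  unfolding agmon_length_def set_lebesgue_integral_def by (intro Bochner_Integration.integral_nonneg) simp

lemma agmon_paths_nonempty: "agmon_paths x y \<noteq> {}"
proof -
  have "(\<lambda>t. x + t *\<^sub>R (y - x)) \<in> agmon_paths x y"
    by (simp add: agmon_paths_def abs_continuous_affine)
  then show ?thesis by blast
qed

lemma agmon_dist_nonneg: "0 \<le> agmon_dist V E x"
  unfolding agmon_dist_def agmon_metric_def
  by (rule cINF_greatest[OF agmon_paths_nonempty agmon_length_nonneg])

lemma agmon_dist_le:
  fixes x y :: "real ^ 'n"
  assumes V: "continuous_on UNIV V"
    and B: "0 \<le> B" "\<And>z. z \<in> closed_segment x y \<Longrightarrow> sqrt (max (V z - E) 0) \<le> B"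
  shows "agmon_dist V E x \<le> agmon_dist V E y + B * dist x y"
proof -
  have "agmon_dist V E x - B * dist x y \<le> agmon_length V E \<gamma>" if \<gamma>: "\<gamma> \<in> agmon_paths y 0" for \<gamma>
  proof -
    have "agmon_dist V E x \<le> agmon_length V E (prepend_segment x \<gamma>)"
      unfolding agmon_dist_def agmon_metric_def
      by (rule cINF_lower) (auto intro: bdd_belowI2[of _ 0] agmon_length_nonneg prepend_segment_path[OF \<gamma>])
    also have "\<dots> \<le> B * dist x y + agmon_length V E \<gamma>"
      using agmon_length_prepend_segment_le[OF V, of \<gamma> B x E] \<gamma> B by (simp add: agmon_paths_def)
    finally show ?thesis by simp
  qed
  then have "agmon_dist V E x - B * dist x y \<le> agmon_dist V E y"
    unfolding agmon_dist_def[of V E y] agmon_metric_def by (intro cINF_greatest[OF agmon_paths_nonempty])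
  then show ?thesis by simp
qed

text \<open>Exchanging the end points makes the one-sided bound two-sided. Stating the hypothesis
  with \<open>B\<^sup>2\<close> matches the squared gradient that mollification will
  produce.\<close>

lemma agmon_dist_diff_le:
  fixes x y :: "real ^ 'n"
  assumes V: "continuous_on UNIV V"
    and B: "0 \<le> B" "\<And>z. z \<in> closed_segment x y \<Longrightarrow> max (V z - E) 0 \<le> B\<^sup>2"
  shows "\<bar>agmon_dist V E x - agmon_dist V E y\<bar> \<le> B * dist x y"
proof -
  have *: "sqrt (max (V z - E) 0) \<le> B" if "z \<in> closed_segment x y" for z
    using B(1) real_sqrt_le_mono[OF B(2)[OF that]] by simp
  show ?thesis
    using agmon_dist_le[OF V B(1), of x y E] agmon_dist_le[OF V B(1), of y x E] *
    by (simp add: closed_segment_commute[of y x] dist_commute[of y x] abs_le_iff)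
qed

section \<open>Weights\<close>

lemma mollify_translate:
  fixes f :: "'a::euclidean_space \<Rightarrow> 'b::{banach,second_countable_topology}"
  assumes r: "r > 0" and [measurable]: "f \<in> borel_measurable borel"
  shows "mollify r f (x + z) = mollify r (\<lambda>y. f (z + y)) x"
proof -
  note [measurable] = mollifier_measurable[OF r, where 'a='a]
  have "(\<integral>y. mollifier r (x + z - (z + y)) *\<^sub>R f (z + y) \<partial>lborel) = (\<integral>y. mollifier r (x + z - y) *\<^sub>R f y \<partial>lborel)"
    by (rule lborel_integral_translate) measurable
  then show ?thesis by (simp add: mollify_def)
qed

text \<open>The gradient \<open>c\<close> is tested in its own direction: the derivative along
  \<open>c\<close> is \<open>(norm c)\<^sup>2\<close>, while difference quotients along
  \<open>c\<close> are at most \<open>L * norm c\<close>. Bounding the partial derivatives one by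
  one would cost a factor of the dimension.\<close>

lemma mollify_gradient_le:
  fixes u :: "real ^ 'n \<Rightarrow> real"
  assumes r: "r > 0" and u: "continuous_on UNIV u" and L: "0 \<le> L" and d: "d > 0"
    and lip: "\<And>y z. norm (x - y) < r + d \<Longrightarrow> norm (x - z) < r + d \<Longrightarrow> \<bar>u y - u z\<bar> \<le> L * norm (y - z)"
  shows "(\<Sum>i\<in>UNIV. (\<integral>y. mollifier_deriv r (x - y) (axis i 1) *\<^sub>R u y \<partial>lborel)\<^sup>2) \<le> L\<^sup>2"
proof -
  define c where "c = (\<chi> i. \<integral>y. mollifier_deriv r (x - y) (axis i 1) *\<^sub>R u y \<partial>lborel)"
  have u_li: "locally_integrable u" by (rule continuous_locally_integrable[OF u])
  have [measurable]: "u \<in> borel_measurable borel" by (rule borel_measurable_continuous_onI[OF u])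
  have sq: "(norm c)\<^sup>2 = (\<Sum>i\<in>UNIV. (c $ i)\<^sup>2)"
    unfolding power2_norm_eq_inner inner_vec_def by (simp add: power2_eq_square)
  have int: "integrable lborel (\<lambda>y. mollifier_deriv r (x - y) v *\<^sub>R u y)" for v
  proof (rule locally_integrable_scaleR_compact_support[OF u_li, of _ "norm x + r"])
    show "continuous_on UNIV (\<lambda>y. mollifier_deriv r (x - y) v)"
      by (intro continuous_on_compose2[OF mollifier_deriv_continuous[OF r]] continuous_intros) auto
    show "mollifier_deriv r (x - y) v = 0" if "norm y > norm x + r" for y
      using that norm_triangle_ineq2[of y x] by (intro mollifier_deriv_eq_0[OF r]) (simp add: norm_minus_commute)
  qed
  have lin: "mollifier_deriv r z c = (\<Sum>i\<in>UNIV. c $ i * mollifier_deriv r z (axis i 1))" for z :: "real ^ 'n"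
    by (simp add: mollifier_deriv_def inner_axis inner_vec_def[of z c] sum_divide_distrib sum_distrib_left
        algebra_simps sum_negf[symmetric])
  have "(\<integral>y. mollifier_deriv r (x - y) c *\<^sub>R u y \<partial>lborel)
      = (\<integral>y. (\<Sum>i\<in>UNIV. c $ i * (mollifier_deriv r (x - y) (axis i 1) *\<^sub>R u y)) \<partial>lborel)"
    by (simp add: lin sum_distrib_right mult.assoc)
  also have "\<dots> = (\<Sum>i\<in>UNIV. c $ i * (\<integral>y. mollifier_deriv r (x - y) (axis i 1) *\<^sub>R u y \<partial>lborel))"
    by (subst Bochner_Integration.integral_sum) (use int in \<open>auto intro!: integrable_mult_right\<close>)
  also have "\<dots> = (norm c)\<^sup>2"
    unfolding sq by (simp add: c_def power2_eq_square)
  finally have Dc: "(\<integral>y. mollifier_deriv r (x - y) c *\<^sub>R u y \<partial>lborel) = (norm c)\<^sup>2" .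
  have "((\<lambda>t. (mollify r u (x + t *\<^sub>R c) - mollify r u x) /\<^sub>R t) \<longlongrightarrow> (norm c)\<^sup>2) (at 0)"
    using mollify_has_vector_derivative[OF r u_li, of x c]
    unfolding Dc has_vector_derivative_at_iff_tendsto by simp
  then have "((\<lambda>t. norm ((mollify r u (x + t *\<^sub>R c) - mollify r u x) /\<^sub>R t)) \<longlongrightarrow> norm ((norm c)\<^sup>2)) (at 0)"
    by (rule tendsto_norm)
  \<comment> \<open>The margin \<open>d\<close> makes room for the shift by
    \<open>t *\<^sub>R c\<close>: both points compared stay within \<open>r + d\<close> of
    \<open>x\<close>.\<close>
  moreover have "\<forall>\<^sub>F t in at 0. norm ((mollify r u (x + t *\<^sub>R c) - mollify r u x) /\<^sub>R t) \<le> L * norm c"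
  proof -
    have "((\<lambda>t. norm (t *\<^sub>R c)) \<longlongrightarrow> norm (0 *\<^sub>R c)) (at 0)" by (intro tendsto_intros)
    then have "\<forall>\<^sub>F t in at 0. norm (t *\<^sub>R c) < d" using d by (intro order_tendstoD(2)) auto
    moreover have "\<forall>\<^sub>F t in at (0::real). t \<noteq> 0" by (simp add: eventually_at_filter)
    ultimately show ?thesis
    proof eventually_elim
      case (elim t)
      have tr: "continuous_on UNIV (\<lambda>y. u (t *\<^sub>R c + y))"
        by (intro continuous_on_compose2[OF u] continuous_intros) auto
      have "mollify r u (x + t *\<^sub>R c) - mollify r u x = mollify r (\<lambda>y. u (t *\<^sub>R c + y) - u y) x"
        by (simp add: mollify_translate[OF r] mollify_diff[OF r continuous_locally_integrable[OF tr] u_li])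
      also have "norm \<dots> \<le> L * norm (t *\<^sub>R c)"
      proof (rule norm_mollify_le[OF r locally_integrable_diff[OF continuous_locally_integrable[OF tr] u_li]])
        have "norm (u (t *\<^sub>R c + y) - u y) \<le> L * norm (t *\<^sub>R c)" if "norm (x - y) < r" for y
        proof -
          have "norm (x - (t *\<^sub>R c + y)) < r + d"
            using that elim norm_triangle_ineq4[of "x - y" "t *\<^sub>R c"] by (simp add: algebra_simps)
          then show ?thesis using lip[of "t *\<^sub>R c + y" y] that d by simp
        qed
        then show "AE y in lborel. norm (x - y) < r \<longrightarrow> norm (u (t *\<^sub>R c + y) - u y) \<le> L * norm (t *\<^sub>R c)"
          by (intro AE_I2) blast
      qed
      finally show ?case using elim by (simp add: field_simps)
    qed
  qed
  ultimately have "norm ((norm c)\<^sup>2) \<le> L * norm c" by (intro tendsto_upperbound) auto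
  then have "norm c \<le> L"
    using L by (cases "norm c = 0") (auto simp: power2_eq_square)
  then have "(norm c)\<^sup>2 \<le> L\<^sup>2" by (intro power_mono) auto
  then show ?thesis unfolding sq by (simp add: c_def)
qed

text \<open>The outer square makes the positive part continuously differentiable, the regularity
  that the energy inequality asks of a weight; the squared norm avoids a kink at the origin.\<close>

definition cutoff :: "real \<Rightarrow> real ^ 'n \<Rightarrow> real" where
  "cutoff R x = (max 0 (1 - (norm x)\<^sup>2 / R\<^sup>2))\<^sup>2"

definition cutoff_deriv :: "real \<Rightarrow> 'n \<Rightarrow> real ^ 'n \<Rightarrow> real" where
  "cutoff_deriv R i x = 2 * max 0 (1 - (norm x)\<^sup>2 / R\<^sup>2) * (- 2 * x $ i / R\<^sup>2)"

lemma max_0_square_has_derivative: "((\<lambda>s. (max 0 s)\<^sup>2) has_real_derivative 2 * max 0 s) (at (s::real))"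
proof -
  consider "s < 0" | "s = 0" | "s > 0" by linarith
  then show ?thesis
  proof cases
    case 1
    have "((\<lambda>s. 0) has_real_derivative 2 * max 0 s) (at s)" using 1 by simp
    then show ?thesis
      by (rule has_field_derivative_transform_within_open[where S="{..<0}"]) (use 1 in auto)
  next
    case 2
    have "((\<lambda>s. max 0 s :: real) \<longlongrightarrow> 0) (at 0)"
      using tendsto_max[OF tendsto_const tendsto_ident_at, of 0 "0::real" UNIV] by simp
    then have "((\<lambda>s. (max 0 s)\<^sup>2 / s :: real) \<longlongrightarrow> 0) (at 0)"
      by (rule Lim_transform_eventually) (auto simp: eventually_at_filter max_def power2_eq_square)
    then show ?thesis using 2 by (simp add: has_field_derivative_iff)
  next
    case 3
    have "((\<lambda>s. s\<^sup>2) has_real_derivative 2 * max 0 s) (at s)" using 3 by (auto intro!: derivative_eq_intros)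
    then show ?thesis
      by (rule has_field_derivative_transform_within_open[where S="{0<..}"]) (use 3 in auto)
  qed
qed

context
  fixes R :: real
  assumes R: "R > 0"
begin

lemma cutoff_range: "0 \<le> cutoff R x" "cutoff R x \<le> 1"
  by (auto simp: cutoff_def power_le_one)

lemma norm_gt_cutoff_radius: "norm x > R \<Longrightarrow> max 0 (1 - (norm x)\<^sup>2 / R\<^sup>2) = 0"
  using R power_strict_mono[of R "norm x" 2] by (simp add: max_def field_simps)

lemma cutoff_eq_0: "norm x > R \<Longrightarrow> cutoff R x = 0" "norm x > R \<Longrightarrow> cutoff_deriv R i x = 0"
  by (simp_all only: cutoff_def cutoff_deriv_def norm_gt_cutoff_radius) simp_all

lemma cutoff_continuous: "continuous_on UNIV (cutoff R)" "continuous_on UNIV (cutoff_deriv R i)"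
  unfolding cutoff_def[abs_def] cutoff_deriv_def[abs_def] using R by (auto intro!: continuous_intros)

lemma cutoff_has_vector_derivative:
  "((\<lambda>t. cutoff R (x + t *\<^sub>R axis i 1)) has_vector_derivative cutoff_deriv R i x) (at 0)"
proof -
  have "((\<lambda>t. 1 - ((x + t *\<^sub>R axis i 1) \<bullet> (x + t *\<^sub>R axis i 1)) / R\<^sup>2) has_real_derivative - 2 * x $ i / R\<^sup>2) (at 0)"
    unfolding inner_add_left inner_add_right using R
    by (auto intro!: derivative_eq_intros simp: inner_axis inner_commute[of "axis i 1"] field_simps)
  from DERIV_chain2[OF max_0_square_has_derivative this]
  show ?thesis
    by (simp add: cutoff_def cutoff_deriv_def power2_norm_eq_inner has_real_derivative_iff_has_vector_derivative)
qed

text \<open>Inside the ball the squared gradient is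
  \<open>16 m\<^sup>2 |x|\<^sup>2 / R\<^sup>4\<close> with \<open>m \<le> 1\<close> and
  \<open>|x| \<le> R\<close>; the 16 is the square of the two factors 2.\<close>

lemma cutoff_gradient_le: "(\<Sum>i\<in>UNIV. (cutoff_deriv R i x)\<^sup>2) \<le> 16 / R\<^sup>2"
proof (cases "norm x > R")
  case True
  then show ?thesis by (simp add: cutoff_eq_0)
next
  case False
  define m where "m = max 0 (1 - (norm x)\<^sup>2 / R\<^sup>2)"
  have m: "0 \<le> m" "m \<le> 1" by (auto simp: m_def)
  have sq: "(norm x)\<^sup>2 = (\<Sum>i\<in>UNIV. (x $ i)\<^sup>2)"
    unfolding power2_norm_eq_inner inner_vec_def by (simp add: power2_eq_square)
  have "(cutoff_deriv R i x)\<^sup>2 = 16 * m\<^sup>2 / R\<^sup>2 / R\<^sup>2 * (x $ i)\<^sup>2" for i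
    unfolding cutoff_deriv_def m_def[symmetric] by (simp add: power2_eq_square)
  then have "(\<Sum>i\<in>UNIV. (cutoff_deriv R i x)\<^sup>2) = 16 * m\<^sup>2 / R\<^sup>2 / R\<^sup>2 * (norm x)\<^sup>2"
    unfolding sq by (simp add: sum_distrib_left)
  also have "\<dots> = 16 * m\<^sup>2 * ((norm x)\<^sup>2 / R\<^sup>2) / R\<^sup>2" by simp
  also have "\<dots> \<le> 16 * 1 * 1 / R\<^sup>2"
    using m False R by (intro divide_right_mono mult_mono) (auto simp: power_le_one power_mono)
  finally show ?thesis by simp
qed

end

section \<open>Logarithmic weights and their regularisation\<close>

lemma agmon_dist_continuous:
  fixes V :: "real ^ 'n \<Rightarrow> real"
  assumes V: "continuous_on UNIV V"
  shows "continuous_on UNIV (agmon_dist V E)"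
proof -
  have "isCont (agmon_dist V E) x" for x
  proof -
    have "compact ((\<lambda>z. max (V z - E) 0) ` cball x 1)"
      by (intro compact_continuous_image continuous_intros continuous_on_subset[OF V]) auto
    then have "bounded ((\<lambda>z. max (V z - E) 0) ` cball x 1)" by (rule compact_imp_bounded)
    then obtain C where C0: "C > 0" and Ci: "\<forall>y\<in>(\<lambda>z. max (V z - E) 0) ` cball x 1. norm y \<le> C"
      unfolding bounded_pos by (elim exE conjE)
    have C: "C > 0" "norm (max (V z - E) 0) \<le> C" if "z \<in> cball x 1" for z
      using C0 Ci[rule_format, OF imageI[OF that]] by auto
    have bound: "\<bar>agmon_dist V E y - agmon_dist V E x\<bar> \<le> sqrt C * dist y x" if "dist y x < 1" for y
    proof (rule agmon_dist_diff_le[OF V])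
      fix z assume "z \<in> closed_segment y x"
      moreover have "closed_segment y x \<subseteq> cball x 1"
        by (rule closed_segment_subset) (use that in \<open>auto simp: dist_commute\<close>)
      ultimately have "norm (max (V z - E) 0) \<le> C" by (intro C(2)) blast
      then show "max (V z - E) 0 \<le> (sqrt C)\<^sup>2" using C0 by simp
    qed (use C0 in simp)
    have lim: "((\<lambda>y. sqrt C * dist y x) \<longlongrightarrow> 0) (at x)"
      using tendsto_mult_left[OF tendsto_dist[OF tendsto_ident_at[of x UNIV] tendsto_const[of x]], of "sqrt C"] by simp
    have "\<forall>\<^sub>F y in at x. dist y x < 1" by (auto simp: eventually_at intro!: exI[of _ 1])
    then have "\<forall>\<^sub>F y in at x. norm (agmon_dist V E y - agmon_dist V E x) \<le> sqrt C * dist y x"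
      by eventually_elim (simp add: bound)
    then have "((\<lambda>y. agmon_dist V E y - agmon_dist V E x) \<longlongrightarrow> 0) (at x)"
      using lim by (rule Lim_null_comparison)
    then show ?thesis by (simp add: isCont_def LIM_zero_iff)
  qed
  then show ?thesis by (simp add: continuous_at_imp_continuous_on)
qed

text \<open>The quotient \<open>\<phi>' / \<phi>\<close> is the derivative of
  \<open>ln \<phi>\<close>, so its bound is a Lipschitz constant on the logarithmic scale.\<close>

lemma ln_lipschitz_of_log_derivative:
  fixes \<phi> \<phi>' :: "real \<Rightarrow> real"
  assumes der: "\<And>t. t \<ge> 0 \<Longrightarrow> (\<phi> has_real_derivative \<phi>' t) (at t within {0..})"
    and ge1: "\<And>t. t \<ge> 0 \<Longrightarrow> \<phi> t \<ge> 1" and M: "\<And>t. t \<ge> 0 \<Longrightarrow> \<bar>\<phi>' t / \<phi> t\<bar> \<le> M"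
    and st: "s \<ge> 0" "t \<ge> 0"
  shows "\<bar>ln (\<phi> s) - ln (\<phi> t)\<bar> \<le> M * \<bar>s - t\<bar>"
proof -
  have "norm (ln (\<phi> s) - ln (\<phi> t)) \<le> M * norm (s - t)"
  proof (rule field_differentiable_bound[of "{0..}" "\<lambda>t. ln (\<phi> t)" "\<lambda>t. \<phi>' t / \<phi> t"])
    show "((\<lambda>t. ln (\<phi> t)) has_field_derivative \<phi>' z / \<phi> z) (at z within {0..})" if "z \<in> {0..}" for z
      using der[of z] ge1[of z] that by (auto intro!: derivative_eq_intros)
  qed (use M st in auto)
  then show ?thesis by simp
qed

text \<open>Young's inequality, tuned so that the coefficient of \<open>b\<^sup>2\<close> can
  approach one: \<open>b\<close> will carry the gradient of the weight, and the large coefficient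
  goes to that of the cutoff.\<close>

lemma square_add_le_weighted:
  fixes a b \<eta> :: real
  assumes "\<eta> > 0"
  shows "(a + b)\<^sup>2 \<le> (1 + 1 / \<eta>) * a\<^sup>2 + (1 + \<eta>) * b\<^sup>2"
proof -
  have "0 \<le> (a - \<eta> * b)\<^sup>2 / \<eta>" using assms by simp
  also have "\<dots> = (1 + 1 / \<eta>) * a\<^sup>2 + (1 + \<eta>) * b\<^sup>2 - (a + b)\<^sup>2"
    using assms by (simp add: power2_eq_square field_simps)
  finally show ?thesis by simp
qed

text \<open>On a small enough ball around \<open>x\<close>, \<open>W\<close> stays below
  \<open>W x + \<tau>\<close>, so the segment bound makes \<open>u\<close> Lipschitz there with
  constant \<open>a * sqrt (W x + \<tau>)\<close>, and the mollified function inherits this as a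
  gradient bound. Compactness gives one radius for all \<open>x\<close> with
  \<open>norm x \<le> R\<close>.\<close>

lemma mollified_weight:
  fixes W u :: "real ^ 'n \<Rightarrow> real"
  assumes W: "continuous_on UNIV W" "\<And>x. 0 \<le> W x" and u: "continuous_on UNIV u" and a: "a \<ge> 0"
    and lip: "\<And>x y B. 0 \<le> B \<Longrightarrow> (\<And>z. z \<in> closed_segment x y \<Longrightarrow> W z \<le> B\<^sup>2) \<Longrightarrow> \<bar>u x - u y\<bar> \<le> a * B * dist x y"
    and \<tau>: "\<tau> > 0"
  obtains w w' where "continuous_on UNIV w" "\<And>i. continuous_on UNIV (w' i)"
    "\<And>i x. ((\<lambda>t. w (x + t *\<^sub>R axis i 1)) has_vector_derivative w' i x) (at 0)"
    "\<And>x. norm x \<le> R \<Longrightarrow> \<bar>w x - u x\<bar> \<le> 1"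
    "\<And>x. norm x \<le> R \<Longrightarrow> (\<Sum>i\<in>UNIV. (w' i x)\<^sup>2) \<le> a\<^sup>2 * (W x + \<tau>)"
proof -
  have u_li: "locally_integrable u" by (rule continuous_locally_integrable[OF u])
  have "uniformly_continuous_on (cball 0 (R + 1)) W" "uniformly_continuous_on (cball 0 (R + 1)) u"
    by (intro compact_uniformly_continuous continuous_on_subset[OF W(1)] continuous_on_subset[OF u]; simp)+
  note uc = this[unfolded uniformly_continuous_on_def, rule_format]
  from uc(1)[OF \<tau>] obtain d1 where d1: "d1 > 0"
    "\<And>x y. norm x \<le> R + 1 \<Longrightarrow> norm y \<le> R + 1 \<Longrightarrow> norm (y - x) < d1 \<Longrightarrow> \<bar>W y - W x\<bar> < \<tau>"
    by (auto simp: dist_norm)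
  from uc(2)[OF zero_less_one] obtain d2 where d2: "d2 > 0"
    "\<And>x y. norm x \<le> R + 1 \<Longrightarrow> norm y \<le> R + 1 \<Longrightarrow> norm (y - x) < d2 \<Longrightarrow> \<bar>u y - u x\<bar> < 1"
    by (auto simp: dist_norm)
  \<comment> \<open>Halving leaves room for the ball of radius \<open>r + r\<close>, made of the
    mollification radius and an equal margin for difference quotients.\<close>
  define r where "r = min (min d1 d2) 1 / 2"
  have r: "r > 0" "r + r \<le> d1" "r \<le> d2" "r + r \<le> 1" using d1(1) d2(1) by (auto simp: r_def)
  have near: "norm y \<le> R + 1" if "norm x \<le> R" "norm (x - y) < r + r" for x y :: "real ^ 'n"
    using that r norm_triangle_ineq2[of y x] by (simp add: norm_minus_commute)
  show ?thesis
  proof (rule that)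
    show "continuous_on UNIV (mollify r u)" by (rule mollify_continuous[OF r(1) u_li])
    show "continuous_on UNIV (\<lambda>x. \<integral>y. mollifier_deriv r (x - y) (axis i 1) *\<^sub>R u y \<partial>lborel)" for i
      by (rule mollify_deriv_continuous[OF r(1) u_li])
    show "((\<lambda>t. mollify r u (x + t *\<^sub>R axis i 1)) has_vector_derivative
        (\<integral>y. mollifier_deriv r (x - y) (axis i 1) *\<^sub>R u y \<partial>lborel)) (at 0)" for i x
      by (rule mollify_has_vector_derivative[OF r(1) u_li])
    fix x :: "real ^ 'n" assume x: "norm x \<le> R"
    have "norm (mollify r u x - u x) \<le> 1"
    proof (rule norm_mollify_diff_le[OF r(1) u_li])
      fix y assume y: "norm (x - y) < r"
      have "\<bar>u y - u x\<bar> < 1"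
        by (rule d2(2)) (use x y r near[of x y] in \<open>auto simp: norm_minus_commute\<close>)
      then show "norm (u y - u x) \<le> 1" by simp
    qed
    then show "\<bar>mollify r u x - u x\<bar> \<le> 1" by simp
    define B where "B = sqrt (W x + \<tau>)"
    have B: "B \<ge> 0" "B\<^sup>2 = W x + \<tau>" using W(2)[of x] \<tau> by (auto simp: B_def)
    have "(\<Sum>i\<in>UNIV. (\<integral>y. mollifier_deriv r (x - y) (axis i 1) *\<^sub>R u y \<partial>lborel)\<^sup>2) \<le> (a * B)\<^sup>2"
    proof (rule mollify_gradient_le[OF r(1) u _ r(1)])
      fix y z assume yz: "norm (x - y) < r + r" "norm (x - z) < r + r"
      have "closed_segment y z \<subseteq> ball x (r + r)"
        using yz by (intro closed_segment_subset) (auto simp: dist_norm)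
      then have "W v \<le> B\<^sup>2" if "v \<in> closed_segment y z" for v
      proof -
        have v: "norm (x - v) < r + r" using \<open>closed_segment y z \<subseteq> ball x (r + r)\<close> that by (auto simp: dist_norm)
        have "\<bar>W v - W x\<bar> < \<tau>"
          by (rule d1(2)) (use x v r near[of x v] in \<open>auto simp: norm_minus_commute\<close>)
        then show ?thesis unfolding B(2) by linarith
      qed
      from lip[OF B(1) this] show "\<bar>u y - u z\<bar> \<le> a * B * norm (y - z)" by (simp add: dist_norm)
    qed (use a B in auto)
    then show "(\<Sum>i\<in>UNIV. (\<integral>y. mollifier_deriv r (x - y) (axis i 1) *\<^sub>R u y \<partial>lborel)\<^sup>2) \<le> a\<^sup>2 * (W x + \<tau>)"
      by (simp add: power_mult_distrib B(2))
  qed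
qed

text \<open>A cutoff at radius \<open>R\<close> costs \<open>1 / R\<^sup>2\<close>, which compensates for the weight being as large as \<open>R\<close>.\<close>

lemma truncated_weight_estimate:
  fixes V f u :: "real ^ 'n \<Rightarrow> real" and \<psi> :: "real ^ 'n \<Rightarrow> complex"
  assumes V: "continuous_on UNIV V" and b: "\<And>x. b \<le> V x"
    and \<psi>_meas [measurable]: "\<psi> \<in> borel_measurable borel" and C: "\<And>x. norm (\<psi> x) \<le> C"
    and \<psi>_int: "integrable lborel (\<lambda>x. (norm (\<psi> x))\<^sup>2)"
    and energy: "\<And>g g' R. continuous_on UNIV g \<Longrightarrow> (\<And>i. continuous_on UNIV (g' i)) \<Longrightarrow>
       (\<And>i x. ((\<lambda>t. g (x + t *\<^sub>R axis i 1)) has_vector_derivative g' i x) (at 0)) \<Longrightarrow>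
       (\<And>x. norm x > R \<Longrightarrow> g x = 0) \<Longrightarrow> (\<And>i x. norm x > R \<Longrightarrow> g' i x = 0) \<Longrightarrow>
       (\<integral>x. (g x)\<^sup>2 * (V x - E) * (norm (\<psi> x))\<^sup>2 \<partial>lborel)
          \<le> (\<integral>x. (\<Sum>i\<in>UNIV. (g' i x)\<^sup>2) * (norm (\<psi> x))\<^sup>2 \<partial>lborel) \<and>
       integrable lborel (\<lambda>x. (g x)\<^sup>2 * (V x - E) * (norm (\<psi> x))\<^sup>2) \<and>
       integrable lborel (\<lambda>x. (\<Sum>i\<in>UNIV. (g' i x)\<^sup>2) * (norm (\<psi> x))\<^sup>2)"
    and f: "continuous_on UNIV f" "\<And>x. 1 \<le> f x" and a: "0 \<le> a" "a < 1" and \<delta>: "\<delta> > 0"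
    and lip: "\<And>x y B. 0 \<le> B \<Longrightarrow> (\<And>z. z \<in> closed_segment x y \<Longrightarrow> max (V z - E) 0 \<le> B\<^sup>2) \<Longrightarrow>
        \<bar>ln (f x) - ln (f y)\<bar> \<le> a * B * dist x y"
    and f_int: "integrable lborel (\<lambda>x. indicator {x. V x \<le> E + \<delta>} x * (f x)\<^sup>2)"
  obtains c where "c \<ge> 0" "\<And>R. R \<ge> 1 \<Longrightarrow>
    (\<integral>\<^sup>+x. ennreal (indicator {x. V x > E + \<delta>} x * ((cutoff R x)\<^sup>2 * (min (f x) R)\<^sup>2 * (norm (\<psi> x))\<^sup>2)) \<partial>lborel) \<le> ennreal c"
proof -
  have a2: "a\<^sup>2 < 1" using a by (simp add: power_less_one_iff abs_square_less_1)
  \<comment> \<open>Half of the gap \<open>1 - a\<^sup>2\<close> suffices: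
    \<open>(1 + \<eta>) * a\<^sup>2 \<le> a\<^sup>2 + \<eta> < 1\<close>.\<close>
  define \<eta> where "\<eta> = (1 - a\<^sup>2) / 2"
  have \<eta>: "\<eta> > 0" "(1 + \<eta>) * a\<^sup>2 < 1"
  proof -
    show "\<eta> > 0" using a2 by (simp add: \<eta>_def)
    then have "\<eta> * a\<^sup>2 \<le> \<eta>" using a2 by (simp add: mult_left_le)
    moreover have "(1 + \<eta>) * a\<^sup>2 = a\<^sup>2 + \<eta> * a\<^sup>2" by (simp add: distrib_right)
    moreover have "a\<^sup>2 + \<eta> < 1" using a2 by (simp add: \<eta>_def field_simps)
    ultimately show "(1 + \<eta>) * a\<^sup>2 < 1" by linarith
  qed
  define k where "k = (1 + \<eta>) * a\<^sup>2"
  have k: "0 \<le> k" "k < 1" using \<eta> by (auto simp: k_def)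
  \<comment> \<open>Where \<open>V - E > \<delta>\<close>, absorbing the gradient leaves at least
    \<open>(1 - k) * \<delta> = 2 * \<tau>\<close>; the regularisation consumes
    \<open>k * \<tau> \<le> \<tau>\<close>, and \<open>\<tau>\<close> remains.\<close>
  define \<tau> where "\<tau> = (1 - k) * \<delta> / 2"
  have \<tau>: "\<tau> > 0" using k \<delta> by (simp add: \<tau>_def)
  \<comment> \<open>On the sublevel set \<open>V - E\<close> is at least
    \<open>- \<bar>b - E\<bar>\<close> and the gradient term takes at most
    \<open>\<delta> + \<tau>\<close>, so adding \<open>B0\<close> restores nonnegativity.\<close>
  define B0 where "B0 = \<bar>b - E\<bar> + \<delta> + \<tau>"
  have B0: "B0 > 0" using \<tau> \<delta> by (simp add: B0_def)
  \<comment> \<open>Mollification moves the logarithm of the weight by at most 1, so the squared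
    weights agree up to the factor \<open>q\<close>.\<close>
  define q where "q = (exp 1 :: real)\<^sup>2"
  have q: "q > 0" by (simp add: q_def)
  \<comment> \<open>The cutoff gradient contributes \<open>16 / R\<^sup>2\<close> times the squared
    weight, which is at most \<open>q * R\<^sup>2\<close>; the bound is free of
    \<open>R\<close>.\<close>
  define C1 where "C1 = q * (16 * (1 + 1 / \<eta>))"
  have C1: "C1 \<ge> 0" using \<eta> q by (simp add: C1_def)
  let ?S = "{x. V x \<le> E + \<delta>}" and ?T = "{x. V x > E + \<delta>}"
  define c1 where "c1 = C1 * (\<integral>x. (norm (\<psi> x))\<^sup>2 \<partial>lborel) + B0 * q * C\<^sup>2 * (\<integral>x. indicator ?S x * (f x)\<^sup>2 \<partial>lborel)"
  define c where "c = c1 * q / \<tau>"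
  have c1: "c1 \<ge> 0" unfolding c1_def using C1 B0 q
    by (intro add_nonneg_nonneg mult_nonneg_nonneg Bochner_Integration.integral_nonneg) auto
  have [measurable]: "V \<in> borel_measurable borel" "f \<in> borel_measurable borel"
    using V f(1) by (auto intro: borel_measurable_continuous_onI)
  have "(\<integral>\<^sup>+x. ennreal (indicator ?T x * ((cutoff R x)\<^sup>2 * (min (f x) R)\<^sup>2 * (norm (\<psi> x))\<^sup>2)) \<partial>lborel) \<le> ennreal c"
    if R: "R \<ge> 1" for R
  proof -
    have R0: "R > 0" using R by simp
    \<comment> \<open>On the logarithm, truncation is a minimum with a constant, which preserves the
      Lipschitz bound.\<close>
    define u where "u x = min (ln (f x)) (ln R)" for x
    have f0: "f x > 0" for x using f(2)[of x] by linarith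
    have u_cont: "continuous_on UNIV u"
      unfolding u_def by (intro continuous_intros f) (use f0 less_imp_neq in \<open>metis\<close>)
    have exp_u: "exp (u x) = min (f x) R" for x
      using f0[of x] R0 by (auto simp: u_def min_def)
    have lip_u: "\<bar>u x - u y\<bar> \<le> a * B * dist x y"
      if "0 \<le> B" "\<And>z. z \<in> closed_segment x y \<Longrightarrow> max (V z - E) 0 \<le> B\<^sup>2" for x y B
    proof -
      have "\<bar>ln (f x) - ln (f y)\<bar> \<le> a * B * dist x y" by (rule lip) (use that in auto)
      then show ?thesis unfolding u_def min_def by (auto split: if_splits)
    qed
    have "continuous_on UNIV (\<lambda>x. max (V x - E) 0)" by (intro continuous_intros V)
    then obtain w w' where w: "continuous_on UNIV w" "\<And>i. continuous_on UNIV (w' i)"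
      "\<And>i x. ((\<lambda>t. w (x + t *\<^sub>R axis i 1)) has_vector_derivative w' i x) (at 0)"
      "\<And>x. norm x \<le> R \<Longrightarrow> \<bar>w x - u x\<bar> \<le> 1"
      "\<And>x. norm x \<le> R \<Longrightarrow> (\<Sum>i\<in>UNIV. (w' i x)\<^sup>2) \<le> a\<^sup>2 * (max (V x - E) 0 + \<tau>)"
      by (rule mollified_weight[where W="\<lambda>x. max (V x - E) 0" and R=R, OF _ _ u_cont a(1) lip_u \<tau>]) auto
    define g where "g x = cutoff R x * exp (w x)" for x
    define g' where "g' i x = (cutoff_deriv R i x + cutoff R x * w' i x) * exp (w x)" for i x
    note cut = cutoff_range[OF R0] cutoff_eq_0[OF R0] cutoff_continuous[OF R0]
    have g: "((\<lambda>t. g (x + t *\<^sub>R axis i 1)) has_vector_derivative g' i x) (at 0)" for i x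
      using cutoff_has_vector_derivative[OF R0, of x i] w(3)[of x i]
      unfolding has_real_derivative_iff_has_vector_derivative[symmetric] g_def g'_def
      by (auto intro!: derivative_eq_intros simp: algebra_simps)
    have en: "(\<integral>x. (g x)\<^sup>2 * (V x - E) * (norm (\<psi> x))\<^sup>2 \<partial>lborel)
          \<le> (\<integral>x. (\<Sum>i\<in>UNIV. (g' i x)\<^sup>2) * (norm (\<psi> x))\<^sup>2 \<partial>lborel) \<and>
       integrable lborel (\<lambda>x. (g x)\<^sup>2 * (V x - E) * (norm (\<psi> x))\<^sup>2) \<and>
       integrable lborel (\<lambda>x. (\<Sum>i\<in>UNIV. (g' i x)\<^sup>2) * (norm (\<psi> x))\<^sup>2)"
    proof (rule energy[OF _ _ g, of R])
      show "continuous_on UNIV g" unfolding g_def by (intro continuous_intros cut w)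
      show "continuous_on UNIV (g' i)" for i unfolding g'_def by (intro continuous_intros cut w)
    qed (auto simp: g_def g'_def cut)
    \<comment> \<open>\<open>P\<close> is the difference of the energy integrands plus two
      corrections: \<open>C1\<close> pays for the cutoff and the \<open>B0\<close> term for the
      sublevel set. Pointwise it dominates \<open>\<tau> / q * Q\<close>; by the energy inequality
      only the corrections count in the bound \<open>c1\<close> for its integral.\<close>
    define P where "P x = (g x)\<^sup>2 * (V x - E) * (norm (\<psi> x))\<^sup>2 - (\<Sum>i\<in>UNIV. (g' i x)\<^sup>2) * (norm (\<psi> x))\<^sup>2
      + C1 * (norm (\<psi> x))\<^sup>2 + B0 * q * C\<^sup>2 * (indicator ?S x * (f x)\<^sup>2)" for x
    define Q where "Q x = indicator ?T x * ((cutoff R x)\<^sup>2 * (min (f x) R)\<^sup>2 * (norm (\<psi> x))\<^sup>2)" for x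
    have P_int: "integrable lborel P" unfolding P_def
      using en \<psi>_int f_int by (intro Bochner_Integration.integrable_add Bochner_Integration.integrable_diff integrable_mult_right) auto
    have P_le: "(\<integral>x. P x \<partial>lborel) \<le> c1"
      unfolding P_def c1_def using en \<psi>_int f_int by (simp add: Bochner_Integration.integral_diff)
    have key: "\<tau> / q * Q x \<le> P x" for x
    proof (cases "norm x \<le> R")
      case False
      then show ?thesis using C1 B0 q \<tau> by (simp add: P_def Q_def g_def g'_def cut)
    next
      case True
      let ?W = "V x - E" and ?e = "(exp (w x))\<^sup>2" and ?m = "(min (f x) R)\<^sup>2"
      have wu: "w x \<le> 1 + u x" "u x \<le> 1 + w x" using w(4)[OF True] by linarith+
      have "exp (w x) \<le> exp 1 * min (f x) R" "min (f x) R \<le> exp 1 * exp (w x)"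
        using wu exp_le_cancel_iff[of "w x" "1 + u x"] exp_le_cancel_iff[of "u x" "1 + w x"]
        unfolding exp_add exp_u by auto
      then have e: "?e \<le> q * ?m" "?m \<le> q * ?e"
        unfolding q_def power_mult_distrib[symmetric] using f0[of x] R0
        by (auto intro!: power_mono)
      have m: "?m \<le> R\<^sup>2" "?m \<le> (f x)\<^sup>2" using f0[of x] R0 by (auto intro!: power_mono)
      have "(g' i x)\<^sup>2 \<le> ((1 + 1 / \<eta>) * (cutoff_deriv R i x)\<^sup>2 + (1 + \<eta>) * ((cutoff R x)\<^sup>2 * (w' i x)\<^sup>2)) * ?e" for i
        unfolding g'_def power_mult_distrib
        using square_add_le_weighted[OF \<eta>(1), of "cutoff_deriv R i x" "cutoff R x * w' i x"]
        by (intro mult_right_mono) (auto simp: power_mult_distrib)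
      then have "(\<Sum>i\<in>UNIV. (g' i x)\<^sup>2) \<le> (\<Sum>i\<in>UNIV. ((1 + 1 / \<eta>) * (cutoff_deriv R i x)\<^sup>2 + (1 + \<eta>) * ((cutoff R x)\<^sup>2 * (w' i x)\<^sup>2)) * ?e)"
        by (rule sum_mono)
      also have "\<dots> = ((1 + 1 / \<eta>) * (\<Sum>i\<in>UNIV. (cutoff_deriv R i x)\<^sup>2) + (1 + \<eta>) * ((cutoff R x)\<^sup>2 * (\<Sum>i\<in>UNIV. (w' i x)\<^sup>2))) * ?e"
        by (simp only: sum.distrib sum_distrib_left flip: sum_distrib_right)
      also have "\<dots> \<le> ((1 + 1 / \<eta>) * (16 / R\<^sup>2) + (1 + \<eta>) * ((cutoff R x)\<^sup>2 * (a\<^sup>2 * (max ?W 0 + \<tau>)))) * ?e"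
        using \<eta>(1) w(5)[OF True] cutoff_gradient_le[OF R0, of x]
        by (intro mult_right_mono add_mono mult_left_mono) auto
      also have "\<dots> = (1 + 1 / \<eta>) * (16 / R\<^sup>2) * ?e + k * (max ?W 0 + \<tau>) * ((cutoff R x)\<^sup>2 * ?e)"
        by (simp add: k_def algebra_simps)
      finally have G: "(\<Sum>i\<in>UNIV. (g' i x)\<^sup>2) \<le> (1 + 1 / \<eta>) * (16 / R\<^sup>2) * ?e + k * (max ?W 0 + \<tau>) * ((cutoff R x)\<^sup>2 * ?e)" .
      have "(1 + 1 / \<eta>) * (16 / R\<^sup>2) * ?e \<le> (1 + 1 / \<eta>) * (16 / R\<^sup>2) * (q * R\<^sup>2)"
        using e(1) m(1) q \<eta>(1) by (intro mult_left_mono) (auto intro: order_trans[OF _ mult_left_mono])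
      also have "\<dots> = C1" using R0 by (simp add: C1_def)
      finally have G1: "(1 + 1 / \<eta>) * (16 / R\<^sup>2) * ?e \<le> C1" .
      have chi: "(cutoff R x)\<^sup>2 \<le> 1" "0 \<le> (cutoff R x)\<^sup>2" using cut(1,2)[of x] by (auto simp: power_le_one)
      have psi: "(norm (\<psi> x))\<^sup>2 \<le> C\<^sup>2" "0 \<le> (norm (\<psi> x))\<^sup>2" using C[of x] by (auto intro: power_mono)
      have ktau: "k * \<tau> \<le> \<tau>" using k \<tau> by (simp add: mult_left_le_one_le)
      have gx: "(g x)\<^sup>2 = (cutoff R x)\<^sup>2 * ?e" by (simp add: g_def power_mult_distrib)
      have ce: "0 \<le> (cutoff R x)\<^sup>2 * ?e" by simp
      show ?thesis
      proof (cases "V x \<le> E + \<delta>")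
        case False
        then have W: "max ?W 0 = ?W" "?W > \<delta>" using \<delta> by auto
        have "(1 - k) * \<delta> \<le> (1 - k) * ?W" using W k by (intro mult_left_mono) auto
        then have "2 * \<tau> \<le> (1 - k) * ?W" by (simp add: \<tau>_def)
        then have "\<tau> \<le> (1 - k) * ?W - k * \<tau>" using ktau by simp
        also have "\<dots> = ?W - k * (?W + \<tau>)" by (simp add: algebra_simps)
        finally have "\<tau> \<le> ?W - k * (?W + \<tau>)" .
        then have "\<tau> * ((cutoff R x)\<^sup>2 * ?e) \<le> (?W - k * (?W + \<tau>)) * ((cutoff R x)\<^sup>2 * ?e)"
          using ce by (rule mult_right_mono)
        also have "\<dots> \<le> (g x)\<^sup>2 * ?W - (\<Sum>i\<in>UNIV. (g' i x)\<^sup>2) + C1"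
          using G G1 unfolding W(1) gx by (simp add: algebra_simps)
        finally have 1: "\<tau> * ((cutoff R x)\<^sup>2 * ?e) \<le> (g x)\<^sup>2 * ?W - (\<Sum>i\<in>UNIV. (g' i x)\<^sup>2) + C1" .
        have "\<tau> / q * ((cutoff R x)\<^sup>2 * ?m) \<le> \<tau> / q * ((cutoff R x)\<^sup>2 * (q * ?e))"
          using e(2) \<tau> q by (intro mult_left_mono) auto
        also have "\<dots> = \<tau> * ((cutoff R x)\<^sup>2 * ?e)" using q by simp
        finally have "\<tau> / q * ((cutoff R x)\<^sup>2 * ?m) \<le> (g x)\<^sup>2 * ?W - (\<Sum>i\<in>UNIV. (g' i x)\<^sup>2) + C1"
          using 1 by linarith
        from mult_right_mono[OF this psi(2)] show ?thesis
          using False by (simp add: P_def Q_def algebra_simps)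
      next
        case True
        define y where "y = k * (max ?W 0 + \<tau>)"
        have "y \<le> 1 * (\<delta> + \<tau>)"
          unfolding y_def using True k \<tau> \<delta> by (intro mult_mono) auto
        then have y: "0 \<le> \<delta> + \<tau> - y" by simp
        have "b - E \<le> ?W" using b[of x] by simp
        then have "0 \<le> ?W + \<bar>b - E\<bar>" using abs_ge_minus_self[of "b - E"] by linarith
        from add_nonneg_nonneg[OF this y] have "0 \<le> ?W - k * (max ?W 0 + \<tau>) + B0"
          unfolding y_def[symmetric] B0_def by (simp add: algebra_simps)
        then have "0 \<le> (?W - k * (max ?W 0 + \<tau>) + B0) * ((cutoff R x)\<^sup>2 * ?e)"
          using ce by (rule mult_nonneg_nonneg)
        also have "\<dots> \<le> (g x)\<^sup>2 * ?W - (\<Sum>i\<in>UNIV. (g' i x)\<^sup>2) + C1 + B0 * ((cutoff R x)\<^sup>2 * ?e)"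
          using G G1 unfolding gx by (simp add: algebra_simps)
        finally have 1: "0 \<le> (g x)\<^sup>2 * ?W - (\<Sum>i\<in>UNIV. (g' i x)\<^sup>2) + C1 + B0 * ((cutoff R x)\<^sup>2 * ?e)" .
        have "(cutoff R x)\<^sup>2 * ?e \<le> 1 * (q * (f x)\<^sup>2)"
          using chi e(1) m(2) q by (intro mult_mono) (auto intro: order_trans[OF _ mult_left_mono])
        then have "(cutoff R x)\<^sup>2 * ?e \<le> q * (f x)\<^sup>2" by simp
        then have "(cutoff R x)\<^sup>2 * ?e * (norm (\<psi> x))\<^sup>2 \<le> (q * (f x)\<^sup>2) * C\<^sup>2"
          by (rule mult_mono) (use psi q in auto)
        then have 2: "B0 * ((cutoff R x)\<^sup>2 * ?e * (norm (\<psi> x))\<^sup>2) \<le> B0 * ((q * (f x)\<^sup>2) * C\<^sup>2)"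
          using B0 by (intro mult_left_mono) auto
        from mult_right_mono[OF 1 psi(2)] 2 show ?thesis
          using True by (simp add: P_def Q_def algebra_simps)
      qed
    qed
    have Q0: "0 \<le> Q x" for x by (simp add: Q_def)
    have "(\<integral>\<^sup>+x. ennreal (Q x) \<partial>lborel) \<le> (\<integral>\<^sup>+x. ennreal (q / \<tau> * P x) \<partial>lborel)"
    proof (intro nn_integral_mono ennreal_leI)
      fix x show "Q x \<le> q / \<tau> * P x" using key[of x] q \<tau> by (simp add: field_simps)
    qed
    also have "\<dots> = ennreal (\<integral>x. q / \<tau> * P x \<partial>lborel)"
    proof (rule nn_integral_eq_integral)
      have "0 \<le> P x" for x using key[of x] Q0[of x] q \<tau> by (meson divide_nonneg_nonneg less_imp_le mult_nonneg_nonneg order_trans)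
      then show "AE x in lborel. 0 \<le> q / \<tau> * P x" using q \<tau> by simp
    qed (use P_int in simp)
    also have "\<dots> \<le> ennreal c"
    proof (rule ennreal_leI)
      have "(\<integral>x. q / \<tau> * P x \<partial>lborel) = q / \<tau> * (\<integral>x. P x \<partial>lborel)" by simp
      also have "\<dots> \<le> q / \<tau> * c1" using P_le q \<tau> by (intro mult_left_mono) auto
      finally show "(\<integral>x. q / \<tau> * P x \<partial>lborel) \<le> c" by (simp add: c_def mult.commute)
    qed
    finally show ?thesis by (simp add: Q_def)
  qed
  moreover have "c \<ge> 0" using c1 q \<tau> by (simp add: c_def)
  ultimately show ?thesis using that by blast
qed

section \<open>Decay of the eigenfunction\<close>

lemma cutoff_tendsto_1: "(\<lambda>m. cutoff (real (Suc m)) x) \<longlonglongrightarrow> 1"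
proof -
  have "(\<lambda>m. inverse (real (Suc m)) * inverse (real (Suc m))) \<longlonglongrightarrow> 0 * 0"
    by (intro tendsto_mult LIMSEQ_inverse_real_of_nat)
  from tendsto_mult_left[OF this, of "(norm x)\<^sup>2"]
  have "(\<lambda>m. (norm x)\<^sup>2 / (real (Suc m))\<^sup>2) \<longlonglongrightarrow> 0"
    by (simp add: divide_inverse power2_eq_square del: of_nat_Suc)
  then have "(\<lambda>m. (max 0 (1 - (norm x)\<^sup>2 / (real (Suc m))\<^sup>2))\<^sup>2) \<longlonglongrightarrow> (max 0 (1 - 0))\<^sup>2"
    by (intro tendsto_intros)
  then show ?thesis by (simp add: cutoff_def del: of_nat_Suc)
qed

theorem theorem2p3:
  fixes V :: "real ^ 'n \<Rightarrow> real"
    and E :: real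
    and \<psi> :: "real ^ 'n \<Rightarrow> complex"
    and \<phi> \<phi>' :: "real \<Rightarrow> real"
    and M \<epsilon> \<delta> :: real
  assumes V_cont: "continuous_on UNIV V"
    and V_bdd_below: "bdd_below (range V)"
    and V_rel_bdd: "relatively_bounded (mult_operator V) neg_laplacian"
    and V_rel_bound: "relative_bound (mult_operator V) neg_laplacian < 1"
    and psi_eigen: "eigenfunction (schroedinger V) E \<psi>"
    and psi_bdd: "essentially_bounded \<psi>"
    and phi_deriv: "\<And>t. t \<ge> 0 \<Longrightarrow> (\<phi> has_real_derivative \<phi>' t) (at t within {0..})"
    and phi'_cont: "continuous_on {0..} \<phi>'"
    and phi_mono: "mono_on {0..} \<phi>"
    and phi_ge_1: "\<And>t. t \<ge> 0 \<Longrightarrow> \<phi> t \<ge> 1"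
    and phi_lim: "filterlim \<phi> at_top at_top"
    and M_finite: "bdd_above ((\<lambda>t. \<bar>\<phi>' t / \<phi> t\<bar>) ` {0..})"
    and M_def: "M = (SUP t\<in>{0..}. \<bar>\<phi>' t / \<phi> t\<bar>)"
    and M_pos: "0 < M"
    and eps_pos: "\<epsilon> > 0"
    and delta_pos: "\<delta> > 0"
    and eps_lower: "max 0 (1 - 1 / M\<^sup>2) < \<epsilon>"
    and eps_upper: "\<epsilon> < 1"
    and sublevel_L2:
      "(\<lambda>x. indicator {x. V x \<le> E + \<delta>} x * \<phi> ((1 - \<epsilon>) * agmon_dist V E x)) \<in> L2"
  shows "\<exists>c>0. (\<integral>\<^sup>+ x. ennreal ((\<phi> ((1 - \<epsilon>) * agmon_dist V E x))\<^sup>2 * (norm (\<psi> x))\<^sup>2) \<partial>lebesgue)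
                 \<le> ennreal c"
proof -
  let ?f = "\<lambda>x. \<phi> ((1 - \<epsilon>) * agmon_dist V E x)"
  let ?S = "{x. V x \<le> E + \<delta>}" and ?T = "{x. V x > E + \<delta>}"
  define a where "a = M * (1 - \<epsilon>)"
  have e: "0 < 1 - \<epsilon>" "1 - \<epsilon> < 1" using eps_pos eps_upper by auto
  \<comment> \<open>The lower bound on \<open>\<epsilon>\<close> amounts to
    \<open>M\<^sup>2 * (1 - \<epsilon>) < 1\<close>; one more factor
    \<open>1 - \<epsilon> < 1\<close> gives \<open>a\<^sup>2 < 1\<close>.\<close>
  have "1 - \<epsilon> < 1 / M\<^sup>2" using eps_lower by auto
  then have "M\<^sup>2 * (1 - \<epsilon>) < 1" using M_pos by (simp add: pos_less_divide_eq mult.commute)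
  moreover have "a\<^sup>2 = (M\<^sup>2 * (1 - \<epsilon>)) * (1 - \<epsilon>)" by (simp add: a_def power2_eq_square)
  moreover have "(M\<^sup>2 * (1 - \<epsilon>)) * (1 - \<epsilon>) \<le> M\<^sup>2 * (1 - \<epsilon>)" using e by (intro mult_left_le) auto
  ultimately have "a\<^sup>2 < 1\<^sup>2" by simp
  moreover have a0: "a \<ge> 0" using M_pos e by (simp add: a_def)
  ultimately have a1: "a < 1" by (intro power_less_imp_less_base[of a 2 1]) auto
  have M: "\<bar>\<phi>' t / \<phi> t\<bar> \<le> M" if "t \<ge> 0" for t
    unfolding M_def by (rule cSUP_upper[OF _ M_finite]) (use that in simp)
  have pos: "0 \<le> (1 - \<epsilon>) * agmon_dist V E x" for x by (intro mult_nonneg_nonneg agmon_dist_nonneg) (use e in simp)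
  have f1: "1 \<le> ?f x" for x by (rule phi_ge_1[OF pos])
  have "continuous_on {0..} \<phi>"
    by (rule DERIV_continuous_on[of _ _ \<phi>']) (use phi_deriv in auto)
  then have f_cont: "continuous_on UNIV ?f"
    by (rule continuous_on_compose2) (use pos in \<open>auto intro!: continuous_intros agmon_dist_continuous[OF V_cont]\<close>)
  have [measurable]: "?f \<in> borel_measurable borel" "V \<in> borel_measurable borel"
    using f_cont V_cont by (auto intro: borel_measurable_continuous_onI)
  \<comment> \<open>The slopes multiply: \<open>M\<close> from \<open>ln \<phi>\<close>,
    \<open>1 - \<epsilon>\<close> from its argument, and \<open>B\<close> from the distance along
    the segment.\<close>
  have lip: "\<bar>ln (?f x) - ln (?f y)\<bar> \<le> a * B * dist x y"
    if "0 \<le> B" "\<And>z. z \<in> closed_segment x y \<Longrightarrow> max (V z - E) 0 \<le> B\<^sup>2" for x y B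
  proof -
    have "\<bar>ln (?f x) - ln (?f y)\<bar> \<le> M * \<bar>(1 - \<epsilon>) * agmon_dist V E x - (1 - \<epsilon>) * agmon_dist V E y\<bar>"
      by (rule ln_lipschitz_of_log_derivative[OF phi_deriv phi_ge_1 M pos pos])
    also have "\<dots> = a * \<bar>agmon_dist V E x - agmon_dist V E y\<bar>"
      using e by (simp add: a_def abs_mult flip: right_diff_distrib)
    also have "\<dots> \<le> a * (B * dist x y)"
      by (intro mult_left_mono agmon_dist_diff_le[OF V_cont that] a0)
    finally show ?thesis by (simp add: mult.assoc)
  qed
  obtain b where b: "\<And>x. b \<le> V x" using V_bdd_below by (auto simp: bdd_below_def)
  have f_int: "integrable lborel (\<lambda>x. indicator ?S x * (?f x)\<^sup>2)"
  proof -
    have "integrable lebesgue (\<lambda>x. (norm (indicator ?S x * ?f x))\<^sup>2)"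
      using sublevel_L2 by (simp add: L2_def)
    also have "(\<lambda>x. (norm (indicator ?S x * ?f x))\<^sup>2) = (\<lambda>x. indicator ?S x * (?f x)\<^sup>2)"
      by (auto simp: fun_eq_iff indicator_def)
    finally show ?thesis by (subst (asm) integrable_completion) auto
  qed
  obtain \<psi>' C where \<psi>': "\<psi>' \<in> borel_measurable borel" and \<psi>'_ae: "AE x in lebesgue. \<psi> x = \<psi>' x"
    and C: "\<And>x. norm (\<psi>' x) \<le> C" and \<psi>'_int: "integrable lborel (\<lambda>x. (norm (\<psi>' x))\<^sup>2)"
    and energy: "\<And>g g' R. continuous_on UNIV g \<Longrightarrow> (\<And>i. continuous_on UNIV (g' i)) \<Longrightarrow>
       (\<And>i x. ((\<lambda>t. g (x + t *\<^sub>R axis i 1)) has_vector_derivative g' i x) (at 0)) \<Longrightarrow>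
       (\<And>x. norm x > R \<Longrightarrow> g x = 0) \<Longrightarrow> (\<And>i x. norm x > R \<Longrightarrow> g' i x = 0) \<Longrightarrow>
       (\<integral>x. (g x)\<^sup>2 * (V x - E) * (norm (\<psi>' x))\<^sup>2 \<partial>lborel)
          \<le> (\<integral>x. (\<Sum>i\<in>UNIV. (g' i x)\<^sup>2) * (norm (\<psi>' x))\<^sup>2 \<partial>lborel) \<and>
       integrable lborel (\<lambda>x. (g x)\<^sup>2 * (V x - E) * (norm (\<psi>' x))\<^sup>2) \<and>
       integrable lborel (\<lambda>x. (\<Sum>i\<in>UNIV. (g' i x)\<^sup>2) * (norm (\<psi>' x))\<^sup>2)"
    by (rule eigenfunction_energy_inequality[OF V_cont psi_eigen psi_bdd]) blast
  note [measurable] = \<psi>'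
  obtain c where c: "c \<ge> 0" and bound: "\<And>R. R \<ge> 1 \<Longrightarrow>
    (\<integral>\<^sup>+x. ennreal (indicator ?T x * ((cutoff R x)\<^sup>2 * (min (?f x) R)\<^sup>2 * (norm (\<psi>' x))\<^sup>2)) \<partial>lborel) \<le> ennreal c"
    by (rule truncated_weight_estimate[OF V_cont b \<psi>' C \<psi>'_int energy f_cont f1 a0 a1 delta_pos lip f_int]) blast+
  \<comment> \<open>Radii \<open>Suc m\<close> are at least 1, as the uniform bound
    requires.\<close>
  define h where "h m x = ennreal (indicator ?T x *
      ((cutoff (real (Suc m)) x)\<^sup>2 * (min (?f x) (real (Suc m)))\<^sup>2 * (norm (\<psi>' x))\<^sup>2))" for m x
  have [measurable]: "h m \<in> borel_measurable borel" for m
  proof -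
    have [measurable]: "cutoff (real (Suc m)) \<in> borel_measurable borel"
      by (rule borel_measurable_continuous_onI[OF cutoff_continuous(1)]) simp
    show ?thesis unfolding h_def by measurable
  qed
  have lim: "(\<lambda>m. h m x) \<longlonglongrightarrow> ennreal (indicator ?T x * ((?f x)\<^sup>2 * (norm (\<psi>' x))\<^sup>2))" for x
  proof -
    \<comment> \<open>At a fixed point the truncation is inactive as soon as the radius exceeds the
      weight there.\<close>
    obtain m0 where m0: "?f x \<le> real m0" using real_arch_simple by blast
    have "\<forall>\<^sub>F m in sequentially. ?f x = min (?f x) (real (Suc m))"
      using eventually_ge_at_top[of m0] by eventually_elim (use m0 in \<open>auto simp: min_def\<close>)
    then have "(\<lambda>m. min (?f x) (real (Suc m))) \<longlonglongrightarrow> ?f x"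
      by (rule Lim_transform_eventually[OF tendsto_const])
    then have "(\<lambda>m. indicator ?T x * ((cutoff (real (Suc m)) x)\<^sup>2 * (min (?f x) (real (Suc m)))\<^sup>2 * (norm (\<psi>' x))\<^sup>2))
        \<longlonglongrightarrow> indicator ?T x * (1\<^sup>2 * (?f x)\<^sup>2 * (norm (\<psi>' x))\<^sup>2)"
      by (intro tendsto_intros cutoff_tendsto_1)
    then show ?thesis unfolding h_def by (intro tendsto_ennrealI) simp
  qed
  have T: "(\<integral>\<^sup>+x. ennreal (indicator ?T x * ((?f x)\<^sup>2 * (norm (\<psi>' x))\<^sup>2)) \<partial>lborel) \<le> ennreal c"
  proof -
    have "(\<integral>\<^sup>+x. ennreal (indicator ?T x * ((?f x)\<^sup>2 * (norm (\<psi>' x))\<^sup>2)) \<partial>lborel) = (\<integral>\<^sup>+x. liminf (\<lambda>m. h m x) \<partial>lborel)"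
      by (intro nn_integral_cong) (use lim_imp_Liminf[OF _ lim] in simp)
    also have "\<dots> \<le> liminf (\<lambda>m. \<integral>\<^sup>+x. h m x \<partial>lborel)"
      by (rule nn_integral_liminf) simp
    also have "\<dots> \<le> liminf (\<lambda>m. ennreal c)"
      by (intro Liminf_mono always_eventually allI) (use bound in \<open>simp add: h_def\<close>)
    also have "\<dots> = ennreal c" by (simp add: Liminf_const)
    finally show ?thesis .
  qed
  have S: "(\<integral>\<^sup>+x. ennreal (indicator ?S x * ((?f x)\<^sup>2 * (norm (\<psi>' x))\<^sup>2)) \<partial>lborel)
      \<le> ennreal (C\<^sup>2 * (\<integral>x. indicator ?S x * (?f x)\<^sup>2 \<partial>lborel))"
  proof -
    have "(\<integral>\<^sup>+x. ennreal (indicator ?S x * ((?f x)\<^sup>2 * (norm (\<psi>' x))\<^sup>2)) \<partial>lborel)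
        \<le> (\<integral>\<^sup>+x. ennreal (C\<^sup>2 * (indicator ?S x * (?f x)\<^sup>2)) \<partial>lborel)"
    proof (intro nn_integral_mono ennreal_leI)
      fix x
      have "(?f x)\<^sup>2 * (norm (\<psi>' x))\<^sup>2 \<le> (?f x)\<^sup>2 * C\<^sup>2" using C by (intro mult_left_mono power_mono) auto
      then show "indicator ?S x * ((?f x)\<^sup>2 * (norm (\<psi>' x))\<^sup>2) \<le> C\<^sup>2 * (indicator ?S x * (?f x)\<^sup>2)"
        by (simp add: indicator_def mult.commute)
    qed
    also have "\<dots> = ennreal (\<integral>x. C\<^sup>2 * (indicator ?S x * (?f x)\<^sup>2) \<partial>lborel)"
      using f_int by (intro nn_integral_eq_integral integrable_mult_right) auto
    finally show ?thesis by simp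
  qed
  define I where "I = (\<integral>x. indicator ?S x * (?f x)\<^sup>2 \<partial>lborel)"
  have I: "0 \<le> I" by (simp add: I_def)
  have "(\<integral>\<^sup>+ x. ennreal ((?f x)\<^sup>2 * (norm (\<psi> x))\<^sup>2) \<partial>lebesgue) = (\<integral>\<^sup>+ x. ennreal ((?f x)\<^sup>2 * (norm (\<psi>' x))\<^sup>2) \<partial>lebesgue)"
    by (rule nn_integral_cong_AE) (use \<psi>'_ae in \<open>auto elim: eventually_mono\<close>)
  also have "\<dots> = (\<integral>\<^sup>+ x. ennreal ((?f x)\<^sup>2 * (norm (\<psi>' x))\<^sup>2) \<partial>lborel)" by (rule nn_integral_completion)
  also have "\<dots> = (\<integral>\<^sup>+ x. ennreal (indicator ?T x * ((?f x)\<^sup>2 * (norm (\<psi>' x))\<^sup>2))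
      + ennreal (indicator ?S x * ((?f x)\<^sup>2 * (norm (\<psi>' x))\<^sup>2)) \<partial>lborel)"
    by (intro nn_integral_cong) (auto simp: indicator_def)
  also have "\<dots> = (\<integral>\<^sup>+ x. ennreal (indicator ?T x * ((?f x)\<^sup>2 * (norm (\<psi>' x))\<^sup>2)) \<partial>lborel)
      + (\<integral>\<^sup>+ x. ennreal (indicator ?S x * ((?f x)\<^sup>2 * (norm (\<psi>' x))\<^sup>2)) \<partial>lborel)"
    by (rule nn_integral_add) measurable
  also have "\<dots> \<le> ennreal c + ennreal (C\<^sup>2 * I)" using T S unfolding I_def by (rule add_mono)
  also have "\<dots> = ennreal (c + C\<^sup>2 * I)" using c I by (subst ennreal_plus) auto
  \<comment> \<open>The added 1 makes the constant positive even if both contributions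
    vanish.\<close>
  also have "\<dots> \<le> ennreal (c + C\<^sup>2 * I + 1)" by (rule ennreal_leI) simp
  finally show ?thesis using c I by (intro exI[of _ "c + C\<^sup>2 * I + 1"]) (auto intro: add_nonneg_pos)
qed

end
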